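(* Let $\mathbb{K}$ be any field, let $A$ be a commutative Noetherian ring containing $\mathbb{K}$, and let $P$ be any finite poset. Assume that the inverse system $V\in\operatorname{Inv}(\widehat P,\mathcal{A})$ is acyclic with respect to the limit on $P$, that there is a natural equivalence of functors $\operatorname{colim}_{p\in P}\circ\,\mathcal{T}\cong T\circ\lim_{p\in P}$, that for any $p\in P$, $\mathbb{R}^jT(V_p)=0$ up to a single value of $j$ (namely, $h_p$), and that for any $p\ne q$, $\operatorname{Hom}_A(\mathbb{R}^{h_p}T(V_p),\mathbb{R}^{h_q}T(V_q))=0$. Then there is a $\mathbb{K}$-vector space isomorphism $$\mathbb{R}^jT\left(\lim_{p\in P}V_p\right)\cong\bigoplus_{q\in P}\mathbb{R}^{h_q}T(V_q)^{\oplus m_{j,q}},$$ where $m_{j,q}=\dim_{\mathbb{K}}\widetilde H_{h_q-j-1}((q,1_{\widehat P});\mathbb{K})$.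
   Context: $\mathcal{A}$ is the category of $A$-modules. For a poset $Q$ viewed as a small category (one morphism $p\to q$ if $p\le q$), $\operatorname{Dir}(Q,\mathcal{A})$ (resp. $\operatorname{Inv}(Q,\mathcal{A})$) is the abelian category of covariant (resp. contravariant) functors $Q\to\mathcal{A}$. $\widehat P=P\cup\{0_{\widehat P},1_{\widehat P}\}$ is $P$ with an initial and a terminal element added; limits and colimits are taken over $P$. $V$ is acyclic with respect to the limit if the right derived functors satisfy $\mathbb{R}^i\lim_{p\in P}V_p=0$ for all $i\ge 1$. For $q\in P$, $(q,1_{\widehat P})=\{z\in P:q<z\}$, and $\widetilde H_*$ denotes reduced simplicial homology of its order complex; for the empty complex it is $\mathbb{K}$ in degree $-1$ and zero otherwise. Setup. $T:\mathcal{A}\to\mathcal{A}$ is a contravariant, left exact functor (with right derived functors $\mathbb{R}^jT$ computed by projective resolutions), and $\mathcal{T}:\operatorname{Inv}(P,\mathcal{A})\to\operatorname{Dir}(P,\mathcal{A})$ is the functor $(G_p)_{p\in P}\mapsto(T(G_p))_{p\in P}$. It is assumed that $T$ commutes with finite direct sums and that $T(A)=Z$ for some $A$-module $Z$; in particular, $\operatorname{colim}_{p\in P}\mathcal{T}(A_{\le q})=Z$ for $q\in P$ ($Z$ depending only on $T$ and not on $q$), where $A_{\le q}$ is the inverse system with value $A$ at all $p\le q$, zero elsewhere, and identity structural maps between nonzero values. *)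

theory Defs
  imports
    "HOL-Algebra.Ring_Divisibility"
    "HOL-Algebra.Subrings"
    "HOL-Library.Extended"
    "HOL-Library.Equipollence"
    "Jordan_Normal_Form.Missing_VectorSpace"
begin

section \<open>Modules\<close>

text \<open>
  The category of \<open>A\<close>-modules is represented by the modules whose carrier lives in a type \<open>'m\<close>.
  The condition below says that \<open>'m\<close> has at least \<open>max \<aleph>\<^sub>0 |A|\<close> elements. Then this category is closed
  up to isomorphism under submodules, quotients, finite direct sums and free modules on sets of size
  at most \<open>|'m|\<close>. So it has finite limits and colimits and enough projectives and, for Noetherian
  \<open>A\<close>, enough injectives.
\<close>

definition large_universe :: "'a ring \<Rightarrow> 'm itself \<Rightarrow> bool" where
  "large_universe A u \<longleftrightarrow> infinite (UNIV :: 'm set) \<and> carrier A \<lesssim> (UNIV :: 'm set)"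

text \<open>
  Morphisms are taken to be extensional functions, so that equality of functions is equality of
  morphisms; composition is \<^const>\<open>compose\<close>.
\<close>

definition lhom :: "'a ring \<Rightarrow> ('a, 'm) module \<Rightarrow> ('a, 'n) module \<Rightarrow> ('m \<Rightarrow> 'n) set" where
  "lhom A M N = module_hom A M N \<inter> extensional (carrier M)"

definition liso :: "'a ring \<Rightarrow> ('a, 'm) module \<Rightarrow> ('a, 'n) module \<Rightarrow> ('m \<Rightarrow> 'n) set" where
  "liso A M N = {f \<in> lhom A M N. bij_betw f (carrier M) (carrier N)}"

definition lker :: "('a, 'm) module \<Rightarrow> ('a, 'n) module \<Rightarrow> ('m \<Rightarrow> 'n) \<Rightarrow> 'm set" where
  "lker M N f = {x \<in> carrier M. f x = \<zero>\<^bsub>N\<^esub>}"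

definition zero_module :: "('a, 'm) module \<Rightarrow> bool" where
  "zero_module M \<longleftrightarrow> carrier M = {\<zero>\<^bsub>M\<^esub>}"

text \<open>
  The quotient \<open>Z / B\<close> for submodules \<open>B \<subseteq> Z\<close> of \<open>M\<close>. Its elements are the cosets \<open>B + x\<close>, and
  \<open>a (B + x)\<close> is formed as \<open>B + {a y | y \<in> B + x}\<close>. The multiplicative part of a module record
  carries no meaning.
\<close>

definition subquot :: "('a, 'm) module \<Rightarrow> 'm set \<Rightarrow> 'm set \<Rightarrow> ('a, 'm set) module" where
  "subquot M Z B =
    \<lparr>carrier = (\<lambda>x. B +>\<^bsub>M\<^esub> x) ` Z, mult = undefined, one = undefined,
     zero = B, add = (\<lambda>X Y. X <+>\<^bsub>M\<^esub> Y),
     smult = (\<lambda>a X. B <+>\<^bsub>M\<^esub> ((\<lambda>x. a \<odot>\<^bsub>M\<^esub> x) ` X))\<rparr>"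

text \<open>Direct sum of a family with finite index set, as the product module.\<close>

definition finite_direct_sum :: "'i set \<Rightarrow> ('i \<Rightarrow> ('a, 'm) module) \<Rightarrow> ('a, 'i \<Rightarrow> 'm) module" where
  "finite_direct_sum I M =
    \<lparr>carrier = (\<Pi>\<^sub>E i\<in>I. carrier (M i)), mult = undefined, one = undefined,
     zero = (\<lambda>i\<in>I. \<zero>\<^bsub>M i\<^esub>), add = (\<lambda>x y. \<lambda>i\<in>I. x i \<oplus>\<^bsub>M i\<^esub> y i),
     smult = (\<lambda>a x. \<lambda>i\<in>I. a \<odot>\<^bsub>M i\<^esub> x i)\<rparr>"

text \<open>Cohomology at \<open>C j\<close> of \<open>0 \<rightarrow> C 0 \<rightarrow> C 1 \<rightarrow> \<dots>\<close>, where \<open>\<delta> j\<close> maps \<open>C j\<close> to \<open>C (Suc j)\<close>.\<close>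

definition cohomology ::
    "(nat \<Rightarrow> ('a, 'm) module) \<Rightarrow> (nat \<Rightarrow> 'm \<Rightarrow> 'm) \<Rightarrow> nat \<Rightarrow> ('a, 'm set) module" where
  "cohomology C \<delta> j =
    subquot (C j) (lker (C j) (C (Suc j)) (\<delta> j))
      (case j of 0 \<Rightarrow> {\<zero>\<^bsub>C 0\<^esub>} | Suc i \<Rightarrow> \<delta> i ` carrier (C i))"


section \<open>Contravariant functors on modules and their right derived functors\<close>

text \<open>
  For \<open>f : M \<rightarrow> N\<close>, the map \<open>far T M N f\<close> goes from \<open>fob T N\<close> to \<open>fob T M\<close>. Source and target may
  be represented in different types, because a functor such as \<open>Hom\<^sub>A(-, N)\<close> need not preserve a
  bound on the cardinality.
\<close>

record ('a, 'm, 'n) mfunctor =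
  fob :: "('a, 'm) module \<Rightarrow> ('a, 'n) module"
  far :: "('a, 'm) module \<Rightarrow> ('a, 'm) module \<Rightarrow> ('m \<Rightarrow> 'm) \<Rightarrow> 'n \<Rightarrow> 'n"

definition contravariant_functor :: "'a ring \<Rightarrow> ('a, 'm, 'n) mfunctor \<Rightarrow> bool" where
  "contravariant_functor A T \<longleftrightarrow>
    (\<forall>M. module A M \<longrightarrow> module A (fob T M)) \<and>
    (\<forall>M N f. module A M \<longrightarrow> module A N \<longrightarrow> f \<in> lhom A M N \<longrightarrow>
       far T M N f \<in> lhom A (fob T N) (fob T M)) \<and>
    (\<forall>M. module A M \<longrightarrow> far T M M (\<lambda>x\<in>carrier M. x) = (\<lambda>y\<in>carrier (fob T M). y)) \<and>
    (\<forall>L M N f g. module A L \<longrightarrow> module A M \<longrightarrow> module A N \<longrightarrow>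
       f \<in> lhom A L M \<longrightarrow> g \<in> lhom A M N \<longrightarrow>
       far T L N (compose (carrier L) g f) =
         compose (carrier (fob T N)) (far T L M f) (far T M N g))"

definition left_exact :: "'a ring \<Rightarrow> ('a, 'm, 'n) mfunctor \<Rightarrow> bool" where
  "left_exact A T \<longleftrightarrow>
    (\<forall>L M N f g. module A L \<longrightarrow> module A M \<longrightarrow> module A N \<longrightarrow>
       f \<in> lhom A L M \<longrightarrow> g \<in> lhom A M N \<longrightarrow>
       f ` carrier L = lker M N g \<longrightarrow> g ` carrier M = carrier N \<longrightarrow>
       inj_on (far T M N g) (carrier (fob T N)) \<and>
       far T M N g ` carrier (fob T N) = lker (fob T M) (fob T L) (far T L M f))"

definition direct_sum_of ::
    "'a ring \<Rightarrow> nat \<Rightarrow> (nat \<Rightarrow> ('a, 'm) module) \<Rightarrow> ('a, 'm) module \<Rightarrow> (nat \<Rightarrow> 'm \<Rightarrow> 'm) \<Rightarrow> bool" where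
  "direct_sum_of A n M S \<iota> \<longleftrightarrow>
    module A S \<and> (\<forall>i<n. module A (M i) \<and> \<iota> i \<in> lhom A (M i) S) \<and>
    bij_betw (\<lambda>x. \<Oplus>\<^bsub>S\<^esub>i\<in>{..<n}. \<iota> i (x i)) (\<Pi>\<^sub>E i\<in>{..<n}. carrier (M i)) (carrier S)"

text \<open>The canonical map \<open>T(M\<^sub>0 \<oplus> \<dots> \<oplus> M\<^sub>n\<^sub>-\<^sub>1) \<rightarrow> T(M\<^sub>0) \<oplus> \<dots> \<oplus> T(M\<^sub>n\<^sub>-\<^sub>1)\<close> is bijective.\<close>

definition commutes_with_finite_direct_sums :: "'a ring \<Rightarrow> ('a, 'm, 'n) mfunctor \<Rightarrow> bool" where
  "commutes_with_finite_direct_sums A T \<longleftrightarrow>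
    (\<forall>n M S \<iota>. direct_sum_of A n M S \<iota> \<longrightarrow>
       bij_betw (\<lambda>y. \<lambda>i\<in>{..<n}. far T (M i) S (\<iota> i) y)
         (carrier (fob T S)) (\<Pi>\<^sub>E i\<in>{..<n}. carrier (fob T (M i))))"

definition projective_module :: "'a ring \<Rightarrow> ('a, 'm) module \<Rightarrow> bool" where
  "projective_module A F \<longleftrightarrow> module A F \<and>
    (\<forall>(N :: ('a, 'm) module) (L :: ('a, 'm) module) g f.
       module A N \<longrightarrow> module A L \<longrightarrow> g \<in> lhom A N L \<longrightarrow> g ` carrier N = carrier L \<longrightarrow>
       f \<in> lhom A F L \<longrightarrow> (\<exists>e \<in> lhom A F N. compose (carrier F) g e = f))"

definition projective_resolution ::
    "'a ring \<Rightarrow> ('a, 'm) module \<Rightarrow>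
     (nat \<Rightarrow> ('a, 'm) module) \<times> (nat \<Rightarrow> 'm \<Rightarrow> 'm) \<times> ('m \<Rightarrow> 'm) \<Rightarrow> bool" where
  "projective_resolution A M = (\<lambda>(F, d, \<epsilon>).
    (\<forall>n. projective_module A (F n) \<and> d n \<in> lhom A (F (Suc n)) (F n)) \<and>
    \<epsilon> \<in> lhom A (F 0) M \<and> \<epsilon> ` carrier (F 0) = carrier M \<and>
    d 0 ` carrier (F (Suc 0)) = lker (F 0) M \<epsilon> \<and>
    (\<forall>n. d (Suc n) ` carrier (F (Suc (Suc n))) = lker (F (Suc n)) (F n) (d n)))"

text \<open>\<open>\<real>\<^sup>jT(M)\<close>, computed with a chosen projective resolution of \<open>M\<close>.\<close>

definition right_derived ::
    "'a ring \<Rightarrow> ('a, 'm, 'n) mfunctor \<Rightarrow> nat \<Rightarrow> ('a, 'm) module \<Rightarrow> ('a, 'n set) module" where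
  "right_derived A T j M =
    (case (SOME r. projective_resolution A M r) of (F, d, \<epsilon>) \<Rightarrow>
       cohomology (\<lambda>n. fob T (F n)) (\<lambda>n. far T (F (Suc n)) (F n) (d n)) j)"


section \<open>Inverse and direct systems\<close>

text \<open>
  A poset is a set \<open>Q\<close> in a type of class \<^class>\<open>order\<close>. For \<open>p \<le> q\<close> the structure map \<open>sar G p q\<close>
  goes from \<open>q\<close> to \<open>p\<close> in an inverse system and from \<open>p\<close> to \<open>q\<close> in a direct system.
\<close>

record ('q, 'a, 'm) system =
  sob :: "'q \<Rightarrow> ('a, 'm) module"
  sar :: "'q \<Rightarrow> 'q \<Rightarrow> 'm \<Rightarrow> 'm"

definition inverse_system :: "'a ring \<Rightarrow> 'q::order set \<Rightarrow> ('q, 'a, 'm) system \<Rightarrow> bool" where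
  "inverse_system A Q G \<longleftrightarrow>
    (\<forall>p\<in>Q. module A (sob G p) \<and> sar G p p = (\<lambda>x\<in>carrier (sob G p). x)) \<and>
    (\<forall>p\<in>Q. \<forall>q\<in>Q. p \<le> q \<longrightarrow> sar G p q \<in> lhom A (sob G q) (sob G p)) \<and>
    (\<forall>p\<in>Q. \<forall>q\<in>Q. \<forall>r\<in>Q. p \<le> q \<longrightarrow> q \<le> r \<longrightarrow>
       sar G p r = compose (carrier (sob G r)) (sar G p q) (sar G q r))"

definition inverse_system_hom ::
    "'a ring \<Rightarrow> 'q::order set \<Rightarrow> ('q, 'a, 'm) system \<Rightarrow> ('q, 'a, 'm) system \<Rightarrow> ('q \<Rightarrow> 'm \<Rightarrow> 'm) \<Rightarrow> bool" where
  "inverse_system_hom A Q G H \<phi> \<longleftrightarrow>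
    inverse_system A Q G \<and> inverse_system A Q H \<and>
    (\<forall>p\<in>Q. \<phi> p \<in> lhom A (sob G p) (sob H p)) \<and>
    (\<forall>p\<in>Q. \<forall>q\<in>Q. p \<le> q \<longrightarrow>
       compose (carrier (sob G q)) (\<phi> p) (sar G p q) =
       compose (carrier (sob G q)) (sar H p q) (\<phi> q))"

text \<open>\<open>P\<close> with an initial and a terminal element added, and restriction of systems from it to \<open>P\<close>.\<close>

definition hat :: "'p set \<Rightarrow> 'p extended set" where
  "hat P = {Minf, Pinf} \<union> Fin ` P"

definition restrict_system :: "('p extended, 'a, 'm) system \<Rightarrow> ('p, 'a, 'm) system" where
  "restrict_system V = \<lparr>sob = (\<lambda>p. sob V (Fin p)), sar = (\<lambda>p q. sar V (Fin p) (Fin q))\<rparr>"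

text \<open>The functor from inverse to direct systems induced by \<open>T\<close>, on objects and on morphisms \<open>\<phi> : G \<rightarrow> H\<close>.\<close>

definition apply_system :: "('a, 'm, 'n) mfunctor \<Rightarrow> ('q, 'a, 'm) system \<Rightarrow> ('q, 'a, 'n) system" where
  "apply_system T G =
    \<lparr>sob = (\<lambda>p. fob T (sob G p)), sar = (\<lambda>p q. far T (sob G q) (sob G p) (sar G p q))\<rparr>"

definition apply_system_hom ::
    "('a, 'm, 'n) mfunctor \<Rightarrow> ('q, 'a, 'm) system \<Rightarrow> ('q, 'a, 'm) system \<Rightarrow>
     ('q \<Rightarrow> 'm \<Rightarrow> 'm) \<Rightarrow> 'q \<Rightarrow> 'n \<Rightarrow> 'n" where
  "apply_system_hom T G H \<phi> = (\<lambda>p. far T (sob G p) (sob H p) (\<phi> p))"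


section \<open>Limits and colimits\<close>

definition cone ::
    "'a ring \<Rightarrow> 'q::order set \<Rightarrow> ('q, 'a, 'm) system \<Rightarrow> ('a, 'm) module \<Rightarrow> ('q \<Rightarrow> 'm \<Rightarrow> 'm) \<Rightarrow> bool" where
  "cone A Q G L \<pi> \<longleftrightarrow> module A L \<and> (\<forall>p\<in>Q. \<pi> p \<in> lhom A L (sob G p)) \<and>
    (\<forall>p\<in>Q. \<forall>q\<in>Q. p \<le> q \<longrightarrow> compose (carrier L) (sar G p q) (\<pi> q) = \<pi> p)"

definition limit_cone ::
    "'a ring \<Rightarrow> 'q::order set \<Rightarrow> ('q, 'a, 'm) system \<Rightarrow> ('a, 'm) module \<times> ('q \<Rightarrow> 'm \<Rightarrow> 'm) \<Rightarrow> bool" where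
  "limit_cone A Q G = (\<lambda>(L, \<pi>). cone A Q G L \<pi> \<and>
    (\<forall>X \<xi>. cone A Q G X \<xi> \<longrightarrow>
       (\<exists>!u. u \<in> lhom A X L \<and> (\<forall>p\<in>Q. compose (carrier X) (\<pi> p) u = \<xi> p))))"

definition lim_ob :: "'a ring \<Rightarrow> 'q::order set \<Rightarrow> ('q, 'a, 'm) system \<Rightarrow> ('a, 'm) module" where
  "lim_ob A Q G = fst (SOME c. limit_cone A Q G c)"

definition lim_proj :: "'a ring \<Rightarrow> 'q::order set \<Rightarrow> ('q, 'a, 'm) system \<Rightarrow> 'q \<Rightarrow> 'm \<Rightarrow> 'm" where
  "lim_proj A Q G = snd (SOME c. limit_cone A Q G c)"

definition lim_map ::
    "'a ring \<Rightarrow> 'q::order set \<Rightarrow> ('q, 'a, 'm) system \<Rightarrow> ('q, 'a, 'm) system \<Rightarrow>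
     ('q \<Rightarrow> 'm \<Rightarrow> 'm) \<Rightarrow> 'm \<Rightarrow> 'm" where
  "lim_map A Q G H \<phi> = (THE u. u \<in> lhom A (lim_ob A Q G) (lim_ob A Q H) \<and>
    (\<forall>p\<in>Q. compose (carrier (lim_ob A Q G)) (lim_proj A Q H p) u =
             compose (carrier (lim_ob A Q G)) (\<phi> p) (lim_proj A Q G p)))"

definition cocone ::
    "'a ring \<Rightarrow> 'q::order set \<Rightarrow> ('q, 'a, 'm) system \<Rightarrow> ('a, 'm) module \<Rightarrow> ('q \<Rightarrow> 'm \<Rightarrow> 'm) \<Rightarrow> bool" where
  "cocone A Q D C \<iota> \<longleftrightarrow> module A C \<and> (\<forall>p\<in>Q. \<iota> p \<in> lhom A (sob D p) C) \<and>
    (\<forall>p\<in>Q. \<forall>q\<in>Q. p \<le> q \<longrightarrow> compose (carrier (sob D p)) (\<iota> q) (sar D p q) = \<iota> p)"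

definition colimit_cocone ::
    "'a ring \<Rightarrow> 'q::order set \<Rightarrow> ('q, 'a, 'm) system \<Rightarrow> ('a, 'm) module \<times> ('q \<Rightarrow> 'm \<Rightarrow> 'm) \<Rightarrow> bool" where
  "colimit_cocone A Q D = (\<lambda>(C, \<iota>). cocone A Q D C \<iota> \<and>
    (\<forall>X \<xi>. cocone A Q D X \<xi> \<longrightarrow>
       (\<exists>!u. u \<in> lhom A C X \<and> (\<forall>p\<in>Q. compose (carrier (sob D p)) u (\<iota> p) = \<xi> p))))"

definition colim_ob :: "'a ring \<Rightarrow> 'q::order set \<Rightarrow> ('q, 'a, 'm) system \<Rightarrow> ('a, 'm) module" where
  "colim_ob A Q D = fst (SOME c. colimit_cocone A Q D c)"

definition colim_inj :: "'a ring \<Rightarrow> 'q::order set \<Rightarrow> ('q, 'a, 'm) system \<Rightarrow> 'q \<Rightarrow> 'm \<Rightarrow> 'm" where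
  "colim_inj A Q D = snd (SOME c. colimit_cocone A Q D c)"

definition colim_map ::
    "'a ring \<Rightarrow> 'q::order set \<Rightarrow> ('q, 'a, 'm) system \<Rightarrow> ('q, 'a, 'm) system \<Rightarrow>
     ('q \<Rightarrow> 'm \<Rightarrow> 'm) \<Rightarrow> 'm \<Rightarrow> 'm" where
  "colim_map A Q D E \<psi> = (THE u. u \<in> lhom A (colim_ob A Q D) (colim_ob A Q E) \<and>
    (\<forall>p\<in>Q. compose (carrier (sob D p)) u (colim_inj A Q D p) =
             compose (carrier (sob D p)) (colim_inj A Q E p) (\<psi> p)))"

text \<open>
  The functors \<open>colim \<circ> \<T>\<close> and \<open>T \<circ> lim\<close> on inverse systems are naturally equivalent. Both are
  contravariant, so for \<open>\<phi> : G \<rightarrow> H\<close> the horizontal maps of the naturality square go from \<open>H\<close> to \<open>G\<close>.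
\<close>

definition colim_lim_equivalence :: "'a ring \<Rightarrow> 'q::order set \<Rightarrow> ('a, 'm, 'n) mfunctor \<Rightarrow> bool" where
  "colim_lim_equivalence A Q T \<longleftrightarrow>
    (\<exists>\<theta> :: ('q, 'a, 'm) system \<Rightarrow> 'n \<Rightarrow> 'n.
      (\<forall>G. inverse_system A Q G \<longrightarrow>
         \<theta> G \<in> liso A (colim_ob A Q (apply_system T G)) (fob T (lim_ob A Q G))) \<and>
      (\<forall>G H \<phi>. inverse_system_hom A Q G H \<phi> \<longrightarrow>
         compose (carrier (colim_ob A Q (apply_system T H))) (\<theta> G)
           (colim_map A Q (apply_system T H) (apply_system T G) (apply_system_hom T G H \<phi>)) =
         compose (carrier (colim_ob A Q (apply_system T H)))
           (far T (lim_ob A Q G) (lim_ob A Q H) (lim_map A Q G H \<phi>)) (\<theta> H)))"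


section \<open>Right derived functors of the limit\<close>

text \<open>Kernels and images of systems are formed pointwise; monomorphisms are the pointwise injective maps.\<close>

definition injective_system :: "'a ring \<Rightarrow> 'q::order set \<Rightarrow> ('q, 'a, 'm) system \<Rightarrow> bool" where
  "injective_system A Q J \<longleftrightarrow> inverse_system A Q J \<and>
    (\<forall>(G :: ('q, 'a, 'm) system) (H :: ('q, 'a, 'm) system) \<mu> \<phi>.
       inverse_system_hom A Q G H \<mu> \<longrightarrow> (\<forall>p\<in>Q. inj_on (\<mu> p) (carrier (sob G p))) \<longrightarrow>
       inverse_system_hom A Q G J \<phi> \<longrightarrow>
       (\<exists>\<psi>. inverse_system_hom A Q H J \<psi> \<and>
          (\<forall>p\<in>Q. compose (carrier (sob G p)) (\<psi> p) (\<mu> p) = \<phi> p)))"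

definition injective_resolution ::
    "'a ring \<Rightarrow> 'q::order set \<Rightarrow> ('q, 'a, 'm) system \<Rightarrow>
     (nat \<Rightarrow> ('q, 'a, 'm) system) \<times> (nat \<Rightarrow> 'q \<Rightarrow> 'm \<Rightarrow> 'm) \<times> ('q \<Rightarrow> 'm \<Rightarrow> 'm) \<Rightarrow> bool" where
  "injective_resolution A Q V = (\<lambda>(J, d, \<eta>).
    (\<forall>n. injective_system A Q (J n) \<and> inverse_system_hom A Q (J n) (J (Suc n)) (d n)) \<and>
    inverse_system_hom A Q V (J 0) \<eta> \<and>
    (\<forall>p\<in>Q. inj_on (\<eta> p) (carrier (sob V p)) \<and>
       \<eta> p ` carrier (sob V p) = lker (sob (J 0) p) (sob (J (Suc 0)) p) (d 0 p) \<and>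
       (\<forall>n. d n p ` carrier (sob (J n) p) =
          lker (sob (J (Suc n)) p) (sob (J (Suc (Suc n))) p) (d (Suc n) p))))"

text \<open>\<open>\<real>\<^sup>ilim V\<close>, computed with a chosen injective resolution of \<open>V\<close>.\<close>

definition derived_lim ::
    "'a ring \<Rightarrow> 'q::order set \<Rightarrow> nat \<Rightarrow> ('q, 'a, 'm) system \<Rightarrow> ('a, 'm set) module" where
  "derived_lim A Q i V =
    (case (SOME r. injective_resolution A Q V r) of (J, d, \<eta>) \<Rightarrow>
       cohomology (\<lambda>n. lim_ob A Q (J n)) (\<lambda>n. lim_map A Q (J n) (J (Suc n)) (d n)) i)"

definition lim_acyclic :: "'a ring \<Rightarrow> 'q::order set \<Rightarrow> ('q, 'a, 'm) system \<Rightarrow> bool" where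
  "lim_acyclic A Q V \<longleftrightarrow> (\<forall>i\<ge>1. zero_module (derived_lim A Q i V))"


section \<open>Reduced simplicial homology of order complexes\<close>

text \<open>
  An \<open>n\<close>-simplex of the order complex of \<open>Q\<close> is a chain with \<open>n + 1\<close> elements, written as a strictly
  increasing list. The empty chain is the unique simplex of dimension \<open>-1\<close>, which gives the
  augmented chain complex, and there are no simplices of dimension below \<open>-1\<close>.
\<close>

definition simplices :: "'p::order set \<Rightarrow> int \<Rightarrow> 'p list set" where
  "simplices Q n = {xs. sorted_wrt (<) xs \<and> set xs \<subseteq> Q \<and> int (length xs) = n + 1}"

text \<open>
  Chains with coefficients in the field \<open>k\<close>. For finite \<open>Q\<close> all functions on the simplices are
  finitely supported.
\<close>

definition chain_space :: "'a ring \<Rightarrow> 'p::order set \<Rightarrow> int \<Rightarrow> ('a, 'p list \<Rightarrow> 'a) module" where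
  "chain_space k Q n = ring.func_space k (simplices Q n)"

definition boundary :: "'a ring \<Rightarrow> 'p::order set \<Rightarrow> int \<Rightarrow> ('p list \<Rightarrow> 'a) \<Rightarrow> 'p list \<Rightarrow> 'a" where
  "boundary k Q n c = (\<lambda>ys\<in>simplices Q (n - 1).
    \<Oplus>\<^bsub>k\<^esub>e\<in>{(xs, i). xs \<in> simplices Q n \<and> i < length xs \<and> take i xs @ drop (Suc i) xs = ys}.
      ((\<ominus>\<^bsub>k\<^esub> \<one>\<^bsub>k\<^esub>) [^]\<^bsub>k\<^esub> snd e) \<otimes>\<^bsub>k\<^esub> c (fst e))"

definition reduced_homology :: "'a ring \<Rightarrow> 'p::order set \<Rightarrow> int \<Rightarrow> ('a, ('p list \<Rightarrow> 'a) set) module" where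
  "reduced_homology k Q n =
    subquot (chain_space k Q n)
      (lker (chain_space k Q n) (chain_space k Q (n - 1)) (boundary k Q n))
      (boundary k Q (n + 1) ` carrier (chain_space k Q (n + 1)))"

definition reduced_betti :: "'a ring \<Rightarrow> 'p::order set \<Rightarrow> int \<Rightarrow> nat" where
  "reduced_betti k Q n = vectorspace.dim k (reduced_homology k Q n)"

end

theory Submission
  imports Defs
begin

text \<open>
  The equivalence \<open>colim \<circ> \<T> \<cong> T \<circ> lim\<close> on all systems is so strong that only two cases are left.
  Suppose two maximal elements \<open>b \<noteq> c\<close> of \<open>P\<close> have a common lower bound. For a monomorphism
  \<open>M \<rightarrow> N\<close>, take the system with value \<open>M\<close> at the elements below \<open>c\<close> and below no other maximal
  element, \<open>N\<close> at the remaining elements below \<open>c\<close>, and \<open>0\<close> elsewhere: its limit is \<open>0\<close>, so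
  \<open>coker (T N \<rightarrow> T M) = 0\<close> and \<open>T\<close> is exact. Then \<open>T (lim V) = colim (\<T> V)\<close>, where all maps between
  different elements vanish by the hypothesis on homomorphisms, so the colimit is the direct sum of
  \<open>T (V q)\<close> over the maximal \<open>q\<close>. Otherwise every element lies below a unique maximal one, \<open>lim V\<close> is
  the direct sum of \<open>V q\<close> over the maximal \<open>q\<close>, and the derived functors of \<open>T\<close> are additive. In both
  cases \<open>\<real>\<^sup>jT (lim V)\<close> is the direct sum of \<open>\<real>\<^sup>jT (V q)\<close> over the maximal \<open>q\<close>. This is the asserted
  sum: the interval above a maximal element is empty, and for the other \<open>q\<close> it is a cone in the
  second case, while in the first case only \<open>h q = 0\<close> matters.
\<close>

section \<open>Homomorphisms\<close>

text \<open>Left exactness supplies the other half of exactness, so surjectivity of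
  \<open>T f\<close> is all that has to be forced. For exact \<open>T\<close> a summand with
  \<open>h q > 0\<close> is zero, and for non-maximal \<open>q\<close> with \<open>h q = 0\<close>
  the degree \<open>- j - 1\<close> is at most \<open>-1\<close>, where a nonempty complex has no
  reduced homology. The hypothesis on homomorphisms reaches the maps of \<open>colim\<close> because
  \<open>T\<close> agrees with its zeroth derived functor: either source or target is zero, or both
  degrees are \<open>0\<close> and the hypothesis applies literally. The obstacle is that modules
  live in a fixed type and that limits, colimits and resolutions are arbitrary choices. Products,
  quotients and free modules are therefore rebuilt inside the type by coding lists as elements;
  chosen objects enter only through universal properties; different lifts to resolutions are
  compared up to homotopy. Homotopies need \<open>T\<close> to be additive on maps, which has to be
  derived from its compatibility with direct sums. All isomorphisms are \<open>A\<close>-linear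
  until scalars are restricted to \<open>K\<close> at the very end.\<close>

lemma module_homI:
  assumes "\<And>x. x \<in> carrier M \<Longrightarrow> f x \<in> carrier N"
    and "\<And>x y. x \<in> carrier M \<Longrightarrow> y \<in> carrier M \<Longrightarrow> f (x \<oplus>\<^bsub>M\<^esub> y) = f x \<oplus>\<^bsub>N\<^esub> f y"
    and "\<And>a x. a \<in> carrier A \<Longrightarrow> x \<in> carrier M \<Longrightarrow> f (a \<odot>\<^bsub>M\<^esub> x) = a \<odot>\<^bsub>N\<^esub> f x"
  shows "f \<in> module_hom A M N"
  using assms by (auto simp: module_hom_def)

lemma module_homD:
  assumes "f \<in> module_hom A M N"
  shows "x \<in> carrier M \<Longrightarrow> f x \<in> carrier N"
    and "x \<in> carrier M \<Longrightarrow> y \<in> carrier M \<Longrightarrow> f (x \<oplus>\<^bsub>M\<^esub> y) = f x \<oplus>\<^bsub>N\<^esub> f y"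
    and "a \<in> carrier A \<Longrightarrow> x \<in> carrier M \<Longrightarrow> f (a \<odot>\<^bsub>M\<^esub> x) = a \<odot>\<^bsub>N\<^esub> f x"
  using assms by (auto simp: module_hom_def)

text \<open>\<open>module_hom\<close> asks for additivity and compatibility with scalars; zero is
  preserved because it is the scalar zero times itself, and negatives and differences
  follow.\<close>

lemma module_hom_zero_minus:
  assumes "module A M" "module A N" "f \<in> module_hom A M N"
  shows "f \<zero>\<^bsub>M\<^esub> = \<zero>\<^bsub>N\<^esub>"
    and "x \<in> carrier M \<Longrightarrow> f (\<ominus>\<^bsub>M\<^esub> x) = \<ominus>\<^bsub>N\<^esub> f x"
    and "x \<in> carrier M \<Longrightarrow> y \<in> carrier M \<Longrightarrow> f (x \<ominus>\<^bsub>M\<^esub> y) = f x \<ominus>\<^bsub>N\<^esub> f y"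
proof -
  interpret M: module A M by fact
  interpret N: module A N by fact
  note f = module_homD[OF assms(3)]
  have "f \<zero>\<^bsub>M\<^esub> = f (\<zero>\<^bsub>A\<^esub> \<odot>\<^bsub>M\<^esub> \<zero>\<^bsub>M\<^esub>)" by simp
  also have "\<dots> = \<zero>\<^bsub>A\<^esub> \<odot>\<^bsub>N\<^esub> f \<zero>\<^bsub>M\<^esub>" by (rule f) auto
  also have "\<dots> = \<zero>\<^bsub>N\<^esub>" using f(1) by simp
  finally show zero: "f \<zero>\<^bsub>M\<^esub> = \<zero>\<^bsub>N\<^esub>" .
  show minus: "f (\<ominus>\<^bsub>M\<^esub> x) = \<ominus>\<^bsub>N\<^esub> f x" if "x \<in> carrier M" for x
    using that f zero by (metis M.add.inv_closed M.l_neg N.minus_equality)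
  show "f (x \<ominus>\<^bsub>M\<^esub> y) = f x \<ominus>\<^bsub>N\<^esub> f y" if "x \<in> carrier M" "y \<in> carrier M"
    using that f minus by (simp add: a_minus_def)
qed

lemma lhomI:
  assumes "module A M" and "\<And>x. x \<in> carrier M \<Longrightarrow> f x = g x" and "g \<in> module_hom A M N"
    and "f \<in> extensional (carrier M)"
  shows "f \<in> lhom A M N"
proof -
  interpret M: module A M by fact
  show ?thesis using assms by (auto simp: lhom_def module_hom_def)
qed

lemma restrict_lhom:
  "module A M \<Longrightarrow> f \<in> module_hom A M N \<Longrightarrow> (\<lambda>x\<in>carrier M. f x) \<in> lhom A M N"
  by (rule lhomI) auto

lemma lhomD:
  assumes "f \<in> lhom A M N"
  shows "f \<in> module_hom A M N" "f \<in> extensional (carrier M)"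
    and "x \<in> carrier M \<Longrightarrow> f x \<in> carrier N"
    and "x \<in> carrier M \<Longrightarrow> y \<in> carrier M \<Longrightarrow> f (x \<oplus>\<^bsub>M\<^esub> y) = f x \<oplus>\<^bsub>N\<^esub> f y"
    and "a \<in> carrier A \<Longrightarrow> x \<in> carrier M \<Longrightarrow> f (a \<odot>\<^bsub>M\<^esub> x) = a \<odot>\<^bsub>N\<^esub> f x"
  using assms by (auto simp: lhom_def module_hom_def)

lemma lhom_eqI:
  assumes "f \<in> lhom A M N" "g \<in> lhom A M N'" "\<And>x. x \<in> carrier M \<Longrightarrow> f x = g x"
  shows "f = g"
  using assms extensionalityI[of f "carrier M" g] by (auto simp: lhom_def)

lemma compose_lhom:
  assumes "module A L" "f \<in> lhom A L M" "g \<in> lhom A M N"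
  shows "compose (carrier L) g f \<in> lhom A L N"
  unfolding compose_def
  by (rule restrict_lhom[OF assms(1)], rule module_homI)
    (simp_all add: lhomD[OF assms(2)] lhomD[OF assms(3)])

lemma compose_lhom_eqI:
  assumes "module A L" "f \<in> lhom A L M" "g \<in> lhom A M N" "h \<in> lhom A L N"
    and "\<And>x. x \<in> carrier L \<Longrightarrow> g (f x) = h x"
  shows "compose (carrier L) g f = h"
  by (rule lhom_eqI[OF compose_lhom[OF assms(1-3)] assms(4)]) (simp add: compose_eq assms(5))

lemma composeD: "compose S g f = h \<Longrightarrow> x \<in> S \<Longrightarrow> g (f x) = h x"
  by (auto simp: compose_eq)

abbreviation (input) lid :: "('a, 'm) module \<Rightarrow> 'm \<Rightarrow> 'm" where
  "lid M \<equiv> \<lambda>x\<in>carrier M. x"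

abbreviation (input) lzero :: "('a, 'm) module \<Rightarrow> ('a, 'n) module \<Rightarrow> 'm \<Rightarrow> 'n" where
  "lzero M N \<equiv> \<lambda>x\<in>carrier M. \<zero>\<^bsub>N\<^esub>"

lemma lid_lhom: "module A M \<Longrightarrow> lid M \<in> lhom A M M"
  by (rule restrict_lhom, assumption, rule module_homI) auto

lemma lzero_lhom:
  assumes "module A M" "module A N" shows "lzero M N \<in> lhom A M N"
proof -
  interpret N: module A N by fact
  show ?thesis
    by (rule restrict_lhom[OF assms(1)], rule module_homI) auto
qed

lemma add_lhom:
  assumes "module A M" "module A N" "f \<in> lhom A M N" "g \<in> lhom A M N"
  shows "(\<lambda>x\<in>carrier M. f x \<oplus>\<^bsub>N\<^esub> g x) \<in> lhom A M N"
proof -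
  interpret N: module A N by fact
  show ?thesis
    by (rule restrict_lhom[OF assms(1)], rule module_homI)
      (simp_all add: lhomD[OF assms(3)] lhomD[OF assms(4)] N.smult_r_distr N.a_ac)
qed

lemma minus_lhom:
  assumes "module A M" "module A N" "f \<in> lhom A M N"
  shows "(\<lambda>x\<in>carrier M. \<ominus>\<^bsub>N\<^esub> f x) \<in> lhom A M N"
proof -
  interpret N: module A N by fact
  show ?thesis
    by (rule restrict_lhom[OF assms(1)], rule module_homI)
      (simp_all add: lhomD[OF assms(3)] N.smult_r_minus N.minus_add)
qed

text \<open>Corestriction: a map becomes surjective onto its image, as projectivity and left
  exactness demand.\<close>

lemma lhom_codomain_submodule:
  assumes "f \<in> lhom A M N" "f ` carrier M \<subseteq> S"
  shows "f \<in> lhom A M (N\<lparr>carrier := S\<rparr>)"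
  using assms by (auto simp: lhom_def module_hom_def)

section \<open>Constructing modules\<close>

text \<open>Module axioms are equations, so they can be tested after maps to modules that jointly
  separate points; negatives are supplied by the scalar \<open>-1\<close>. The product passes this
  test through its projections, the free module through all its evaluations.\<close>

lemma module_jointly_faithful:
  fixes N :: "('a, 'n) module" and M :: "'i \<Rightarrow> ('a, 'm) module"
  assumes "cring A" "\<zero>\<^bsub>N\<^esub> \<in> carrier N"
    and closed: "\<And>x y. x \<in> carrier N \<Longrightarrow> y \<in> carrier N \<Longrightarrow> x \<oplus>\<^bsub>N\<^esub> y \<in> carrier N"
      "\<And>a x. a \<in> carrier A \<Longrightarrow> x \<in> carrier N \<Longrightarrow> a \<odot>\<^bsub>N\<^esub> x \<in> carrier N"
    and hom: "\<And>i. i \<in> I \<Longrightarrow> module A (M i)" "\<And>i. i \<in> I \<Longrightarrow> \<phi> i \<in> module_hom A N (M i)"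
      "\<And>i. i \<in> I \<Longrightarrow> \<phi> i \<zero>\<^bsub>N\<^esub> = \<zero>\<^bsub>M i\<^esub>"
    and inj: "\<And>x y. x \<in> carrier N \<Longrightarrow> y \<in> carrier N \<Longrightarrow> (\<And>i. i \<in> I \<Longrightarrow> \<phi> i x = \<phi> i y) \<Longrightarrow> x = y"
  shows "module A N"
proof (rule module_criteria)
  interpret A: cring A by fact
  note h = module_homD[OF hom(2)]
  note [simp] = assms(2) closed hom(3) h
  show "\<forall>v\<in>carrier N. \<exists>neg_v\<in>carrier N. v \<oplus>\<^bsub>N\<^esub> neg_v = \<zero>\<^bsub>N\<^esub>"
  proof
    fix v assume v: "v \<in> carrier N"
    have "v \<oplus>\<^bsub>N\<^esub> ((\<ominus>\<^bsub>A\<^esub> \<one>\<^bsub>A\<^esub>) \<odot>\<^bsub>N\<^esub> v) = \<zero>\<^bsub>N\<^esub>"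
    proof (rule inj)
      fix i assume i: "i \<in> I"
      interpret M: module A "M i" by (rule hom(1)[OF i])
      show "\<phi> i (v \<oplus>\<^bsub>N\<^esub> ((\<ominus>\<^bsub>A\<^esub> \<one>\<^bsub>A\<^esub>) \<odot>\<^bsub>N\<^esub> v)) = \<phi> i \<zero>\<^bsub>N\<^esub>"
        using i v by (simp add: M.smult_l_minus M.r_neg)
    qed (use v in auto)
    then show "\<exists>neg_v\<in>carrier N. v \<oplus>\<^bsub>N\<^esub> neg_v = \<zero>\<^bsub>N\<^esub>" using v by auto
  qed
  have *: "module A (M i)" if "i \<in> I" for i using hom(1) that .
  show "\<forall>v w. v \<in> carrier N \<and> w \<in> carrier N \<longrightarrow> v \<oplus>\<^bsub>N\<^esub> w = w \<oplus>\<^bsub>N\<^esub> v"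
    by (auto intro!: inj simp: abelian_monoid.a_comm[OF abelian_group.axioms(1)[OF module.axioms(2)[OF *]]])
  show "\<forall>v w x. v \<in> carrier N \<and> w \<in> carrier N \<and> x \<in> carrier N \<longrightarrow>
      v \<oplus>\<^bsub>N\<^esub> w \<oplus>\<^bsub>N\<^esub> x = v \<oplus>\<^bsub>N\<^esub> (w \<oplus>\<^bsub>N\<^esub> x)"
    by (auto intro!: inj simp: abelian_monoid.a_assoc[OF abelian_group.axioms(1)[OF module.axioms(2)[OF *]]])
  show "\<forall>v\<in>carrier N. v \<oplus>\<^bsub>N\<^esub> \<zero>\<^bsub>N\<^esub> = v"
    by (auto intro!: inj simp: abelian_monoid.r_zero[OF abelian_group.axioms(1)[OF module.axioms(2)[OF *]]])
  show "\<forall>a b v. a \<in> carrier A \<and> b \<in> carrier A \<and> v \<in> carrier N \<longrightarrow>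
      (a \<otimes>\<^bsub>A\<^esub> b) \<odot>\<^bsub>N\<^esub> v = a \<odot>\<^bsub>N\<^esub> (b \<odot>\<^bsub>N\<^esub> v)"
    by (auto intro!: inj simp: module.smult_assoc1[OF *])
  show "\<forall>v\<in>carrier N. \<one>\<^bsub>A\<^esub> \<odot>\<^bsub>N\<^esub> v = v"
    by (auto intro!: inj simp: module.smult_one[OF *])
  show "\<forall>a b v. a \<in> carrier A \<and> b \<in> carrier A \<and> v \<in> carrier N \<longrightarrow>
      (a \<oplus>\<^bsub>A\<^esub> b) \<odot>\<^bsub>N\<^esub> v = a \<odot>\<^bsub>N\<^esub> v \<oplus>\<^bsub>N\<^esub> b \<odot>\<^bsub>N\<^esub> v"
    by (auto intro!: inj simp: module.smult_l_distr[OF *])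
  show "\<forall>a v w. a \<in> carrier A \<and> v \<in> carrier N \<and> w \<in> carrier N \<longrightarrow>
      a \<odot>\<^bsub>N\<^esub> (v \<oplus>\<^bsub>N\<^esub> w) = a \<odot>\<^bsub>N\<^esub> v \<oplus>\<^bsub>N\<^esub> a \<odot>\<^bsub>N\<^esub> w"
    by (auto intro!: inj simp: module.smult_r_distr[OF *])
qed (use assms in auto)

text \<open>The counterpart for surjections: equations and negatives pass to the image. This covers
  renamed copies and quotients.\<close>

lemma module_image:
  assumes "module A M" "e \<in> module_hom A M N" "e ` carrier M = carrier N" "e \<zero>\<^bsub>M\<^esub> = \<zero>\<^bsub>N\<^esub>"
  shows "module A N"
proof -
  interpret M: module A M by fact
  note e = module_homD[OF assms(2)]
  have N: "carrier N = e ` carrier M" using assms(3) by simp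
  note [simp] = e(2,3)[symmetric] assms(4)[symmetric]
  show ?thesis
  proof (rule module_criteria)
    show "\<forall>v\<in>carrier N. \<exists>neg_v\<in>carrier N. v \<oplus>\<^bsub>N\<^esub> neg_v = \<zero>\<^bsub>N\<^esub>"
    proof
      fix v assume "v \<in> carrier N"
      then obtain x where x: "x \<in> carrier M" "v = e x" by (auto simp: N)
      then have "v \<oplus>\<^bsub>N\<^esub> e (\<ominus>\<^bsub>M\<^esub> x) = \<zero>\<^bsub>N\<^esub>" by (simp add: M.r_neg)
      then show "\<exists>neg_v\<in>carrier N. v \<oplus>\<^bsub>N\<^esub> neg_v = \<zero>\<^bsub>N\<^esub>" using x by (auto simp: N)
    qed
  qed (use M.R.is_cring in \<open>auto simp: N M.smult_r_distr M.smult_l_distr M.a_ac M.smult_assoc1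
        intro!: imageI\<close>)
qed

text \<open>A copy of \<open>M\<close> with elements renamed by an injection \<open>e\<close>. It
  brings products and quotients, whose elements are functions or sets, back into the type in which
  the category lives.\<close>

definition transport :: "('x \<Rightarrow> 'y) \<Rightarrow> ('a, 'x) module \<Rightarrow> ('a, 'y) module" where
  "transport e M =
    \<lparr>carrier = e ` carrier M, mult = undefined, one = undefined, zero = e \<zero>\<^bsub>M\<^esub>,
     add = (\<lambda>u v. e (inv_into (carrier M) e u \<oplus>\<^bsub>M\<^esub> inv_into (carrier M) e v)),
     smult = (\<lambda>a u. e (a \<odot>\<^bsub>M\<^esub> inv_into (carrier M) e u))\<rparr>"

lemma transport:
  assumes "module A M" "inj_on e (carrier M)"
  shows "module A (transport e M)" "e \<in> module_hom A M (transport e M)"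
    "bij_betw e (carrier M) (carrier (transport e M))"
proof -
  show e: "e \<in> module_hom A M (transport e M)"
    by (rule module_homI) (use assms(2) in \<open>auto simp: transport_def\<close>)
  show "module A (transport e M)"
    by (rule module_image[OF assms(1) e]) (auto simp: transport_def)
  show "bij_betw e (carrier M) (carrier (transport e M))"
    using assms(2) by (auto simp: transport_def bij_betw_def)
qed

lemma module_hom_inv_into:
  assumes "module A M" "f \<in> module_hom A M N" "bij_betw f (carrier M) (carrier N)"
  shows "inv_into (carrier M) f \<in> module_hom A N M"
proof -
  interpret M: module A M by fact
  let ?g = "inv_into (carrier M) f"
  have g: "?g x \<in> carrier M" "f (?g x) = x" if "x \<in> carrier N" for x
    using that assms(3) by (auto simp: bij_betw_def inv_into_into f_inv_into_f)
  have gf: "?g (f x) = x" if "x \<in> carrier M" for x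
    using that assms(3) by (auto simp: bij_betw_def)
  note f = module_homD[OF assms(2)]
  show ?thesis
  proof (rule module_homI)
    fix x y assume "x \<in> carrier N" "y \<in> carrier N"
    then show "?g (x \<oplus>\<^bsub>N\<^esub> y) = ?g x \<oplus>\<^bsub>M\<^esub> ?g y"
      using gf[of "?g x \<oplus>\<^bsub>M\<^esub> ?g y"] by (simp add: g f)
  next
    fix a x assume "a \<in> carrier A" "x \<in> carrier N"
    then show "?g (a \<odot>\<^bsub>N\<^esub> x) = a \<odot>\<^bsub>M\<^esub> ?g x"
      using gf[of "a \<odot>\<^bsub>M\<^esub> ?g x"] by (simp add: g f)
  qed (rule g)
qed

lemma finite_direct_sum_module:
  assumes "cring A" "\<And>i. i \<in> I \<Longrightarrow> module A (M i)"
  shows "module A (finite_direct_sum I M)"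
proof (rule module_jointly_faithful[where M = M and \<phi> = "\<lambda>i x. x i" and I = I])
  have z: "\<zero>\<^bsub>M i\<^esub> \<in> carrier (M i)" if "i \<in> I" for i
    using abelian_monoid.zero_closed[OF abelian_group.axioms(1)[OF module.axioms(2)[OF assms(2)[OF that]]]] .
  have p: "x \<oplus>\<^bsub>M i\<^esub> y \<in> carrier (M i)" if "i \<in> I" "x \<in> carrier (M i)" "y \<in> carrier (M i)" for i x y
    using abelian_monoid.a_closed[OF abelian_group.axioms(1)[OF module.axioms(2)[OF assms(2)[OF that(1)]]] that(2,3)] .
  have s: "a \<odot>\<^bsub>M i\<^esub> x \<in> carrier (M i)" if "i \<in> I" "a \<in> carrier A" "x \<in> carrier (M i)" for i a x
    using module.smult_closed[OF assms(2)[OF that(1)] that(2,3)] .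
  show "\<zero>\<^bsub>finite_direct_sum I M\<^esub> \<in> carrier (finite_direct_sum I M)"
    by (auto simp: finite_direct_sum_def z)
  show "x \<oplus>\<^bsub>finite_direct_sum I M\<^esub> y \<in> carrier (finite_direct_sum I M)"
    if "x \<in> carrier (finite_direct_sum I M)" "y \<in> carrier (finite_direct_sum I M)" for x y
    using that by (auto simp: finite_direct_sum_def intro!: p)
  show "a \<odot>\<^bsub>finite_direct_sum I M\<^esub> x \<in> carrier (finite_direct_sum I M)"
    if "a \<in> carrier A" "x \<in> carrier (finite_direct_sum I M)" for a x
    using that by (auto simp: finite_direct_sum_def intro!: s)
  show "(\<lambda>x. x i) \<in> module_hom A (finite_direct_sum I M) (M i)" if "i \<in> I" for i
    by (rule module_homI) (use that in \<open>auto simp: finite_direct_sum_def\<close>)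
  show "\<zero>\<^bsub>finite_direct_sum I M\<^esub> i = \<zero>\<^bsub>M i\<^esub>" if "i \<in> I" for i
    using that by (auto simp: finite_direct_sum_def)
  show "x = y" if "x \<in> carrier (finite_direct_sum I M)" "y \<in> carrier (finite_direct_sum I M)"
    "\<And>i. i \<in> I \<Longrightarrow> x i = y i" for x y
    using that by (intro PiE_ext[of x I "\<lambda>i. carrier (M i)" y]) (auto simp: finite_direct_sum_def)
qed (use assms in auto)

lemma finite_direct_sum_proj:
  "i \<in> I \<Longrightarrow> (\<lambda>x. x i) \<in> module_hom A (finite_direct_sum I M) (M i)"
  by (rule module_homI) (auto simp: finite_direct_sum_def)

section \<open>Kernels, images and zero as submodules\<close>

lemma lker_submodule:
  assumes "module A M" "module A N" "f \<in> module_hom A M N"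
  shows "submodule A (lker M N f) M"
proof -
  interpret M: module A M by fact
  interpret N: module A N by fact
  show ?thesis
    by (rule submodule.intro[OF assms(1)])
      (auto simp: lker_def module_homD[OF assms(3)] module_hom_zero_minus[OF assms])
qed

lemma image_submodule:
  assumes "module A M" "module A N" "f \<in> module_hom A M N"
  shows "submodule A (f ` carrier M) N"
proof -
  interpret M: module A M by fact
  interpret N: module A N by fact
  note f = module_homD[OF assms(3)]
  show ?thesis
    by (rule submodule.intro[OF assms(2)])
      (auto simp: f intro: rev_image_eqI[OF M.zero_closed]
        simp flip: f(2,3) module_hom_zero_minus(1)[OF assms])
qed

lemma zero_submodule: "module A M \<Longrightarrow> submodule A {\<zero>\<^bsub>M\<^esub>} M"
proof -
  assume "module A M"
  interpret M: module A M by fact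
  show ?thesis by (rule submodule.intro) (auto simp: \<open>module A M\<close>)
qed

lemma submodule_neg:
  assumes "submodule A B M" "x \<in> B" shows "\<ominus>\<^bsub>M\<^esub> x \<in> B"
proof -
  interpret B: submodule A B M by fact
  interpret M: module A M by (rule B.module)
  have "\<ominus>\<^bsub>M\<^esub> x = (\<ominus>\<^bsub>A\<^esub> \<one>\<^bsub>A\<^esub>) \<odot>\<^bsub>M\<^esub> x"
    using assms(2) B.subset by (simp add: M.smult_l_minus subsetD)
  then show ?thesis using assms(2) by simp
qed

section \<open>Quotients\<close>

lemma coset_eq_iff:
  assumes "submodule A B M" "x \<in> carrier M" "y \<in> carrier M"
  shows "B +>\<^bsub>M\<^esub> x = B +>\<^bsub>M\<^esub> y \<longleftrightarrow> x \<ominus>\<^bsub>M\<^esub> y \<in> B"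
proof -
  interpret B: submodule A B M by fact
  interpret M: module A M by (rule B.module)
  have sub: "\<And>b. b \<in> B \<Longrightarrow> b \<in> carrier M" using B.subset by auto
  show ?thesis
  proof
    assume "B +>\<^bsub>M\<^esub> x = B +>\<^bsub>M\<^esub> y"
    moreover have "x \<in> B +>\<^bsub>M\<^esub> x"
      unfolding a_r_coset_def' using assms by (auto intro!: bexI[of _ "\<zero>\<^bsub>M\<^esub>"])
    ultimately obtain b where "b \<in> B" "x = b \<oplus>\<^bsub>M\<^esub> y" by (auto simp: a_r_coset_def')
    then show "x \<ominus>\<^bsub>M\<^esub> y \<in> B" using assms(3) sub by (simp add: a_minus_def M.a_assoc M.r_neg)
  next
    assume d: "x \<ominus>\<^bsub>M\<^esub> y \<in> B"
    then have d': "y \<ominus>\<^bsub>M\<^esub> x \<in> B"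
      using submodule_neg[OF assms(1) d] assms(2,3) by (simp add: a_minus_def M.minus_add M.a_comm)
    have *: "B +>\<^bsub>M\<^esub> u \<subseteq> B +>\<^bsub>M\<^esub> v" if "u \<ominus>\<^bsub>M\<^esub> v \<in> B" "u \<in> carrier M" "v \<in> carrier M" for u v
    proof
      fix z assume "z \<in> B +>\<^bsub>M\<^esub> u"
      then obtain b where b: "b \<in> B" "z = b \<oplus>\<^bsub>M\<^esub> u" by (auto simp: a_r_coset_def')
      have "z = (b \<oplus>\<^bsub>M\<^esub> (u \<ominus>\<^bsub>M\<^esub> v)) \<oplus>\<^bsub>M\<^esub> v"
        using b that sub by (simp add: a_minus_def M.a_assoc M.l_neg)
      then show "z \<in> B +>\<^bsub>M\<^esub> v" using b that unfolding a_r_coset_def' by auto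
    qed
    show "B +>\<^bsub>M\<^esub> x = B +>\<^bsub>M\<^esub> y" using *[OF d] *[OF d'] assms by auto
  qed
qed

lemma subquot_sel [simp]:
  "carrier (subquot M Z B) = (\<lambda>x. B +>\<^bsub>M\<^esub> x) ` Z" "\<zero>\<^bsub>subquot M Z B\<^esub> = B"
  by (auto simp: subquot_def)

lemma coset_zero:
  assumes "submodule A B M" shows "B +>\<^bsub>M\<^esub> \<zero>\<^bsub>M\<^esub> = B"
proof -
  interpret B: submodule A B M by fact
  interpret M: module A M by (rule B.module)
  show ?thesis unfolding a_r_coset_def' using B.subset by (auto simp: subset_iff)
qed

lemma coset_eq_zero_iff:
  assumes "submodule A B M" "x \<in> carrier M"
  shows "B +>\<^bsub>M\<^esub> x = B \<longleftrightarrow> x \<in> B"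
proof -
  interpret B: submodule A B M by fact
  interpret M: module A M by (rule B.module)
  have "\<ominus>\<^bsub>M\<^esub> \<zero>\<^bsub>M\<^esub> = \<zero>\<^bsub>M\<^esub>" by (rule M.minus_equality) auto
  then have "x \<ominus>\<^bsub>M\<^esub> \<zero>\<^bsub>M\<^esub> = x" using assms(2) by (metis a_minus_def M.r_zero)
  then show ?thesis
    using coset_eq_iff[OF assms M.zero_closed] by (simp add: coset_zero[OF assms(1)])
qed

text \<open>Multiplying a coset by \<open>a\<close> gives only \<open>a B + a x\<close>; the extra
  summand \<open>B\<close> in the scalar multiplication of \<open>subquot\<close> fills this up to a
  full coset.\<close>

lemma subquot_ops:
  assumes "submodule A B M" "x \<in> carrier M"
  shows "y \<in> carrier M \<Longrightarrow> (B +>\<^bsub>M\<^esub> x) \<oplus>\<^bsub>subquot M Z B\<^esub> (B +>\<^bsub>M\<^esub> y) = B +>\<^bsub>M\<^esub> (x \<oplus>\<^bsub>M\<^esub> y)"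
    and "a \<in> carrier A \<Longrightarrow> a \<odot>\<^bsub>subquot M Z B\<^esub> (B +>\<^bsub>M\<^esub> x) = B +>\<^bsub>M\<^esub> (a \<odot>\<^bsub>M\<^esub> x)"
proof -
  interpret B: submodule A B M by fact
  interpret M: module A M by (rule B.module)
  have sub: "\<And>b. b \<in> B \<Longrightarrow> b \<in> carrier M" using B.subset by auto
  note [simp] = sub assms(2)
  have coset: "B +>\<^bsub>M\<^esub> z = {b \<oplus>\<^bsub>M\<^esub> z |b. b \<in> B}" for z
    unfolding a_r_coset_def' by auto
  show "(B +>\<^bsub>M\<^esub> x) \<oplus>\<^bsub>subquot M Z B\<^esub> (B +>\<^bsub>M\<^esub> y) = B +>\<^bsub>M\<^esub> (x \<oplus>\<^bsub>M\<^esub> y)" if y: "y \<in> carrier M"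
  proof -
    have add: "X \<oplus>\<^bsub>subquot M Z B\<^esub> Y = {u \<oplus>\<^bsub>M\<^esub> v |u v. u \<in> X \<and> v \<in> Y}" for X Y
      unfolding subquot_def set_add_def' by auto
    show ?thesis
    proof (intro equalityI subsetI)
      fix z assume "z \<in> (B +>\<^bsub>M\<^esub> x) \<oplus>\<^bsub>subquot M Z B\<^esub> (B +>\<^bsub>M\<^esub> y)"
      then obtain b c where "b \<in> B" "c \<in> B" "z = b \<oplus>\<^bsub>M\<^esub> x \<oplus>\<^bsub>M\<^esub> (c \<oplus>\<^bsub>M\<^esub> y)"
        unfolding add coset by blast
      then have "z = (b \<oplus>\<^bsub>M\<^esub> c) \<oplus>\<^bsub>M\<^esub> (x \<oplus>\<^bsub>M\<^esub> y)" "b \<oplus>\<^bsub>M\<^esub> c \<in> B"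
        using y by (simp_all add: M.a_ac)
      then show "z \<in> B +>\<^bsub>M\<^esub> (x \<oplus>\<^bsub>M\<^esub> y)" unfolding coset by blast
    next
      fix z assume "z \<in> B +>\<^bsub>M\<^esub> (x \<oplus>\<^bsub>M\<^esub> y)"
      then obtain b where b: "b \<in> B" "z = b \<oplus>\<^bsub>M\<^esub> (x \<oplus>\<^bsub>M\<^esub> y)" unfolding coset by blast
      then have "z = (b \<oplus>\<^bsub>M\<^esub> x) \<oplus>\<^bsub>M\<^esub> (\<zero>\<^bsub>M\<^esub> \<oplus>\<^bsub>M\<^esub> y)" using y by (simp add: M.a_assoc)
      then show "z \<in> (B +>\<^bsub>M\<^esub> x) \<oplus>\<^bsub>subquot M Z B\<^esub> (B +>\<^bsub>M\<^esub> y)"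
        unfolding add coset using b B.zero_closed by blast
    qed
  qed
  show "a \<odot>\<^bsub>subquot M Z B\<^esub> (B +>\<^bsub>M\<^esub> x) = B +>\<^bsub>M\<^esub> (a \<odot>\<^bsub>M\<^esub> x)" if a: "a \<in> carrier A"
  proof -
    have smult: "a \<odot>\<^bsub>subquot M Z B\<^esub> X = {b \<oplus>\<^bsub>M\<^esub> a \<odot>\<^bsub>M\<^esub> u |b u. b \<in> B \<and> u \<in> X}" for X
      unfolding subquot_def set_add_def' by auto
    show ?thesis
    proof (intro equalityI subsetI)
      fix z assume "z \<in> a \<odot>\<^bsub>subquot M Z B\<^esub> (B +>\<^bsub>M\<^esub> x)"
      then obtain b c where "b \<in> B" "c \<in> B" "z = b \<oplus>\<^bsub>M\<^esub> a \<odot>\<^bsub>M\<^esub> (c \<oplus>\<^bsub>M\<^esub> x)"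
        unfolding smult coset by blast
      then have "z = (b \<oplus>\<^bsub>M\<^esub> a \<odot>\<^bsub>M\<^esub> c) \<oplus>\<^bsub>M\<^esub> a \<odot>\<^bsub>M\<^esub> x" "b \<oplus>\<^bsub>M\<^esub> a \<odot>\<^bsub>M\<^esub> c \<in> B"
        using a by (simp_all add: M.smult_r_distr M.a_ac)
      then show "z \<in> B +>\<^bsub>M\<^esub> (a \<odot>\<^bsub>M\<^esub> x)" unfolding coset by blast
    next
      fix z assume "z \<in> B +>\<^bsub>M\<^esub> (a \<odot>\<^bsub>M\<^esub> x)"
      then obtain b where b: "b \<in> B" "z = b \<oplus>\<^bsub>M\<^esub> a \<odot>\<^bsub>M\<^esub> x" unfolding coset by blast
      then have "z = b \<oplus>\<^bsub>M\<^esub> a \<odot>\<^bsub>M\<^esub> (\<zero>\<^bsub>M\<^esub> \<oplus>\<^bsub>M\<^esub> x)" by simp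
      then show "z \<in> a \<odot>\<^bsub>subquot M Z B\<^esub> (B +>\<^bsub>M\<^esub> x)"
        unfolding smult coset using b B.zero_closed by blast
    qed
  qed
qed

lemma quotient_hom:
  assumes "submodule A B M" "Z \<subseteq> carrier M"
  shows "(\<lambda>x. B +>\<^bsub>M\<^esub> x) \<in> module_hom A (M\<lparr>carrier := Z\<rparr>) (subquot M Z B)"
  by (rule module_homI) (use assms in \<open>auto simp: subquot_ops[OF assms(1)] subset_iff\<close>)

lemma subquot_module:
  assumes "submodule A B M" "submodule A Z M"
  shows "module A (subquot M Z B)"
proof -
  interpret Z: submodule A Z M by fact
  interpret M: module A M by (rule Z.module)
  show ?thesis
    by (rule module_image[OF M.submodule_is_module[OF assms(2)] quotient_hom[OF assms(1) Z.subset]])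
      (simp_all add: coset_zero[OF assms(1)])
qed

section \<open>Finite direct sums\<close>

lemma finsum_hom:
  assumes "module A M" "module A N" "f \<in> module_hom A M N" "finite I" "g \<in> I \<rightarrow> carrier M"
  shows "f (\<Oplus>\<^bsub>M\<^esub>i\<in>I. g i) = (\<Oplus>\<^bsub>N\<^esub>i\<in>I. f (g i))"
  using assms(4,5)
proof (induction I)
  case empty
  interpret M: module A M by fact
  interpret N: module A N by fact
  show ?case by (simp add: module_hom_zero_minus[OF assms(1-3)])
next
  case (insert i I)
  interpret M: module A M by fact
  interpret N: module A N by fact
  have g: "g i \<in> carrier M" "\<And>j. j \<in> I \<Longrightarrow> g j \<in> carrier M" using insert by auto
  show ?case using insert g
    by (simp add: Pi_iff module_homD[OF assms(3)])
qed

lemma finite_direct_sum_map: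
  assumes "finite I" "module A X" "\<And>i. i \<in> I \<Longrightarrow> module A (M i)"
    and h: "\<And>i. i \<in> I \<Longrightarrow> h i \<in> module_hom A (M i) X"
  shows "(\<lambda>x. \<Oplus>\<^bsub>X\<^esub>i\<in>I. h i (x i)) \<in> module_hom A (finite_direct_sum I M) X"
proof -
  interpret X: module A X by fact
  note h' = module_homD[OF h]
  have c: "\<And>x i. x \<in> (\<Pi>\<^sub>E i\<in>I. carrier (M i)) \<Longrightarrow> i \<in> I \<Longrightarrow> x i \<in> carrier (M i)" by auto
  show ?thesis
  proof (rule module_homI, goal_cases)
    case (1 x)
    then show ?case by (auto simp: finite_direct_sum_def h' c intro!: X.finsum_closed)
  next
    case (2 x y)
    then have "(\<Oplus>\<^bsub>X\<^esub>i\<in>I. h i (x i) \<oplus>\<^bsub>X\<^esub> h i (y i)) = (\<Oplus>\<^bsub>X\<^esub>i\<in>I. h i (x i)) \<oplus>\<^bsub>X\<^esub> (\<Oplus>\<^bsub>X\<^esub>i\<in>I. h i (y i))"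
      by (intro X.finsum_addf) (auto simp: finite_direct_sum_def h' c)
    moreover have "(\<Oplus>\<^bsub>X\<^esub>i\<in>I. h i ((x \<oplus>\<^bsub>finite_direct_sum I M\<^esub> y) i)) = (\<Oplus>\<^bsub>X\<^esub>i\<in>I. h i (x i) \<oplus>\<^bsub>X\<^esub> h i (y i))"
      using 2 by (intro X.finsum_cong') (auto simp: finite_direct_sum_def h' c)
    ultimately show ?case by simp
  next
    case (3 a x)
    then have "a \<odot>\<^bsub>X\<^esub> (\<Oplus>\<^bsub>X\<^esub>i\<in>I. h i (x i)) = (\<Oplus>\<^bsub>X\<^esub>i\<in>I. a \<odot>\<^bsub>X\<^esub> h i (x i))"
      by (intro X.finsum_smult_ldistr assms(1)) (auto simp: finite_direct_sum_def h' c)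
    moreover have "(\<Oplus>\<^bsub>X\<^esub>i\<in>I. h i ((a \<odot>\<^bsub>finite_direct_sum I M\<^esub> x) i)) = (\<Oplus>\<^bsub>X\<^esub>i\<in>I. a \<odot>\<^bsub>X\<^esub> h i (x i))"
      using 3 by (intro X.finsum_cong') (auto simp: finite_direct_sum_def h' c)
    ultimately show ?case by simp
  qed
qed

lemma (in abelian_monoid) finsum_eq_single:
  assumes "finite I" "i \<in> I" "y \<in> carrier G"
    and "\<And>j. j \<in> I \<Longrightarrow> j \<noteq> i \<Longrightarrow> f j = \<zero>" "f i = y"
  shows "(\<Oplus>j\<in>I. f j) = y"
proof -
  have "(\<Oplus>j\<in>I. f j) = (\<Oplus>j\<in>I. if i = j then y else \<zero>)"
    by (rule finsum_cong') (use assms in auto)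
  also have "\<dots> = y" using finsum_singleton[of i I "\<lambda>_. y"] assms by auto
  finally show ?thesis .
qed

lemma finsum_single:
  assumes "module A X" "finite I" "i \<in> I" "y \<in> carrier X"
    and "\<And>j. j \<in> I \<Longrightarrow> j \<noteq> i \<Longrightarrow> f j = \<zero>\<^bsub>X\<^esub>" "f i = y"
  shows "(\<Oplus>\<^bsub>X\<^esub>j\<in>I. f j) = y"
proof -
  interpret X: module A X by fact
  show ?thesis by (rule X.finsum_eq_single) fact+
qed

definition single :: "'i set \<Rightarrow> ('i \<Rightarrow> ('a, 'm) module) \<Rightarrow> 'i \<Rightarrow> 'm \<Rightarrow> 'i \<Rightarrow> 'm" where
  "single I M i y = (\<lambda>j\<in>I. if j = i then y else \<zero>\<^bsub>M j\<^esub>)"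

lemma single_hom:
  assumes "\<And>j. j \<in> I \<Longrightarrow> module A (M j)"
  shows "single I M i \<in> module_hom A (M i) (finite_direct_sum I M)"
proof -
  have z: "\<zero>\<^bsub>M j\<^esub> \<in> carrier (M j)" "\<zero>\<^bsub>M j\<^esub> \<oplus>\<^bsub>M j\<^esub> \<zero>\<^bsub>M j\<^esub> = \<zero>\<^bsub>M j\<^esub>"
    "\<And>a. a \<in> carrier A \<Longrightarrow> a \<odot>\<^bsub>M j\<^esub> \<zero>\<^bsub>M j\<^esub> = \<zero>\<^bsub>M j\<^esub>" if "j \<in> I" for j
  proof -
    interpret module A "M j" by (rule assms[OF that])
    show "\<zero>\<^bsub>M j\<^esub> \<in> carrier (M j)" "\<zero>\<^bsub>M j\<^esub> \<oplus>\<^bsub>M j\<^esub> \<zero>\<^bsub>M j\<^esub> = \<zero>\<^bsub>M j\<^esub>"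
      "\<And>a. a \<in> carrier A \<Longrightarrow> a \<odot>\<^bsub>M j\<^esub> \<zero>\<^bsub>M j\<^esub> = \<zero>\<^bsub>M j\<^esub>" by auto
  qed
  show ?thesis
    by (rule module_homI) (auto simp: single_def finite_direct_sum_def z)
qed

text \<open>A map out of the product is thus determined by its composites with the coordinate
  injections, which gives uniqueness for colimits.\<close>

lemma sum_single:
  assumes "finite I" "cring A" "\<And>j. j \<in> I \<Longrightarrow> module A (M j)" "x \<in> carrier (finite_direct_sum I M)"
  shows "(\<Oplus>\<^bsub>finite_direct_sum I M\<^esub>i\<in>I. single I M i (x i)) = x" (is "?s = x")
proof -
  let ?S = "finite_direct_sum I M"
  interpret S: module A ?S by (rule finite_direct_sum_module) fact+
  have x: "\<And>i. i \<in> I \<Longrightarrow> x i \<in> carrier (M i)" using assms(4) by (auto simp: finite_direct_sum_def)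
  have c: "(\<lambda>i. single I M i (x i)) \<in> I \<rightarrow> carrier ?S"
    using module_homD(1)[OF single_hom[of I A M]] assms(3) x by auto
  show ?thesis
  proof (rule PiE_ext[of _ I "\<lambda>i. carrier (M i)"])
    show "?s \<in> (\<Pi>\<^sub>E i\<in>I. carrier (M i))" using S.finsum_closed[OF c] by (simp add: finite_direct_sum_def)
    show "x \<in> (\<Pi>\<^sub>E i\<in>I. carrier (M i))" using assms(4) by (simp add: finite_direct_sum_def)
    fix j assume j: "j \<in> I"
    have "?s j = (\<Oplus>\<^bsub>M j\<^esub>i\<in>I. single I M i (x i) j)"
      by (rule finsum_hom[OF S.module_axioms assms(3)[OF j] finite_direct_sum_proj[OF j] assms(1) c])
    also have "\<dots> = x j"
      by (rule finsum_single[OF assms(3)[OF j] assms(1) j]) (use j x in \<open>auto simp: single_def\<close>)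
    finally show "?s j = x j" .
  qed
qed

text \<open>An infinite type is in bijection with its square, so a list folds into one element by
  iterated pairing. The fold is injective only among lists of equal length; hence the length, coded
  by \<open>g\<close>, is paired in.\<close>

lemma ex_inj_list:
  assumes "infinite (UNIV :: 'm set)"
  shows "\<exists>e :: 'm list \<Rightarrow> 'm. inj e"
proof -
  obtain f :: "'m \<times> 'm \<Rightarrow> 'm" where "bij_betw f (UNIV \<times> UNIV) UNIV"
    using card_of_ordIso[THEN iffD2, OF card_of_Times_same_infinite[OF assms]] by blast
  then have "inj f" by (simp add: bij_betw_def)
  note f = inj_eq[OF this]
  obtain g :: "nat \<Rightarrow> 'm" where g: "inj g"
    using assms by (auto simp: infinite_iff_countable_subset)
  define r where "r = foldr (\<lambda>x y. f (x, y))"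
  have r: "length xs = length ys \<Longrightarrow> r xs c = r ys c \<Longrightarrow> xs = ys" for xs ys c
    by (induction xs ys rule: list_induct2) (auto simp: r_def f)
  have "inj (\<lambda>xs. f (g (length xs), r xs undefined))"
    by (rule injI) (use r g in \<open>auto simp: f inj_eq\<close>)
  then show ?thesis by blast
qed

text \<open>An extensional function on a finite set is the list of its values. This is what keeps
  finite products inside the universe.\<close>

lemma ex_inj_on_extensional:
  assumes "infinite (UNIV :: 'm set)" "finite I"
  shows "\<exists>e :: ('i \<Rightarrow> 'm) \<Rightarrow> 'm. inj_on e (extensional I)"
proof -
  obtain e :: "'m list \<Rightarrow> 'm" where e: "inj e" using ex_inj_list[OF assms(1)] by blast
  obtain xs where xs: "set xs = I" using finite_list[OF assms(2)] by blast
  have "inj_on (\<lambda>f. e (map f xs)) (extensional I)"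
    by (rule inj_onI) (use e xs in \<open>auto simp: inj_eq intro: extensionalityI\<close>)
  then show ?thesis by blast
qed

lemma inj_on_finite_direct_sum:
  "inj_on e (extensional I) \<Longrightarrow> inj_on e (carrier (finite_direct_sum I M))"
  by (erule inj_on_subset) (auto simp: finite_direct_sum_def PiE_def)

section \<open>Factoring through quotients\<close>

lemma module_minus_eq_zero_iff:
  assumes "module A M" "x \<in> carrier M" "y \<in> carrier M"
  shows "x \<ominus>\<^bsub>M\<^esub> y = \<zero>\<^bsub>M\<^esub> \<longleftrightarrow> x = y"
proof -
  interpret M: module A M by fact
  have "x \<ominus>\<^bsub>M\<^esub> y \<oplus>\<^bsub>M\<^esub> y = x" using assms by (simp add: a_minus_def M.a_assoc M.l_neg)
  then show ?thesis using assms by (metis M.l_zero a_minus_def M.r_neg)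
qed

lemma module_minus_closed:
  assumes "module A M" "x \<in> carrier M" "y \<in> carrier M"
  shows "x \<ominus>\<^bsub>M\<^esub> y \<in> carrier M"
proof -
  interpret M: module A M by fact
  show ?thesis using assms(2,3) by (simp add: a_minus_def)
qed

text \<open>Preimages under \<open>k\<close> are chosen; two choices differ by an element that
  \<open>k\<close>, hence \<open>h\<close>, kills.\<close>

lemma lhom_factor:
  assumes "module A M" "module A C" "module A X" "k \<in> lhom A M C" "k ` carrier M = carrier C"
    and "h \<in> module_hom A M X" "\<And>x. x \<in> carrier M \<Longrightarrow> k x = \<zero>\<^bsub>C\<^esub> \<Longrightarrow> h x = \<zero>\<^bsub>X\<^esub>"
  shows "\<exists>u \<in> lhom A C X. \<forall>x\<in>carrier M. u (k x) = h x"
proof -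
  interpret M: module A M by fact
  interpret C: module A C by fact
  interpret X: module A X by fact
  note k = lhomD[OF assms(4)] and h = module_homD[OF assms(6)]
  have wd: "h x = h y" if "x \<in> carrier M" "y \<in> carrier M" "k x = k y" for x y
  proof -
    have "k (x \<ominus>\<^bsub>M\<^esub> y) = \<zero>\<^bsub>C\<^esub>"
      using that k(3) by (simp add: module_hom_zero_minus(3)[OF assms(1,2) k(1)] module_minus_eq_zero_iff[OF assms(2)])
    then have "h (x \<ominus>\<^bsub>M\<^esub> y) = \<zero>\<^bsub>X\<^esub>" using that assms(7) module_minus_closed[OF assms(1)] by simp
    then show ?thesis
      using that h(1) by (simp add: module_hom_zero_minus(3)[OF assms(1,3,6)] module_minus_eq_zero_iff[OF assms(3)])
  qed
  define u where "u = (\<lambda>c\<in>carrier C. h (inv_into (carrier M) k c))"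
  have i: "inv_into (carrier M) k c \<in> carrier M" "k (inv_into (carrier M) k c) = c" if "c \<in> carrier C" for c
    using that by (auto simp: assms(5)[symmetric] inv_into_into f_inv_into_f)
  have u: "u (k x) = h x" if "x \<in> carrier M" for x
    unfolding u_def using that i[of "k x"] k(3) by (auto intro: wd)
  have "u \<in> lhom A C X"
  proof (rule lhomI[OF assms(2) refl])
    show "u \<in> module_hom A C X"
    proof (rule module_homI, goal_cases)
      case (1 x)
      then show ?case using i h(1) by (simp add: u_def)
    next
      case (2 x y)
      let ?x = "inv_into (carrier M) k x" and ?y = "inv_into (carrier M) k y"
      have "u (x \<oplus>\<^bsub>C\<^esub> y) = u (k (?x \<oplus>\<^bsub>M\<^esub> ?y))" using 2 i by (simp add: k)
      also have "\<dots> = u (k ?x) \<oplus>\<^bsub>X\<^esub> u (k ?y)" using 2 i(1) by (simp only: u h M.a_closed)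
      also have "\<dots> = u x \<oplus>\<^bsub>X\<^esub> u y" using 2 by (simp only: i(2))
      finally show ?case .
    next
      case (3 a x)
      let ?x = "inv_into (carrier M) k x"
      have "u (a \<odot>\<^bsub>C\<^esub> x) = u (k (a \<odot>\<^bsub>M\<^esub> ?x))" using 3 i by (simp add: k)
      also have "\<dots> = a \<odot>\<^bsub>X\<^esub> u (k ?x)" using 3 i(1) by (simp only: u h M.smult_closed)
      also have "\<dots> = a \<odot>\<^bsub>X\<^esub> u x" using 3 by (simp only: i(2))
      finally show ?case .
    qed
  qed (simp add: u_def)
  then show ?thesis using u by blast
qed

text \<open>A coset is a set and has the wrong type; the code \<open>e\<close> of a chosen
  representative serves as its name.\<close>

lemma ex_quotient:
  fixes M :: "('a, 'x) module" and e :: "'x \<Rightarrow> 'n"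
  assumes "module A M" "submodule A B M" "inj_on e (carrier M)"
  shows "\<exists>(C :: ('a, 'n) module) k. module A C \<and> k \<in> lhom A M C \<and> k ` carrier M = carrier C \<and>
    (\<forall>x\<in>carrier M. k x = \<zero>\<^bsub>C\<^esub> \<longleftrightarrow> x \<in> B)"
proof -
  interpret M: module A M by fact
  interpret B: submodule A B M by fact
  let ?q = "\<lambda>x. B +>\<^bsub>M\<^esub> x" and ?Q = "subquot M (carrier M) B"
  define r where "r = inv_into (carrier M) ?q"
  have r: "r X \<in> carrier M" "?q (r X) = X" if "X \<in> ?q ` carrier M" for X
    using that unfolding r_def by (rule inv_into_into, intro f_inv_into_f)
  have er: "inj_on (\<lambda>X. e (r X)) (carrier ?Q)"
    by (rule inj_onI) (metis inj_onD[OF assms(3)] r subquot_sel(1))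
  have sM: "submodule A (carrier M) M"
    by (rule submodule.intro[OF assms(1)]) auto
  note Q = subquot_module[OF assms(2) sM]
  note t = transport[OF Q er]
  let ?C = "transport (\<lambda>X. e (r X)) ?Q"
  define k where "k = (\<lambda>x\<in>carrier M. e (r (?q x)))"
  have q: "?q \<in> module_hom A M ?Q" using quotient_hom[OF assms(2) order_refl] by simp
  have qc: "?q x \<in> carrier ?Q" if "x \<in> carrier M" for x using that by simp
  have "k \<in> lhom A M ?C"
    unfolding k_def
    by (rule restrict_lhom[OF assms(1)], rule module_homI)
      (simp_all only: module_homD[OF q] module_homD[OF t(2)] qc)
  moreover have "k ` carrier M = carrier ?C"
    using t(3) by (auto simp: k_def bij_betw_def image_image)
  moreover have "k x = \<zero>\<^bsub>?C\<^esub> \<longleftrightarrow> x \<in> B" if x: "x \<in> carrier M" for x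
  proof -
    have "k x = \<zero>\<^bsub>?C\<^esub> \<longleftrightarrow> e (r (?q x)) = e (r \<zero>\<^bsub>?Q\<^esub>)"
      using x by (simp add: k_def transport_def)
    also have "\<dots> \<longleftrightarrow> ?q x = \<zero>\<^bsub>?Q\<^esub>"
      by (rule inj_on_eq_iff[OF er qc[OF x]])
        (rule abelian_monoid.zero_closed[OF abelian_group.axioms(1)[OF module.axioms(2)[OF Q]]])
    also have "\<dots> \<longleftrightarrow> x \<in> B" by (simp add: coset_eq_zero_iff[OF assms(2) x])
    finally show ?thesis .
  qed
  ultimately show ?thesis using t(1) by blast
qed

section \<open>Existence of finite limits and colimits\<close>

text \<open>\<open>lim_ob\<close> is a choice, so it has the universal property as soon as some
  limit exists in the universe. That limit is the module of compatible families in the finite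
  product, renamed by an injection.\<close>

lemma lim_ob_limit_cone:
  fixes G :: "('q::order, 'a, 'm) system"
  assumes "cring A" "infinite (UNIV :: 'm set)" "finite Q"
    and G: "\<And>p. p \<in> Q \<Longrightarrow> module A (sob G p)"
      "\<And>p q. p \<in> Q \<Longrightarrow> q \<in> Q \<Longrightarrow> p \<le> q \<Longrightarrow> sar G p q \<in> lhom A (sob G q) (sob G p)"
  shows "limit_cone A Q G (lim_ob A Q G, lim_proj A Q G)"
proof -
  let ?S = "finite_direct_sum Q (sob G)"
  interpret S: module A ?S by (rule finite_direct_sum_module) (use assms in auto)
  obtain e :: "('q \<Rightarrow> 'm) \<Rightarrow> 'm" where e: "inj_on e (extensional Q)"
    using ex_inj_on_extensional[OF assms(2,3)] by blast
  define C where "C = {x \<in> carrier ?S. \<forall>p\<in>Q. \<forall>q\<in>Q. p \<le> q \<longrightarrow> sar G p q (x q) = x p}"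
  have C: "submodule A C ?S"
  proof (rule submodule.intro[OF S.module_axioms])
    note proj = module_homD[OF finite_direct_sum_proj] module_hom_zero_minus(1)[OF S.module_axioms _ finite_direct_sum_proj]
    note sar = lhomD[OF G(2)] module_hom_zero_minus(1)[OF _ _ lhomD(1)[OF G(2)]]
    show "x \<oplus>\<^bsub>?S\<^esub> y \<in> C" if "x \<in> C" "y \<in> C" for x y
      using that by (auto simp: C_def proj sar)
    show "a \<odot>\<^bsub>?S\<^esub> x \<in> C" if "a \<in> carrier A" "x \<in> C" for a x
      using that by (auto simp: C_def proj sar)
    show "\<zero>\<^bsub>?S\<^esub> \<in> C" by (auto simp: C_def proj sar G)
  qed (auto simp: C_def)
  let ?L0 = "?S\<lparr>carrier := C\<rparr>"
  have L0: "module A ?L0" by (rule S.submodule_is_module[OF C])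
  have eC: "inj_on e (carrier ?L0)"
    by (rule inj_on_subset[OF e]) (auto simp: C_def finite_direct_sum_def PiE_def)
  define L where "L = transport e ?L0"
  note L = transport[OF L0 eC, folded L_def]
  define \<pi> where "\<pi> = (\<lambda>p. \<lambda>u\<in>carrier L. inv_into C e u p)"
  have \<pi>_e: "\<pi> p (e x) = x p" if "x \<in> C" for p x
    using that eC by (auto simp: \<pi>_def L_def transport_def)
  have carL: "carrier L = e ` C" by (simp add: L_def transport_def)
  have inv: "inv_into C e \<in> module_hom A L ?L0"
    using module_hom_inv_into[OF L0 L(2,3)] by simp
  have proj: "(\<lambda>x. x p) \<in> module_hom A ?L0 (sob G p)" if "p \<in> Q" for p
    using finite_direct_sum_proj[OF that, of A "sob G"] C_def by (auto simp: module_hom_def)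
  have Ccar: "x p \<in> carrier (sob G p)" if "x \<in> C" "p \<in> Q" for x p
    using that by (auto simp: C_def finite_direct_sum_def)
  have "limit_cone A Q G (L, \<pi>)"
    unfolding limit_cone_def prod.case
  proof (intro conjI allI impI)
    show "cone A Q G L \<pi>"
      unfolding cone_def
    proof (intro conjI ballI impI)
      show \<pi>: "\<pi> p \<in> lhom A L (sob G p)" if "p \<in> Q" for p
        unfolding \<pi>_def
        by (rule restrict_lhom[OF L(1)], rule module_homI)
          (simp_all only: module_homD[OF inv] module_homD[OF proj[OF that]])
      fix p q assume pq: "p \<in> Q" "q \<in> Q" "p \<le> q"
      show "compose (carrier L) (sar G p q) (\<pi> q) = \<pi> p"
        by (rule compose_lhom_eqI[OF L(1) \<pi> G(2) \<pi>])
          (use pq in \<open>auto simp: carL \<pi>_e C_def\<close>)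
    qed (rule L)
    fix X \<xi> assume cone: "cone A Q G X \<xi>"
    then have X: "module A X" and \<xi>: "\<And>p. p \<in> Q \<Longrightarrow> \<xi> p \<in> lhom A X (sob G p)"
      and comp: "\<And>p q x. p \<in> Q \<Longrightarrow> q \<in> Q \<Longrightarrow> p \<le> q \<Longrightarrow> x \<in> carrier X \<Longrightarrow> sar G p q (\<xi> q x) = \<xi> p x"
      by (auto simp: cone_def dest: composeD)
    define t where "t x = (\<lambda>p\<in>Q. \<xi> p x)" for x
    have t: "t x \<in> C" if "x \<in> carrier X" for x
      using that by (auto simp: t_def C_def finite_direct_sum_def comp lhomD[OF \<xi>])
    have "t \<in> module_hom A X ?L0"
      by (rule module_homI)
        (use t in \<open>auto simp: t_def finite_direct_sum_def lhomD[OF \<xi>] intro!: restrict_ext\<close>)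
    then have u: "(\<lambda>x\<in>carrier X. e (t x)) \<in> lhom A X L"
      by (intro restrict_lhom[OF X] module_homI)
        (simp_all only: module_homD[of t A X ?L0] module_homD[OF L(2)])
    show "\<exists>!u. u \<in> lhom A X L \<and> (\<forall>p\<in>Q. compose (carrier X) (\<pi> p) u = \<xi> p)"
    proof (rule ex1I[of _ "\<lambda>x\<in>carrier X. e (t x)"], intro conjI ballI)
      fix p assume p: "p \<in> Q"
      show "compose (carrier X) (\<pi> p) (\<lambda>x\<in>carrier X. e (t x)) = \<xi> p"
      proof (rule extensionalityI[of _ "carrier X"])
        show "\<xi> p \<in> extensional (carrier X)" using lhomD(2)[OF \<xi>[OF p]] .
        show "compose (carrier X) (\<pi> p) (\<lambda>x\<in>carrier X. e (t x)) x = \<xi> p x" if "x \<in> carrier X" for x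
          using that p t by (simp add: compose_eq \<pi>_e) (simp add: t_def)
      qed simp
    next
      fix v assume v: "v \<in> lhom A X L \<and> (\<forall>p\<in>Q. compose (carrier X) (\<pi> p) v = \<xi> p)"
      then have v: "v \<in> lhom A X L" "\<And>p x. p \<in> Q \<Longrightarrow> x \<in> carrier X \<Longrightarrow> \<pi> p (v x) = \<xi> p x"
        by (auto dest: composeD)
      show "v = (\<lambda>x\<in>carrier X. e (t x))"
      proof (rule lhom_eqI[OF v(1) u])
        fix x assume x: "x \<in> carrier X"
        then obtain c where c: "c \<in> C" "v x = e c" using lhomD(3)[OF v(1) x] carL by auto
        have "c = t x"
        proof (rule extensionalityI[of _ Q])
          show "c \<in> extensional Q" using c(1) by (auto simp: C_def finite_direct_sum_def PiE_def)
          show "c p = t x p" if "p \<in> Q" for p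
            using v(2)[OF that x] c that by (simp add: \<pi>_e t_def)
        qed (simp add: t_def)
        then show "v x = (\<lambda>x\<in>carrier X. e (t x)) x" using c x by simp
      qed
    qed (rule u)
  qed
  then have "limit_cone A Q G (SOME c. limit_cone A Q G c)" by (rule someI)
  then show ?thesis by (simp add: lim_ob_def lim_proj_def)
qed

text \<open>Again the point is existence inside the universe: a quotient of the finite direct sum,
  realized by \<open>ex_quotient\<close>.\<close>

lemma colim_ob_colimit_cocone:
  fixes D :: "('q::order, 'a, 'n) system"
  assumes "cring A" "infinite (UNIV :: 'n set)" "finite Q"
    and D: "\<And>p. p \<in> Q \<Longrightarrow> module A (sob D p)"
      "\<And>p q. p \<in> Q \<Longrightarrow> q \<in> Q \<Longrightarrow> p \<le> q \<Longrightarrow> sar D p q \<in> lhom A (sob D p) (sob D q)"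
  shows "colimit_cocone A Q D (colim_ob A Q D, colim_inj A Q D)"
proof -
  let ?S = "finite_direct_sum Q (sob D)"
  interpret S: module A ?S by (rule finite_direct_sum_module) (use assms in auto)
  obtain e :: "('q \<Rightarrow> 'n) \<Rightarrow> 'n" where e: "inj_on e (extensional Q)"
    using ex_inj_on_extensional[OF assms(2,3)] by blast
  define h where "h X \<xi> x = (\<Oplus>\<^bsub>X\<^esub>p\<in>Q. \<xi> p (x p))" for X :: "('a, 'n) module" and \<xi> :: "'q \<Rightarrow> 'n \<Rightarrow> 'n" and x
  have cocone: "module A X" "\<And>p. p \<in> Q \<Longrightarrow> \<xi> p \<in> lhom A (sob D p) X"
    "\<And>p q x. p \<in> Q \<Longrightarrow> q \<in> Q \<Longrightarrow> p \<le> q \<Longrightarrow> x \<in> carrier (sob D p) \<Longrightarrow> \<xi> q (sar D p q x) = \<xi> p x"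
    if "cocone A Q D X \<xi>" for X :: "('a, 'n) module" and \<xi>
    using that by (auto simp: cocone_def dest: composeD)
  have h: "h X \<xi> \<in> module_hom A ?S X" if "cocone A Q D X \<xi>" for X \<xi>
    unfolding h_def
    by (rule finite_direct_sum_map[OF assms(3) cocone(1)[OF that] D(1) lhomD(1)[OF cocone(2)[OF that]]])
  let ?in = "single Q (sob D)"
  have "in": "?in p \<in> module_hom A (sob D p) ?S" if "p \<in> Q" for p
    by (rule single_hom) (use D in auto)
  have h_in: "h X \<xi> (?in p y) = \<xi> p y"
    if "cocone A Q D X \<xi>" "p \<in> Q" "y \<in> carrier (sob D p)" for X \<xi> p y
    unfolding h_def
    by (rule finsum_single[OF cocone(1)[OF that(1)] assms(3) that(2)])
      (use that in \<open>auto simp: single_def lhomD[OF cocone(2)[OF that(1)]]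
        module_hom_zero_minus(1)[OF D(1) cocone(1)[OF that(1)] lhomD(1)[OF cocone(2)[OF that(1)]]]\<close>)
  \<comment> \<open>The relations are taken as the common kernel of the maps induced by all cocones
    instead of being generated. Every cocone then factors by definition, and the expected relations
    lie in \<open>N\<close> because each cocone is compatible.\<close>
  define N where "N = {x \<in> carrier ?S. \<forall>X \<xi>. cocone A Q D X \<xi> \<longrightarrow> h X \<xi> x = \<zero>\<^bsub>X\<^esub>}"
  have N: "submodule A N ?S"
  proof (rule submodule.intro[OF S.module_axioms])
    have z: "\<zero>\<^bsub>X\<^esub> \<oplus>\<^bsub>X\<^esub> \<zero>\<^bsub>X\<^esub> = \<zero>\<^bsub>X\<^esub>" "\<And>a. a \<in> carrier A \<Longrightarrow> a \<odot>\<^bsub>X\<^esub> \<zero>\<^bsub>X\<^esub> = \<zero>\<^bsub>X\<^esub>"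
      if "cocone A Q D X \<xi>" for X \<xi>
    proof -
      interpret X: module A X by (rule cocone(1)[OF that])
      show "\<zero>\<^bsub>X\<^esub> \<oplus>\<^bsub>X\<^esub> \<zero>\<^bsub>X\<^esub> = \<zero>\<^bsub>X\<^esub>" "\<And>a. a \<in> carrier A \<Longrightarrow> a \<odot>\<^bsub>X\<^esub> \<zero>\<^bsub>X\<^esub> = \<zero>\<^bsub>X\<^esub>" by auto
    qed
    show "x \<oplus>\<^bsub>?S\<^esub> y \<in> N" if "x \<in> N" "y \<in> N" for x y
      using that by (auto simp: N_def module_homD[OF h] z)
    show "a \<odot>\<^bsub>?S\<^esub> x \<in> N" if "a \<in> carrier A" "x \<in> N" for a x
      using that by (auto simp: N_def module_homD[OF h] z)
    show "\<zero>\<^bsub>?S\<^esub> \<in> N"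
      by (auto simp: N_def module_hom_zero_minus(1)[OF S.module_axioms cocone(1) h])
  qed (auto simp: N_def)
  obtain C :: "('a, 'n) module" and k where C: "module A C" and k: "k \<in> lhom A ?S C"
    "k ` carrier ?S = carrier C" "\<And>x. x \<in> carrier ?S \<Longrightarrow> k x = \<zero>\<^bsub>C\<^esub> \<longleftrightarrow> x \<in> N"
    using ex_quotient[OF S.module_axioms N inj_on_finite_direct_sum[OF e]] by blast
  interpret C: module A C by (rule C)
  note k' = lhomD[OF k(1)]
  define \<iota> where "\<iota> = (\<lambda>p. \<lambda>y\<in>carrier (sob D p). k (?in p y))"
  have \<iota>: "\<iota> p \<in> lhom A (sob D p) C" if "p \<in> Q" for p
    unfolding \<iota>_def
    by (rule restrict_lhom[OF D(1)[OF that]], rule module_homI)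
      (simp_all only: module_homD[OF "in"[OF that]] k')
  have "colimit_cocone A Q D (C, \<iota>)"
    unfolding colimit_cocone_def prod.case
  proof (intro conjI allI impI)
    show "cocone A Q D C \<iota>"
      unfolding cocone_def
    proof (intro conjI ballI impI)
      fix p q assume pq: "p \<in> Q" "q \<in> Q" "p \<le> q"
      show "compose (carrier (sob D p)) (\<iota> q) (sar D p q) = \<iota> p"
      proof (rule compose_lhom_eqI[OF D(1) D(2) \<iota> \<iota>])
        fix y assume y: "y \<in> carrier (sob D p)"
        let ?y = "sar D p q y"
        have y': "?y \<in> carrier (sob D q)" using lhomD(3)[OF D(2)[OF pq] y] .
        have c: "?in q ?y \<in> carrier ?S" "?in p y \<in> carrier ?S"
          using module_homD(1)[OF "in"] pq y y' by auto
        have "?in q ?y \<ominus>\<^bsub>?S\<^esub> ?in p y \<in> N"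
          unfolding N_def
        proof (intro CollectI conjI allI impI)
          fix X \<xi> assume X: "cocone A Q D X \<xi>"
          interpret X: module A X by (rule cocone(1)[OF X])
          have "h X \<xi> (?in q ?y \<ominus>\<^bsub>?S\<^esub> ?in p y) = \<xi> q ?y \<ominus>\<^bsub>X\<^esub> \<xi> p y"
            using c h_in[OF X] pq y y'
            by (simp add: module_hom_zero_minus(3)[OF S.module_axioms cocone(1)[OF X] h[OF X]])
          also have "\<dots> = \<zero>\<^bsub>X\<^esub>"
            using cocone(3)[OF X pq y] lhomD(3)[OF cocone(2)[OF X pq(1)] y] by (simp add: a_minus_def X.r_neg)
          finally show "h X \<xi> (?in q ?y \<ominus>\<^bsub>?S\<^esub> ?in p y) = \<zero>\<^bsub>X\<^esub>" .
        qed (use c in simp)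
        then have "k (?in q ?y \<ominus>\<^bsub>?S\<^esub> ?in p y) = \<zero>\<^bsub>C\<^esub>"
          using k(3) by (simp add: N_def)
        then have "k (?in q ?y) \<ominus>\<^bsub>C\<^esub> k (?in p y) = \<zero>\<^bsub>C\<^esub>"
          by (simp only: module_hom_zero_minus(3)[OF S.module_axioms C k'(1) c])
        then have "k (?in q ?y) = k (?in p y)" using c k'(3) by (simp add: module_minus_eq_zero_iff[OF C])
        then show "\<iota> q (sar D p q y) = \<iota> p y" using y y' by (simp add: \<iota>_def)
      qed (use pq in auto)
    qed (auto simp: C \<iota>)
    fix X \<xi> assume X: "cocone A Q D X \<xi>"
    obtain u where u: "u \<in> lhom A C X" "\<And>x. x \<in> carrier ?S \<Longrightarrow> u (k x) = h X \<xi> x"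
      using lhom_factor[OF S.module_axioms C cocone(1)[OF X] k(1,2) h[OF X]] k(3) X
      by (auto simp: N_def)
    show "\<exists>!u. u \<in> lhom A C X \<and> (\<forall>p\<in>Q. compose (carrier (sob D p)) u (\<iota> p) = \<xi> p)"
    proof (rule ex1I[of _ u], intro conjI ballI)
      fix p assume p: "p \<in> Q"
      show "compose (carrier (sob D p)) u (\<iota> p) = \<xi> p"
        by (rule compose_lhom_eqI[OF D(1)[OF p] \<iota>[OF p] u(1) cocone(2)[OF X p]])
          (use p in \<open>simp add: \<iota>_def u(2) module_homD(1)[OF "in"] h_in[OF X]\<close>)
    next
      fix v assume "v \<in> lhom A C X \<and> (\<forall>p\<in>Q. compose (carrier (sob D p)) v (\<iota> p) = \<xi> p)"
      then have v: "v \<in> lhom A C X"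
        "\<And>p y. p \<in> Q \<Longrightarrow> y \<in> carrier (sob D p) \<Longrightarrow> v (k (?in p y)) = \<xi> p y"
        by (auto dest!: composeD simp: \<iota>_def)
      show "v = u"
      proof (rule lhom_eqI[OF v(1) u(1)])
        fix c assume "c \<in> carrier C"
        then obtain x where x: "x \<in> carrier ?S" "c = k x" using k(2) by auto
        have xp: "\<And>p. p \<in> Q \<Longrightarrow> x p \<in> carrier (sob D p)" using x(1) by (auto simp: finite_direct_sum_def)
        have vk: "(\<lambda>x. v (k x)) \<in> module_hom A ?S X"
          by (rule module_homI) (simp_all only: k' lhomD[OF v(1)])
        \<comment> \<open>Elements of \<open>C\<close> come from sums of coordinate vectors, and on
          these \<open>v\<close> is prescribed.\<close>
        have "v (k (\<Oplus>\<^bsub>?S\<^esub>p\<in>Q. ?in p (x p))) = (\<Oplus>\<^bsub>X\<^esub>p\<in>Q. v (k (?in p (x p))))"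
          by (rule finsum_hom[OF S.module_axioms cocone(1)[OF X] vk assms(3)])
            (use xp module_homD(1)[OF "in"] in auto)
        also have "\<dots> = h X \<xi> x"
        proof -
          interpret X: module A X by (rule cocone(1)[OF X])
          show ?thesis
            unfolding h_def
            by (rule X.finsum_cong') (use xp v(2) lhomD(3)[OF cocone(2)[OF X]] in auto)
        qed
        finally show "v c = u c"
          using x u(2) sum_single[OF assms(3,1) D(1) x(1)] by simp
      qed
    qed (rule u(1))
  qed
  then have "colimit_cocone A Q D (SOME c. colimit_cocone A Q D c)" by (rule someI)
  then show ?thesis by (simp add: colim_ob_def colim_inj_def)
qed

section \<open>Projective resolutions\<close>

text \<open>A word is a formal linear combination with basis elements \<open>x\<close>; this is its
  value once each \<open>x\<close> is sent to \<open>n x\<close>.\<close>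

fun eval_word :: "('a, 'm) module \<Rightarrow> ('x \<Rightarrow> 'm) \<Rightarrow> ('a \<times> 'x) list \<Rightarrow> 'm" where
  "eval_word N n [] = \<zero>\<^bsub>N\<^esub>"
| "eval_word N n ((a, x) # w) = a \<odot>\<^bsub>N\<^esub> n x \<oplus>\<^bsub>N\<^esub> eval_word N n w"

lemma eval_word:
  assumes "module A N" "n \<in> X \<rightarrow> carrier N" "w \<in> lists (carrier A \<times> X)"
  shows "eval_word N n w \<in> carrier N"
    and "v \<in> lists (carrier A \<times> X) \<Longrightarrow> eval_word N n (w @ v) = eval_word N n w \<oplus>\<^bsub>N\<^esub> eval_word N n v"
    and "a \<in> carrier A \<Longrightarrow>
      eval_word N n (map (\<lambda>(b, x). (a \<otimes>\<^bsub>A\<^esub> b, x)) w) = a \<odot>\<^bsub>N\<^esub> eval_word N n w"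
proof -
  interpret N: module A N by fact
  have n: "x \<in> X \<Longrightarrow> n x \<in> carrier N" for x using assms(2) by auto
  have c: "eval_word N n w \<in> carrier N" if "w \<in> lists (carrier A \<times> X)" for w
    using that by (induction w) (auto simp: n)
  then show "eval_word N n w \<in> carrier N" using assms(3) .
  show "eval_word N n (w @ v) = eval_word N n w \<oplus>\<^bsub>N\<^esub> eval_word N n v" if v: "v \<in> lists (carrier A \<times> X)"
    using assms(3)
  proof induction
    case (Cons p w)
    then show ?case using n c[OF v] c[OF Cons(2)] by (cases p) (simp add: N.a_assoc)
  qed (use c[OF v] in simp)
  show "eval_word N n (map (\<lambda>(b, x). (a \<otimes>\<^bsub>A\<^esub> b, x)) w) = a \<odot>\<^bsub>N\<^esub> eval_word N n w" if "a \<in> carrier A"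
    using assms(3)
  proof induction
    case (Cons p w)
    then show ?case using n that c[OF Cons(2)] by (cases p) (simp add: N.smult_r_distr N.smult_assoc1)
  qed (use that in simp)
qed

lemma hom_eval_word:
  assumes "module A N" "module A L" "g \<in> module_hom A N L" "n \<in> X \<rightarrow> carrier N"
    "w \<in> lists (carrier A \<times> X)"
  shows "g (eval_word N n w) = eval_word L (\<lambda>x. g (n x)) w"
proof -
  interpret N: module A N by fact
  have n: "x \<in> X \<Longrightarrow> n x \<in> carrier N" for x using assms(4) by auto
  show ?thesis
    using assms(5)
  proof (induction w)
    case Nil
    show ?case by (simp add: module_hom_zero_minus(1)[OF assms(1-3)])
  next
    case (Cons p w)
    then show ?case
      using eval_word(1)[OF assms(1,4), of w] n
      by (cases p) (simp add: module_homD[OF assms(3)] in_listsI)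
  qed
qed

text \<open>The free module on the set \<open>carrier M\<close> is built from words. Identifying
  words by their values in all modules makes the evaluations jointly injective, so the module axioms
  hold at once. Lifting is equally direct: a choice of preimages of the generators is itself one of
  the evaluations.\<close>

lemma ex_projective_cover:
  fixes M :: "('a, 'm) module"
  assumes "cring A" "large_universe A TYPE('m)" "module A M"
  shows "\<exists>(F :: ('a, 'm) module) \<epsilon>. projective_module A F \<and> \<epsilon> \<in> lhom A F M \<and> \<epsilon> ` carrier F = carrier M"
proof -
  interpret A: cring A by fact
  interpret M: module A M by fact
  define W where "W = lists (carrier A \<times> carrier M)"
  \<comment> \<open>Only modules in the type \<open>'m\<close> occur, which are exactly those
    against which \<open>projective_module\<close> tests.\<close>
  define I :: "(('a, 'm) module \<times> ('m \<Rightarrow> 'm)) set"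
    where "I = {(N, n). module A N \<and> n \<in> carrier M \<rightarrow> carrier N}"
  have I: "module A (fst i)" "snd i \<in> carrier M \<rightarrow> carrier (fst i)" if "i \<in> I" for i
    using that by (auto simp: I_def)
  let ?ev = "\<lambda>i. eval_word (fst i) (snd i)"
  note ev = eval_word[OF I, folded W_def]
  obtain l :: "'m list \<Rightarrow> 'm" where l: "inj l"
    using ex_inj_list assms(2) unfolding large_universe_def by blast
  obtain t :: "'a \<Rightarrow> 'm" where t: "inj_on t (carrier A)"
    using assms(2) unfolding large_universe_def lepoll_def by blast
  \<comment> \<open>A letter \<open>(a, x)\<close> becomes the code of the two-element list
    \<open>[t a, x]\<close>, and a word becomes the code of the list of its letters. The injection
    \<open>t\<close> exists because the universe is at least as large as \<open>A\<close>.\<close>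
  define enc where "enc w = l (map (\<lambda>(a, x). l [t a, x]) w)" for w
  have enc: "inj_on enc W"
  proof (rule inj_onI)
    fix v w assume vw: "v \<in> W" "w \<in> W" "enc v = enc w"
    have "inj_on (\<lambda>(a, x). l [t a, x]) (set v \<union> set w)"
      by (rule inj_onI) (use vw l in \<open>auto simp: W_def inj_eq dest!: inj_onD[OF t]\<close>)
    moreover have "map (\<lambda>(a, x). l [t a, x]) v = map (\<lambda>(a, x). l [t a, x]) w"
      using vw(3) l by (simp add: enc_def inj_eq)
    ultimately show "v = w" by (rule map_inj_on[rotated])
  qed
  \<comment> \<open>The free module on \<open>carrier M\<close>: words modulo having the same value in all modules.\<close>
  define eqv where "eqv v w \<longleftrightarrow> (\<forall>i\<in>I. ?ev i v = ?ev i w)" for v w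
  \<comment> \<open>The choice depends only on the equivalence class of \<open>w\<close>, so it is a
    normal form; its code is the element of the free module.\<close>
  define r where "r w = (SOME v. v \<in> W \<and> eqv w v)" for w
  have r: "r w \<in> W" "eqv w (r w)" if "w \<in> W" for w
    using someI[of "\<lambda>v. v \<in> W \<and> eqv w v" w] that by (auto simp: r_def eqv_def)
  have r_eq: "r v = r w" if "eqv v w" for v w
  proof -
    have "(\<lambda>u. u \<in> W \<and> eqv v u) = (\<lambda>u. u \<in> W \<and> eqv w u)" using that by (auto simp: eqv_def)
    then show ?thesis by (simp add: r_def)
  qed
  define nf where "nf w = enc (r w)" for w
  have nf_eq: "nf v = nf w \<longleftrightarrow> eqv v w" if "v \<in> W" "w \<in> W" for v w
  proof
    assume "nf v = nf w"
    then have "r v = r w" using r that enc by (auto simp: nf_def dest: inj_onD)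
    then show "eqv v w" using r(2)[OF that(1)] r(2)[OF that(2)] by (simp add: eqv_def)
  qed (simp add: nf_def r_eq)
  define rep where "rep = inv_into W nf"
  have rep: "rep u \<in> W" "nf (rep u) = u" if "u \<in> nf ` W" for u
    using that by (auto simp: rep_def inv_into_into f_inv_into_f)
  define F :: "('a, 'm) module" where
    "F = \<lparr>carrier = nf ` W, mult = undefined, one = undefined, zero = nf [],
      add = (\<lambda>u v. nf (rep u @ rep v)),
      smult = (\<lambda>a u. nf (map (\<lambda>(b, x). (a \<otimes>\<^bsub>A\<^esub> b, x)) (rep u)))\<rparr>"
  have carF: "carrier F = nf ` W" by (simp add: F_def)
  have Nil: "[] \<in> W" by (simp add: W_def)
  have app: "v @ w \<in> W" if "v \<in> W" "w \<in> W" for v w using that by (auto simp: W_def)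
  have scale: "map (\<lambda>(b, x). (a \<otimes>\<^bsub>A\<^esub> b, x)) w \<in> W" if "a \<in> carrier A" "w \<in> W" for a w
    using that by (fastforce simp: W_def)
  define \<phi> where "\<phi> i u = ?ev i (rep u)" for i :: "('a, 'm) module \<times> ('m \<Rightarrow> 'm)" and u
  have \<phi>_nf: "\<phi> i (nf w) = ?ev i w" if "w \<in> W" "i \<in> I" for i w
    using nf_eq[of "rep (nf w)" w] rep[of "nf w"] that by (auto simp: \<phi>_def eqv_def)
  have \<phi>: "\<phi> i \<in> module_hom A F (fst i)" if "i \<in> I" for i
  proof (rule module_homI, goal_cases)
    case (1 x)
    then show ?case using rep ev(1)[OF that that] by (simp add: \<phi>_def carF)
  next
    case (2 x y)
    then have "rep x \<in> W" "rep y \<in> W" using rep by (auto simp: carF)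
    then show ?case using that by (simp add: F_def \<phi>_nf app ev(2)) (simp add: \<phi>_def)
  next
    case (3 a x)
    then have "rep x \<in> W" using rep by (auto simp: carF)
    then show ?case using that 3 by (simp add: F_def \<phi>_nf scale ev(3)) (simp add: \<phi>_def)
  qed
  have \<phi>_inj: "u = v" if uv: "u \<in> carrier F" "v \<in> carrier F" "\<And>i. i \<in> I \<Longrightarrow> \<phi> i u = \<phi> i v" for u v
  proof -
    have "nf (rep u) = nf (rep v)"
      using uv rep by (subst nf_eq) (auto simp: carF eqv_def \<phi>_def)
    then show ?thesis using uv rep by (simp add: carF)
  qed
  have F: "module A F"
  proof (rule module_jointly_faithful[where I = I and M = fst and \<phi> = \<phi>])
    show "\<phi> i \<zero>\<^bsub>F\<^esub> = \<zero>\<^bsub>fst i\<^esub>" if "i \<in> I" for i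
      using that by (simp add: F_def \<phi>_nf Nil)
    show "\<zero>\<^bsub>F\<^esub> \<in> carrier F" by (auto simp: F_def Nil)
    show "u \<oplus>\<^bsub>F\<^esub> v \<in> carrier F" if "u \<in> carrier F" "v \<in> carrier F" for u v
      using that rep by (auto simp: F_def intro!: imageI app)
    show "a \<odot>\<^bsub>F\<^esub> u \<in> carrier F" if "a \<in> carrier A" "u \<in> carrier F" for a u
      using that rep by (auto simp: F_def intro!: imageI scale)
  qed (use I \<phi> \<phi>_inj assms(1) in auto)
  interpret F: module A F by (rule F)
  have nfW: "nf w \<in> carrier F" if "w \<in> W" for w using that by (simp add: carF)
  \<comment> \<open>A homomorphism out of \<open>F\<close> is determined by its values on the
    generators, the one-letter words with coefficient one.\<close>
  have hom_nf: "f (nf w) = eval_word L (\<lambda>x. f (nf [(\<one>\<^bsub>A\<^esub>, x)])) w"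
    if L: "module A L" and f: "f \<in> module_hom A F L" and w: "w \<in> W" for L :: "('a, 'm) module" and f w
  proof -
    have "f (nf w) = eval_word L (\<lambda>x. f (nf [(\<one>\<^bsub>A\<^esub>, x)])) w"
      using w unfolding W_def
    proof (induction w)
      case Nil
      have "nf [] = \<zero>\<^bsub>F\<^esub>" by (simp add: F_def)
      then show ?case by (simp add: module_hom_zero_minus(1)[OF F L f])
    next
      case (Cons p w)
      obtain a x where p: "p = (a, x)" by (cases p)
      have ax: "a \<in> carrier A" "x \<in> carrier M" and w: "w \<in> W" using Cons p by (auto simp: W_def)
      have s: "[(\<one>\<^bsub>A\<^esub>, x)] \<in> W" "(a, x) # w \<in> W" using ax w by (auto simp: W_def)
      have "nf ((a, x) # w) = a \<odot>\<^bsub>F\<^esub> nf [(\<one>\<^bsub>A\<^esub>, x)] \<oplus>\<^bsub>F\<^esub> nf w"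
      proof (rule \<phi>_inj)
        fix i assume i: "i \<in> I"
        interpret N: module A "fst i" by (rule I(1)[OF i])
        have "snd i x \<in> carrier (fst i)" using I(2)[OF i] ax by auto
        then show "\<phi> i (nf ((a, x) # w)) = \<phi> i (a \<odot>\<^bsub>F\<^esub> nf [(\<one>\<^bsub>A\<^esub>, x)] \<oplus>\<^bsub>F\<^esub> nf w)"
          using ax w s i by (simp add: module_homD[OF \<phi>[OF i]] nfW \<phi>_nf)
      qed (use ax w s nfW in auto)
      then show ?case
        using Cons p ax w s nfW by (simp add: module_homD[OF f])
    qed
    then show ?thesis .
  qed
  have "projective_module A F"
    unfolding projective_module_def
  proof (intro conjI allI impI)
    fix N L :: "('a, 'm) module" and g f
    assume N: "module A N" and L: "module A L" and g: "g \<in> lhom A N L" "g ` carrier N = carrier L"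
      and f: "f \<in> lhom A F L"
    define n where "n x = inv_into (carrier N) g (f (nf [(\<one>\<^bsub>A\<^esub>, x)]))" for x
    have n: "n x \<in> carrier N" "g (n x) = f (nf [(\<one>\<^bsub>A\<^esub>, x)])" if "x \<in> carrier M" for x
    proof -
      have "f (nf [(\<one>\<^bsub>A\<^esub>, x)]) \<in> g ` carrier N"
        using that by (auto simp: g(2) W_def intro!: lhomD(3)[OF f] nfW)
      then show "n x \<in> carrier N" "g (n x) = f (nf [(\<one>\<^bsub>A\<^esub>, x)])"
        unfolding n_def by (auto intro: inv_into_into f_inv_into_f)
    qed
    \<comment> \<open>The chosen preimages form an index, so evaluation at it is the desired
      lift.\<close>
    have i: "(N, n) \<in> I" using N n by (auto simp: I_def)
    let ?e = "\<lambda>u\<in>carrier F. \<phi> (N, n) u"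
    have e: "?e \<in> lhom A F N" using restrict_lhom[OF F \<phi>[OF i]] by simp
    have "compose (carrier F) g ?e = f"
    proof (rule compose_lhom_eqI[OF F e g(1) f])
      fix u assume "u \<in> carrier F"
      then obtain w where w: "w \<in> W" "u = nf w" by (auto simp: carF)
      have "g (?e u) = g (eval_word N n w)" using w i nfW by (simp add: \<phi>_nf)
      also have "\<dots> = eval_word L (\<lambda>x. g (n x)) w"
        by (rule hom_eval_word[OF N L lhomD(1)[OF g(1)], of _ "carrier M"]) (use n w in \<open>auto simp: W_def\<close>)
      also have "\<dots> = eval_word L (\<lambda>x. f (nf [(\<one>\<^bsub>A\<^esub>, x)])) w"
        using w(1) unfolding W_def by (induction w) (auto simp: n)
      also have "\<dots> = f u" using hom_nf[OF L lhomD(1)[OF f] w(1)] w by simp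
      finally show "g (?e u) = f u" .
    qed
    then show "\<exists>e\<in>lhom A F N. compose (carrier F) g e = f" using e by blast
  qed (rule F)
  \<comment> \<open>The cover itself is evaluation at the identity valuation of
    \<open>M\<close>.\<close>
  moreover have i: "(M, \<lambda>x. x) \<in> I" using assms(3) by (auto simp: I_def)
  let ?\<epsilon> = "\<lambda>u\<in>carrier F. \<phi> (M, \<lambda>x. x) u"
  have "?\<epsilon> \<in> lhom A F M" using restrict_lhom[OF F \<phi>[OF i]] by simp
  moreover have "?\<epsilon> ` carrier F = carrier M"
  proof
    show "carrier M \<subseteq> ?\<epsilon> ` carrier F"
    proof
      fix x assume x: "x \<in> carrier M"
      then have w: "[(\<one>\<^bsub>A\<^esub>, x)] \<in> W" by (simp add: W_def)
      have "?\<epsilon> (nf [(\<one>\<^bsub>A\<^esub>, x)]) = x" using x i w nfW by (simp add: \<phi>_nf)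
      then show "x \<in> ?\<epsilon> ` carrier F" using nfW[OF w] by (metis imageI)
    qed
  qed (use module_homD(1)[OF \<phi>[OF i]] in auto)
  ultimately show ?thesis by blast
qed

text \<open>Syzygies are iterated: cover \<open>M\<close>, take the kernel of the cover, and cover
  it again.\<close>

lemma ex_projective_resolution:
  fixes M :: "('a, 'm) module"
  assumes "cring A" "large_universe A TYPE('m)" "module A M"
  shows "\<exists>r. projective_resolution A M r"
proof -
  define cov :: "('a, 'm) module \<Rightarrow> ('a, 'm) module \<times> ('m \<Rightarrow> 'm)" where
    "cov N = (SOME c. projective_module A (fst c) \<and> snd c \<in> lhom A (fst c) N \<and>
      snd c ` carrier (fst c) = carrier N)" for N
  have "projective_module A (fst (cov N)) \<and> snd (cov N) \<in> lhom A (fst (cov N)) N \<and>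
      snd (cov N) ` carrier (fst (cov N)) = carrier N" if "module A N" for N
    unfolding cov_def by (rule someI_ex) (use ex_projective_cover[OF assms(1,2) that] in auto)
  then have cov: "projective_module A (fst (cov N))" "module A (fst (cov N))"
      "snd (cov N) \<in> lhom A (fst (cov N)) N" "snd (cov N) ` carrier (fst (cov N)) = carrier N"
    if "module A N" for N
    using that by (auto simp: projective_module_def)
  \<comment> \<open>\<open>K N\<close> is the first syzygy of \<open>N\<close> for its chosen cover,
    so \<open>m n\<close> below is the \<open>n\<close>-th syzygy of \<open>M\<close>.\<close>
  define K where "K N = (fst (cov N))\<lparr>carrier := lker (fst (cov N)) N (snd (cov N))\<rparr>" for N
  have K: "module A (K N)" if "module A N" for N
    unfolding K_def
    by (rule module.submodule_is_module[OF cov(2)[OF that]])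
      (rule lker_submodule[OF cov(2) that lhomD(1)[OF cov(3)]], rule that, rule that)
  define m where "m n = (K ^^ n) M" for n
  have m: "module A (m n)" for n
    by (induction n) (auto simp: m_def assms(3) K)
  have mS: "m (Suc n) = K (m n)" for n by (simp add: m_def)
  let ?F = "\<lambda>n. fst (cov (m n))" and ?\<epsilon> = "\<lambda>n. snd (cov (m n))"
  \<comment> \<open>The inclusion of a syzygy into the module covering the previous one does not
    change elements, so the cover of the next syzygy is itself the differential.\<close>
  have d: "?\<epsilon> (Suc n) \<in> lhom A (?F (Suc n)) (?F n)" for n
    using cov(3)[OF m[of "Suc n"]]
    by (auto simp: mS[of n] K_def lhom_def module_hom_def lker_def)
  have im: "?\<epsilon> (Suc n) ` carrier (?F (Suc n)) = lker (?F n) (m n) (?\<epsilon> n)" for n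
    using cov(4)[OF m[of "Suc n"]] by (simp add: mS[of n] K_def)
  have "projective_resolution A M (?F, \<lambda>n. ?\<epsilon> (Suc n), ?\<epsilon> 0)"
    unfolding projective_resolution_def prod.case
  proof (intro conjI allI)
    show "?\<epsilon> (Suc (Suc n)) ` carrier (?F (Suc (Suc n))) = lker (?F (Suc n)) (?F n) (?\<epsilon> (Suc n))" for n
      unfolding im[of "Suc n"] by (simp add: lker_def mS[of n] K_def)
    show "?\<epsilon> (Suc 0) ` carrier (?F (Suc 0)) = lker (?F 0) M (?\<epsilon> 0)"
      unfolding im[of 0] by (simp add: lker_def m_def)
    show "?\<epsilon> 0 \<in> lhom A (?F 0) M" "?\<epsilon> 0 ` carrier (?F 0) = carrier M"
      using cov(3,4)[OF m[of 0]] by (simp_all add: m_def)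
  qed (use cov m d in auto)
  then show ?thesis by blast
qed

text \<open>Projectivity speaks about surjections; \<open>g\<close> is made surjective by shrinking
  its target to its image, which contains the values of \<open>h\<close>.\<close>

lemma projective_lift:
  fixes F N L :: "('a, 'm) module"
  assumes "projective_module A F" "module A N" "module A L" "g \<in> lhom A N L" "h \<in> lhom A F L"
    and "\<And>x. x \<in> carrier F \<Longrightarrow> h x \<in> g ` carrier N"
  shows "\<exists>e \<in> lhom A F N. \<forall>x\<in>carrier F. g (e x) = h x"
proof -
  interpret L: module A L by fact
  let ?L = "L\<lparr>carrier := g ` carrier N\<rparr>"
  have L': "module A ?L"
    by (rule L.submodule_is_module[OF image_submodule[OF assms(2,3) lhomD(1)[OF assms(4)]]])
  have "g \<in> lhom A N ?L" "h \<in> lhom A F ?L"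
    by (rule lhom_codomain_submodule, use assms in auto)+
  moreover have "g ` carrier N = carrier ?L" by simp
  ultimately obtain e where "e \<in> lhom A F N" "compose (carrier F) g e = h"
    using assms(1,2) L' unfolding projective_module_def by meson
  then show ?thesis by (metis composeD)
qed

section \<open>Additivity of the functor\<close>

definition zero_mod :: "('a, 'm) module" where
  "zero_mod = \<lparr>carrier = {undefined}, mult = undefined, one = undefined, zero = undefined,
    add = (\<lambda>_ _. undefined), smult = (\<lambda>_ _. undefined)\<rparr>"

lemma zero_mod: "cring A \<Longrightarrow> module A zero_mod" "zero_module zero_mod"
  by (auto intro!: module_criteria simp: zero_mod_def zero_module_def)

lemma finsum_lhom:
  assumes "module A M" "module A N" "finite I" "\<And>i. i \<in> I \<Longrightarrow> f i \<in> lhom A M N"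
  shows "(\<lambda>x\<in>carrier M. \<Oplus>\<^bsub>N\<^esub>i\<in>I. f i x) \<in> lhom A M N"
proof (rule restrict_lhom[OF assms(1)])
  interpret N: module A N by fact
  note f = lhomD[OF assms(4)]
  show "(\<lambda>x. \<Oplus>\<^bsub>N\<^esub>i\<in>I. f i x) \<in> module_hom A M N"
  proof (rule module_homI, goal_cases)
    case (1 x)
    then show ?case by (intro N.finsum_closed) (use f in auto)
  next
    case (2 x y)
    then have "(\<Oplus>\<^bsub>N\<^esub>i\<in>I. f i (x \<oplus>\<^bsub>M\<^esub> y)) = (\<Oplus>\<^bsub>N\<^esub>i\<in>I. f i x \<oplus>\<^bsub>N\<^esub> f i y)"
      by (intro N.finsum_cong') (use f in auto)
    also have "\<dots> = (\<Oplus>\<^bsub>N\<^esub>i\<in>I. f i x) \<oplus>\<^bsub>N\<^esub> (\<Oplus>\<^bsub>N\<^esub>i\<in>I. f i y)"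
      by (rule N.finsum_addf) (use 2 f in auto)
    finally show ?case .
  next
    case (3 a x)
    then have "(\<Oplus>\<^bsub>N\<^esub>i\<in>I. f i (a \<odot>\<^bsub>M\<^esub> x)) = (\<Oplus>\<^bsub>N\<^esub>i\<in>I. a \<odot>\<^bsub>N\<^esub> f i x)"
      by (intro N.finsum_cong') (use f in auto)
    also have "\<dots> = a \<odot>\<^bsub>N\<^esub> (\<Oplus>\<^bsub>N\<^esub>i\<in>I. f i x)"
      by (rule N.finsum_smult_ldistr[symmetric]) (use 3 f assms in auto)
    finally show ?case .
  qed
qed

locale module_functor =
  fixes A :: "'a ring" and T :: "('a, 'm, 'n) mfunctor"
  assumes cring: "cring A"
    and large: "large_universe A TYPE('m)" "large_universe A TYPE('n)"
    and T: "contravariant_functor A T"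
    and left_exact: "left_exact A T"
    and direct_sums: "commutes_with_finite_direct_sums A T"
begin

sublocale A: cring A by (rule cring)

lemma inf: "infinite (UNIV :: 'm set)" "infinite (UNIV :: 'n set)"
  using large by (auto simp: large_universe_def)

lemma T_module: "module A M \<Longrightarrow> module A (fob T M)"
  using T by (simp add: contravariant_functor_def)

lemma T_lhom: "module A M \<Longrightarrow> module A N \<Longrightarrow> f \<in> lhom A M N \<Longrightarrow> far T M N f \<in> lhom A (fob T N) (fob T M)"
  using T by (simp add: contravariant_functor_def)

lemmas T_hom = lhomD[OF T_lhom]

lemma T_id: "module A M \<Longrightarrow> y \<in> carrier (fob T M) \<Longrightarrow> far T M M (lid M) y = y"
  using T by (simp add: contravariant_functor_def)

lemma T_compose:
  assumes "module A L" "module A M" "module A N" "f \<in> lhom A L M" "g \<in> lhom A M N" "h \<in> lhom A L N"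
    and "\<And>x. x \<in> carrier L \<Longrightarrow> g (f x) = h x" and "y \<in> carrier (fob T N)"
  shows "far T L M f (far T M N g y) = far T L N h y"
proof -
  have "far T L N (compose (carrier L) g f) = compose (carrier (fob T N)) (far T L M f) (far T M N g)"
    using T assms unfolding contravariant_functor_def by blast
  moreover have "compose (carrier L) g f = h" by (rule compose_lhom_eqI) fact+
  ultimately show ?thesis using assms(8) by (simp add: compose_eq)
qed

text \<open>A zero module is an empty direct sum; for \<open>n = 0\<close> the canonical map is a
  bijection onto the empty product, which has one element.\<close>

lemma T_zero_module:
  assumes "module A Z" "zero_module Z" shows "zero_module (fob T Z)"
proof -
  interpret Z: module A Z by fact
  interpret TZ: module A "fob T Z" by (rule T_module) fact
  have "direct_sum_of A 0 (\<lambda>_. Z) Z (\<lambda>_. undefined)"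
    using assms by (auto simp: direct_sum_of_def zero_module_def)
  then have "bij_betw (\<lambda>y. \<lambda>i\<in>{..<0::nat}. far T Z Z undefined y) (carrier (fob T Z))
      (\<Pi>\<^sub>E i\<in>{..<0}. carrier (fob T Z))"
    using direct_sums unfolding commutes_with_finite_direct_sums_def by blast
  note inj = inj_onD[OF bij_betw_imp_inj_on[OF this]]
  have "x = y" if "x \<in> carrier (fob T Z)" "y \<in> carrier (fob T Z)" for x y
    by (rule inj) (use that in auto)
  then show ?thesis using TZ.zero_closed by (auto simp: zero_module_def)
qed

text \<open>A zero map factors through a zero module.\<close>

lemma T_lzero:
  assumes "module A M" "module A N" "y \<in> carrier (fob T N)"
  shows "far T M N (lzero M N) y = \<zero>\<^bsub>fob T M\<^esub>"
proof -
  define Z :: "('a, 'm) module" where "Z = zero_mod"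
  have Z: "module A Z" "zero_module Z" using zero_mod cring by (auto simp: Z_def)
  note l = lzero_lhom[OF assms(1) Z(1)] lzero_lhom[OF Z(1) assms(2)]
  have zz: "\<zero>\<^bsub>Z\<^esub> \<in> carrier Z" using Z(2) by (simp add: zero_module_def)
  have "far T M Z (lzero M Z) (far T Z N (lzero Z N) y) = far T M N (lzero M N) y"
    by (rule T_compose[OF assms(1) Z(1) assms(2) l lzero_lhom[OF assms(1,2)]]) (use assms zz in auto)
  moreover have "far T Z N (lzero Z N) y = \<zero>\<^bsub>fob T Z\<^esub>"
    using T_hom(3)[OF Z(1) assms(2) l(2) assms(3)] T_zero_module[OF Z] by (simp add: zero_module_def)
  ultimately show ?thesis
    using module_hom_zero_minus(1)[OF T_module[OF Z(1)] T_module[OF assms(1)] T_hom(1)[OF assms(1) Z(1) l(1)]]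
    by simp
qed

text \<open>\<open>direct_sum_of\<close> records the injections only; additivity of \<open>T\<close>
  also uses the projections, so both are provided for one copy of the sum in the universe.\<close>

lemma ex_biproduct:
  assumes "module A M"
  shows "\<exists>(S :: ('a, 'm) module) i p. direct_sum_of A 2 (\<lambda>_. M) S i \<and>
    (\<forall>k<2. p k \<in> lhom A S M) \<and>
    (\<forall>k<2. \<forall>l<2. \<forall>x\<in>carrier M. p k (i l x) = (if k = l then x else \<zero>\<^bsub>M\<^esub>)) \<and>
    (\<forall>s\<in>carrier S. i 0 (p 0 s) \<oplus>\<^bsub>S\<^esub> i (Suc 0) (p (Suc 0) s) = s)"
proof -
  interpret M: module A M by fact
  let ?I = "{..<2::nat}"
  let ?S0 = "finite_direct_sum ?I (\<lambda>_. M)"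
  have S0: "module A ?S0" by (rule finite_direct_sum_module) (use assms cring in auto)
  obtain e :: "(nat \<Rightarrow> 'm) \<Rightarrow> 'm" where e: "inj_on e (extensional ?I)"
    using ex_inj_on_extensional[OF inf(1), of ?I] by blast
  note e0 = inj_on_finite_direct_sum[OF e, of "\<lambda>_. M"]
  define S where "S = transport e ?S0"
  note S = transport[OF S0 e0, folded S_def]
  interpret S: module A S by (rule S(1))
  define i where "i k = (\<lambda>x\<in>carrier M. e (single ?I (\<lambda>_. M) k x))" for k
  define p where "p k = (\<lambda>s\<in>carrier S. inv_into (carrier ?S0) e s k)" for k :: nat
  have sing: "single ?I (\<lambda>_. M) k \<in> module_hom A M ?S0" for k
    using single_hom[of ?I A "\<lambda>_. M" k] assms by auto
  have i: "i k \<in> lhom A M S" for k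
    unfolding i_def
    by (rule restrict_lhom[OF assms], rule module_homI) (simp_all only: module_homD[OF sing] module_homD[OF S(2)])
  note inv = module_hom_inv_into[OF S0 S(2,3)]
  have p: "p k \<in> lhom A S M" if "k < 2" for k
  proof -
    have k: "k \<in> ?I" using that by simp
    show ?thesis
      unfolding p_def
      by (rule restrict_lhom[OF S(1)], rule module_homI)
        (simp_all only: module_homD[OF inv] module_homD[OF finite_direct_sum_proj[OF k, of A "\<lambda>_. M"]])
  qed
  have p_e: "p k (e x) = x k" if "x \<in> carrier ?S0" for x k
    using that e0 module_homD(1)[OF S(2) that] by (simp add: p_def)
  have pi: "p k (i l x) = (if k = l then x else \<zero>\<^bsub>M\<^esub>)" if "k < 2" "l < 2" "x \<in> carrier M" for k l x
    using that p_e[OF module_homD(1)[OF sing]] by (simp add: i_def single_def)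
  have carS: "carrier S = e ` carrier ?S0" by (simp add: S_def transport_def)
  have I: "?I = {0, Suc 0}" by auto
  have S_eqI: "s = t" if st: "s \<in> carrier S" "t \<in> carrier S" "p 0 s = p 0 t" "p (Suc 0) s = p (Suc 0) t" for s t
  proof -
    obtain x y where xy: "x \<in> carrier ?S0" "y \<in> carrier ?S0" "s = e x" "t = e y"
      using st(1,2) by (auto simp: carS)
    have "x = y"
    proof (rule PiE_ext[of x ?I "\<lambda>_. carrier M" y])
      fix k assume "k \<in> ?I"
      then consider "k = 0" | "k = Suc 0" by force
      then show "x k = y k" using st(3,4) xy by cases (simp_all add: p_e)
    qed (use xy in \<open>simp_all add: finite_direct_sum_def\<close>)
    then show ?thesis using xy by simp
  qed
  have sum: "i 0 (p 0 s) \<oplus>\<^bsub>S\<^esub> i (Suc 0) (p (Suc 0) s) = s" if "s \<in> carrier S" for s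
    by (rule S_eqI) (use that in \<open>auto simp: lhomD[OF i] lhomD[OF p] pi\<close>)
  have ds: "(\<Oplus>\<^bsub>S\<^esub>k\<in>?I. i k (x k)) = i 0 (x 0) \<oplus>\<^bsub>S\<^esub> i (Suc 0) (x (Suc 0))"
    if "x \<in> (\<Pi>\<^sub>E k\<in>?I. carrier M)" for x
  proof -
    have "x 0 \<in> carrier M" "x (Suc 0) \<in> carrier M" using that by (auto simp: I)
    then show ?thesis unfolding I by (subst S.finsum_insert) (auto simp: lhomD[OF i])
  qed
  have "bij_betw (\<lambda>x. \<Oplus>\<^bsub>S\<^esub>k\<in>?I. i k (x k)) (\<Pi>\<^sub>E k\<in>?I. carrier M) (carrier S)"
  proof (rule bij_betw_byWitness[where f' = "\<lambda>s. \<lambda>k\<in>?I. p k s"])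
    have c: "x 0 \<in> carrier M" "x (Suc 0) \<in> carrier M" if "x \<in> (\<Pi>\<^sub>E k\<in>?I. carrier M)" for x
      using that by (auto simp: I)
    show "\<forall>x\<in>\<Pi>\<^sub>E k\<in>?I. carrier M. (\<lambda>k\<in>?I. p k (\<Oplus>\<^bsub>S\<^esub>l\<in>?I. i l (x l))) = x"
    proof
      fix x assume x: "x \<in> (\<Pi>\<^sub>E k\<in>?I. carrier M)"
      show "(\<lambda>k\<in>?I. p k (\<Oplus>\<^bsub>S\<^esub>l\<in>?I. i l (x l))) = x"
      proof (rule extensionalityI[of _ ?I])
        fix k assume "k \<in> ?I"
        then consider "k = 0" | "k = Suc 0" by force
        then show "(\<lambda>k\<in>?I. p k (\<Oplus>\<^bsub>S\<^esub>l\<in>?I. i l (x l))) k = x k"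
          using c[OF x] by cases (simp_all add: ds[OF x] lhomD[OF i] lhomD[OF p] pi)
      qed (use x in \<open>auto simp: PiE_def\<close>)
    qed
    show "\<forall>s\<in>carrier S. (\<Oplus>\<^bsub>S\<^esub>k\<in>?I. i k ((\<lambda>k\<in>?I. p k s) k)) = s"
    proof
      fix s assume s: "s \<in> carrier S"
      have "(\<lambda>k\<in>?I. p k s) \<in> (\<Pi>\<^sub>E k\<in>?I. carrier M)" using s lhomD(3)[OF p] by auto
      from ds[OF this] show "(\<Oplus>\<^bsub>S\<^esub>k\<in>?I. i k ((\<lambda>k\<in>?I. p k s) k)) = s"
        using sum[OF s] by simp
    qed
    show "(\<lambda>x. \<Oplus>\<^bsub>S\<^esub>k\<in>?I. i k (x k)) ` (\<Pi>\<^sub>E k\<in>?I. carrier M) \<subseteq> carrier S"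
    proof
      fix s assume "s \<in> (\<lambda>x. \<Oplus>\<^bsub>S\<^esub>k\<in>?I. i k (x k)) ` (\<Pi>\<^sub>E k\<in>?I. carrier M)"
      then obtain x where x: "x \<in> (\<Pi>\<^sub>E k\<in>?I. carrier M)" "s = (\<Oplus>\<^bsub>S\<^esub>k\<in>?I. i k (x k))" by blast
      then show "s \<in> carrier S" unfolding ds[OF x(1)] x(2) using c[OF x(1)] lhomD(3)[OF i] by simp
    qed
    show "(\<lambda>s. \<lambda>k\<in>?I. p k s) ` carrier S \<subseteq> (\<Pi>\<^sub>E k\<in>?I. carrier M)"
      by (rule image_subsetI) (use lhomD(3)[OF p] in \<open>simp add: restrict_PiE_iff\<close>)
  qed
  then have "direct_sum_of A 2 (\<lambda>_. M) S i"
    using assms i S(1) by (simp add: direct_sum_of_def)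
  then show ?thesis using p pi sum by blast
qed

text \<open>A functor that preserves biproducts is additive: \<open>h\<close> is the diagonal
  followed by the map \<open>q\<close> with components \<open>f\<close> and \<open>g\<close>, and
  \<open>T\<close> turns restriction along the diagonal into addition of components.\<close>

lemma T_add:
  assumes "module A M" "module A N" "f \<in> lhom A M N" "g \<in> lhom A M N" "h \<in> lhom A M N"
    and h: "\<And>x. x \<in> carrier M \<Longrightarrow> h x = f x \<oplus>\<^bsub>N\<^esub> g x" and y: "y \<in> carrier (fob T N)"
  shows "far T M N h y = far T M N f y \<oplus>\<^bsub>fob T M\<^esub> far T M N g y"
proof -
  interpret M: module A M by fact
  interpret N: module A N by fact
  interpret TM: module A "fob T M" by (rule T_module) fact
  obtain S :: "('a, 'm) module" and i p where S: "direct_sum_of A 2 (\<lambda>_. M) S i"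
    and p: "\<And>k. k < 2 \<Longrightarrow> p k \<in> lhom A S M"
    and pi: "\<And>k l x. k < 2 \<Longrightarrow> l < 2 \<Longrightarrow> x \<in> carrier M \<Longrightarrow> p k (i l x) = (if k = l then x else \<zero>\<^bsub>M\<^esub>)"
    and sum: "\<And>s. s \<in> carrier S \<Longrightarrow> i 0 (p 0 s) \<oplus>\<^bsub>S\<^esub> i (Suc 0) (p (Suc 0) s) = s"
    using ex_biproduct[OF assms(1)] by blast
  have mS: "module A S" and i: "\<And>k. k < 2 \<Longrightarrow> i k \<in> lhom A M S"
    using S by (auto simp: direct_sum_of_def)
  interpret S: module A S by (rule mS)
  interpret TS: module A "fob T S" by (rule T_module) fact
  note p0 = p[of 0, simplified] and p1 = p[of "Suc 0", simplified]
  note i0 = i[of 0, simplified] and i1 = i[of "Suc 0", simplified]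
  have inj: "inj_on (\<lambda>y. \<lambda>k\<in>{..<2::nat}. far T M S (i k) y) (carrier (fob T S))"
    using direct_sums S unfolding commutes_with_finite_direct_sums_def bij_betw_def by blast
  \<comment> \<open>The codiagonal of \<open>T(S) = T(M) \<oplus> T(M)\<close> is \<open>T\<close> of the diagonal \<open>D\<close>.\<close>
  define D where "D = (\<lambda>x\<in>carrier M. i 0 x \<oplus>\<^bsub>S\<^esub> i (Suc 0) x)"
  have D: "D \<in> lhom A M S" unfolding D_def by (rule add_lhom[OF assms(1) mS i0 i1])
  let ?Tp = "\<lambda>k. far T S M (p k)" and ?Ti = "\<lambda>k. far T M S (i k)"
  have Tpi: "?Ti l (?Tp k z) = (if k = l then z else \<zero>\<^bsub>fob T M\<^esub>)"
    if "k < 2" "l < 2" "z \<in> carrier (fob T M)" for k l z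
  proof (cases "k = l")
    case True
    have "?Ti l (?Tp k z) = far T M M (lid M) z"
      by (rule T_compose[OF assms(1) mS assms(1) i p lid_lhom[OF assms(1)]]) (use that True pi in auto)
    then show ?thesis using True T_id[OF assms(1) that(3)] by simp
  next
    case False
    have "?Ti l (?Tp k z) = far T M M (lzero M M) z"
      by (rule T_compose[OF assms(1) mS assms(1) i p lzero_lhom[OF assms(1,1)]]) (use that False pi in auto)
    then show ?thesis using False T_lzero[OF assms(1,1) that(3)] by simp
  qed
  have TD: "far T M S D s = ?Ti 0 s \<oplus>\<^bsub>fob T M\<^esub> ?Ti (Suc 0) s" if s: "s \<in> carrier (fob T S)" for s
  proof -
    let ?a = "?Ti 0 s" and ?b = "?Ti (Suc 0) s"
    have ab: "?a \<in> carrier (fob T M)" "?b \<in> carrier (fob T M)"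
      using T_hom(3)[OF assms(1) mS] i0 i1 s by auto
    have c: "?Tp 0 ?a \<in> carrier (fob T S)" "?Tp (Suc 0) ?b \<in> carrier (fob T S)"
      using T_hom(3)[OF mS assms(1)] p0 p1 ab by auto
    \<comment> \<open>Both sides have the same components under the canonical map of
      \<open>T S\<close>, which is injective.\<close>
    have "?Tp 0 ?a \<oplus>\<^bsub>fob T S\<^esub> ?Tp (Suc 0) ?b = s"
    proof (rule inj_onD[OF inj])
      show "(\<lambda>k\<in>{..<2}. ?Ti k (?Tp 0 ?a \<oplus>\<^bsub>fob T S\<^esub> ?Tp (Suc 0) ?b)) = (\<lambda>k\<in>{..<2}. ?Ti k s)"
      proof (rule restrict_ext)
        fix k assume k: "k \<in> {..<2::nat}"
        then consider "k = 0" | "k = Suc 0" by force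
        moreover have "?Ti k (?Tp 0 ?a \<oplus>\<^bsub>fob T S\<^esub> ?Tp (Suc 0) ?b) =
            ?Ti k (?Tp 0 ?a) \<oplus>\<^bsub>fob T M\<^esub> ?Ti k (?Tp (Suc 0) ?b)"
          by (rule T_hom(4)[OF assms(1) mS i]) (use k c in auto)
        ultimately show "?Ti k (?Tp 0 ?a \<oplus>\<^bsub>fob T S\<^esub> ?Tp (Suc 0) ?b) = ?Ti k s"
          using ab by cases (simp_all add: Tpi)
      qed
    qed (use s c in auto)
    moreover have "far T M S D (?Tp 0 ?a) = ?a"
    proof -
      have "far T M S D (?Tp 0 ?a) = far T M M (lid M) ?a"
        by (rule T_compose[OF assms(1) mS assms(1) D p0 lid_lhom[OF assms(1)]])
          (use ab in \<open>auto simp: D_def lhomD[OF p0] lhomD[OF i0] lhomD[OF i1] pi\<close>)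
      then show ?thesis using T_id[OF assms(1)] ab by simp
    qed
    moreover have "far T M S D (?Tp (Suc 0) ?b) = ?b"
    proof -
      have "far T M S D (?Tp (Suc 0) ?b) = far T M M (lid M) ?b"
        by (rule T_compose[OF assms(1) mS assms(1) D p1 lid_lhom[OF assms(1)]])
          (use ab in \<open>auto simp: D_def lhomD[OF p1] lhomD[OF i0] lhomD[OF i1] pi\<close>)
      then show ?thesis using T_id[OF assms(1)] ab by simp
    qed
    ultimately show ?thesis
      using T_hom(4)[OF assms(1) mS D c] by simp
  qed
  \<comment> \<open>The map out of the biproduct that restricts to \<open>f\<close> and
    \<open>g\<close> on the two summands.\<close>
  define q where "q = (\<lambda>s\<in>carrier S. f (p 0 s) \<oplus>\<^bsub>N\<^esub> g (p (Suc 0) s))"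
  have q: "q \<in> lhom A S N"
  proof -
    have "(\<lambda>s\<in>carrier S. compose (carrier S) f (p 0) s \<oplus>\<^bsub>N\<^esub> compose (carrier S) g (p (Suc 0)) s) \<in> lhom A S N"
      by (rule add_lhom[OF mS assms(2) compose_lhom[OF mS p0 assms(3)] compose_lhom[OF mS p1 assms(4)]])
    moreover have "(\<lambda>s\<in>carrier S. compose (carrier S) f (p 0) s \<oplus>\<^bsub>N\<^esub> compose (carrier S) g (p (Suc 0)) s) = q"
      by (auto simp: q_def compose_eq)
    ultimately show ?thesis by simp
  qed
  note fz = module_hom_zero_minus(1)[OF assms(1,2) lhomD(1)[OF assms(3)]]
    module_hom_zero_minus(1)[OF assms(1,2) lhomD(1)[OF assms(4)]]
  have "far T M N h y = far T M S D (far T S N q y)"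
    by (rule T_compose[symmetric, OF assms(1) mS assms(2) D q assms(5) _ y])
      (simp add: D_def q_def h lhomD[OF p0] lhomD[OF p1] lhomD[OF i0] lhomD[OF i1] pi)
  also have "\<dots> = ?Ti 0 (far T S N q y) \<oplus>\<^bsub>fob T M\<^esub> ?Ti (Suc 0) (far T S N q y)"
    by (rule TD[OF T_hom(3)[OF mS assms(2) q y]])
  also have "?Ti 0 (far T S N q y) = far T M N f y"
    by (rule T_compose[OF assms(1) mS assms(2) i0 q assms(3) _ y])
      (simp add: q_def lhomD[OF i0] pi fz lhomD[OF assms(3)])
  also have "?Ti (Suc 0) (far T S N q y) = far T M N g y"
    by (rule T_compose[OF assms(1) mS assms(2) i1 q assms(4) _ y])
      (simp add: q_def lhomD[OF i1] pi fz lhomD[OF assms(4)])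
  finally show ?thesis .
qed

lemma T_finsum:
  assumes "module A M" "module A N" "finite I" "\<And>i. i \<in> I \<Longrightarrow> f i \<in> lhom A M N" "y \<in> carrier (fob T N)"
  shows "far T M N (\<lambda>x\<in>carrier M. \<Oplus>\<^bsub>N\<^esub>i\<in>I. f i x) y = (\<Oplus>\<^bsub>fob T M\<^esub>i\<in>I. far T M N (f i) y)"
  using assms(3,4)
proof (induction I)
  case empty
  interpret N: module A N by fact
  interpret TM: module A "fob T M" by (rule T_module) fact
  show ?case unfolding N.finsum_empty TM.finsum_empty by (rule T_lzero) fact+
next
  case (insert j I)
  interpret N: module A N by fact
  interpret TM: module A "fob T M" by (rule T_module) fact
  let ?s = "\<lambda>I. \<lambda>x\<in>carrier M. \<Oplus>\<^bsub>N\<^esub>i\<in>I. f i x"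
  have f: "f j \<in> lhom A M N" "\<And>i. i \<in> I \<Longrightarrow> f i \<in> lhom A M N"
    using insert(4) by (blast intro: insertI1 insertI2)+
  note s = finsum_lhom[OF assms(1,2) insert(1) f(2)]
  have IH: "far T M N (?s I) y = (\<Oplus>\<^bsub>fob T M\<^esub>i\<in>I. far T M N (f i) y)"
    by (rule insert.IH) (rule f(2))
  have "far T M N (?s (insert j I)) y = far T M N (f j) y \<oplus>\<^bsub>fob T M\<^esub> far T M N (?s I) y"
  proof (rule T_add[OF assms(1,2) f(1) s _ _ assms(5)])
    show "?s (insert j I) \<in> lhom A M N"
      by (rule finsum_lhom) (use assms insert in auto)
    fix x assume x: "x \<in> carrier M"
    have "f j x \<in> carrier N" "(\<lambda>i. f i x) \<in> I \<rightarrow> carrier N"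
      using x lhomD(3)[OF f(1)] lhomD(3)[OF f(2)] by auto
    then show "?s (insert j I) x = f j x \<oplus>\<^bsub>N\<^esub> ?s I x" using x insert(1,2) by simp
  qed
  also have "\<dots> = (\<Oplus>\<^bsub>fob T M\<^esub>i\<in>insert j I. far T M N (f i) y)"
    unfolding IH
    using insert(1,2) T_hom(3)[OF assms(1,2) f(1) assms(5)] T_hom(3)[OF assms(1,2) f(2) assms(5)]
    by (subst TM.finsum_insert) auto
  finally show ?case .
qed

end

section \<open>Comparison of resolutions\<close>

text \<open>Chain maps over \<open>f\<close> from the resolution \<open>F, d, \<epsilon>\<close> to
  the resolution \<open>G, e, \<eta>\<close>, written elementwise.\<close>

definition lifts where
  "lifts A F d \<epsilon> G e \<eta> f \<phi> \<longleftrightarrow> (\<forall>n. \<phi> n \<in> lhom A (F n) (G n)) \<and>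
    (\<forall>x\<in>carrier (F 0). \<eta> (\<phi> 0 x) = f (\<epsilon> x)) \<and>
    (\<forall>n. \<forall>x\<in>carrier (F (Suc n)). e n (\<phi> (Suc n) x) = \<phi> n (d n x))"

lemma liftsD:
  assumes "lifts A F d \<epsilon> G e \<eta> f \<phi>"
  shows "\<phi> n \<in> lhom A (F n) (G n)" "x \<in> carrier (F 0) \<Longrightarrow> \<eta> (\<phi> 0 x) = f (\<epsilon> x)"
    "x \<in> carrier (F (Suc n)) \<Longrightarrow> e n (\<phi> (Suc n) x) = \<phi> n (d n x)"
  using assms by (auto simp: lifts_def)

lemma resolutionD:
  assumes "projective_resolution A M (F, d, \<epsilon>)"
  shows "projective_module A (F n)" "module A (F n)" "d n \<in> lhom A (F (Suc n)) (F n)"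
    "\<epsilon> \<in> lhom A (F 0) M" "\<epsilon> ` carrier (F 0) = carrier M"
    "x \<in> carrier (F (Suc 0)) \<Longrightarrow> \<epsilon> (d 0 x) = \<zero>\<^bsub>M\<^esub>"
    "x \<in> carrier (F (Suc (Suc n))) \<Longrightarrow> d n (d (Suc n) x) = \<zero>\<^bsub>F n\<^esub>"
    "x \<in> carrier (F 0) \<Longrightarrow> \<epsilon> x = \<zero>\<^bsub>M\<^esub> \<Longrightarrow> x \<in> d 0 ` carrier (F (Suc 0))"
    "x \<in> carrier (F (Suc n)) \<Longrightarrow> d n x = \<zero>\<^bsub>F n\<^esub> \<Longrightarrow> x \<in> d (Suc n) ` carrier (F (Suc (Suc n)))"
proof -
  show "d n (d (Suc n) x) = \<zero>\<^bsub>F n\<^esub>" if "x \<in> carrier (F (Suc (Suc n)))"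
  proof -
    have "d (Suc n) x \<in> lker (F (Suc n)) (F n) (d n)"
      using assms that unfolding projective_resolution_def by blast
    then show ?thesis by (simp add: lker_def)
  qed
qed (use assms in \<open>auto simp: projective_resolution_def projective_module_def lker_def\<close>)

text \<open>The comparison theorem: projectivity of the source is played against exactness of the
  target, one degree at a time.\<close>

lemma ex_lifts:
  fixes M N :: "('a, 'm) module"
  assumes F: "projective_resolution A M (F, d, \<epsilon>)" and G: "projective_resolution A N (G, e, \<eta>)"
    and MN: "module A M" "module A N" and f: "f \<in> lhom A M N"
  shows "\<exists>\<phi>. lifts A F d \<epsilon> G e \<eta> f \<phi>"
proof -
  note F' = resolutionD[OF F] and G' = resolutionD[OF G]
  note dc = lhomD(3)[OF F'(3)] and ec = lhomD(3)[OF G'(3)]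
  \<comment> \<open>The invariant keeps what the next lift requires, namely that the map after
    \<open>d n\<close> has values in the image of \<open>e n\<close>.\<close>
  let ?P = "\<lambda>n \<phi>. \<phi> \<in> lhom A (F n) (G n) \<and> (\<forall>x\<in>carrier (F (Suc n)). \<phi> (d n x) \<in> e n ` carrier (G (Suc n)))
    \<and> (n = 0 \<longrightarrow> (\<forall>x\<in>carrier (F 0). \<eta> (\<phi> x) = f (\<epsilon> x)))"
  let ?Q = "\<lambda>n \<phi> \<phi>'. \<forall>x\<in>carrier (F (Suc n)). e n (\<phi>' x) = \<phi> (d n x)"
  have base: "\<exists>\<phi>. ?P 0 \<phi>"
  proof -
    have fe: "compose (carrier (F 0)) f \<epsilon> \<in> lhom A (F 0) N" by (rule compose_lhom[OF F'(2,4) f])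
    obtain \<phi> where \<phi>: "\<phi> \<in> lhom A (F 0) (G 0)" "\<And>x. x \<in> carrier (F 0) \<Longrightarrow> \<eta> (\<phi> x) = f (\<epsilon> x)"
    proof -
      have "compose (carrier (F 0)) f \<epsilon> x \<in> \<eta> ` carrier (G 0)" if "x \<in> carrier (F 0)" for x
        using lhomD(3)[OF fe that] by (simp add: G'(5))
      from projective_lift[OF F'(1) G'(2) MN(2) G'(4) fe this] show ?thesis
        using that by (auto simp: compose_eq)
    qed
    have "\<phi> (d 0 x) \<in> e 0 ` carrier (G (Suc 0))" if "x \<in> carrier (F (Suc 0))" for x
    proof (rule G'(8))
      show "\<phi> (d 0 x) \<in> carrier (G 0)" using lhomD(3)[OF \<phi>(1)] dc that by simp
      have "\<eta> (\<phi> (d 0 x)) = f \<zero>\<^bsub>M\<^esub>" using \<phi>(2) dc that F'(6) by simp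
      then show "\<eta> (\<phi> (d 0 x)) = \<zero>\<^bsub>N\<^esub>" using module_hom_zero_minus(1)[OF MN lhomD(1)[OF f]] by simp
    qed
    then show ?thesis using \<phi> by blast
  qed
  have step: "\<exists>\<phi>'. ?P (Suc n) \<phi>' \<and> ?Q n \<phi> \<phi>'" if P: "?P n \<phi>" for n \<phi>
  proof -
    have \<phi>: "\<phi> \<in> lhom A (F n) (G n)" using P by blast
    have c: "compose (carrier (F (Suc n))) \<phi> (d n) \<in> lhom A (F (Suc n)) (G n)"
      by (rule compose_lhom[OF F'(2,3) \<phi>])
    obtain \<phi>' where \<phi>': "\<phi>' \<in> lhom A (F (Suc n)) (G (Suc n))"
      "\<And>x. x \<in> carrier (F (Suc n)) \<Longrightarrow> e n (\<phi>' x) = \<phi> (d n x)"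
    proof -
      have "compose (carrier (F (Suc n))) \<phi> (d n) x \<in> e n ` carrier (G (Suc n))" if "x \<in> carrier (F (Suc n))" for x
        using P that by (simp add: compose_eq)
      from projective_lift[OF F'(1) G'(2) G'(2) G'(3) c this] show ?thesis
        using that by (auto simp: compose_eq)
    qed
    have "\<phi>' (d (Suc n) x) \<in> e (Suc n) ` carrier (G (Suc (Suc n)))" if x: "x \<in> carrier (F (Suc (Suc n)))" for x
    proof (rule G'(9))
      show "\<phi>' (d (Suc n) x) \<in> carrier (G (Suc n))" using lhomD(3)[OF \<phi>'(1)] dc x by simp
      have "e n (\<phi>' (d (Suc n) x)) = \<phi> \<zero>\<^bsub>F n\<^esub>" using \<phi>'(2) dc x F'(7) by simp
      then show "e n (\<phi>' (d (Suc n) x)) = \<zero>\<^bsub>G n\<^esub>"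
        using module_hom_zero_minus(1)[OF F'(2) G'(2) lhomD(1)[OF \<phi>]] by simp
    qed
    then show ?thesis using \<phi>' by blast
  qed
  have "\<exists>\<phi>. \<forall>n. ?P n (\<phi> n) \<and> ?Q n (\<phi> n) (\<phi> (Suc n))"
    by (rule dependent_nat_choice[of ?P ?Q, OF base step])
  then obtain \<phi> where \<phi>: "\<forall>n. ?P n (\<phi> n) \<and> ?Q n (\<phi> n) (\<phi> (Suc n))" by (rule exE)
  show ?thesis
    unfolding lifts_def by (rule exI[of _ \<phi>], intro conjI allI) (use \<phi> in simp_all)
qed

text \<open>The uniqueness half of the comparison theorem, for lifts of zero: such a chain map is
  null-homotopic.\<close>

lemma lifts_zero_homotopy:
  fixes M N :: "('a, 'm) module"
  assumes F: "projective_resolution A M (F, d, \<epsilon>)" and G: "projective_resolution A N (G, e, \<eta>)"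
    and MN: "module A M" "module A N"
    and l: "lifts A F d \<epsilon> G e \<eta> (lzero M N) \<phi>"
  shows "\<exists>s. (\<forall>n. s n \<in> lhom A (F n) (G (Suc n))) \<and> (\<forall>x\<in>carrier (F 0). e 0 (s 0 x) = \<phi> 0 x) \<and>
    (\<forall>n. \<forall>x\<in>carrier (F (Suc n)). \<phi> (Suc n) x = e (Suc n) (s (Suc n) x) \<oplus>\<^bsub>G (Suc n)\<^esub> s n (d n x))"
proof -
  note F' = resolutionD[OF F] and G' = resolutionD[OF G] and \<phi> = liftsD[OF l]
  note dc = lhomD(3)[OF F'(3)] and ec = lhomD(3)[OF G'(3)] and \<phi>c = lhomD(3)[OF \<phi>(1)]
  \<comment> \<open>The middle condition says that \<open>\<phi> (Suc n)\<close> minus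
    \<open>s\<close> after \<open>d n\<close> is killed by \<open>e n\<close>; exactness of the
    target then allows the next lift.\<close>
  let ?P = "\<lambda>n s. s \<in> lhom A (F n) (G (Suc n)) \<and>
    (\<forall>x\<in>carrier (F (Suc n)). e n (s (d n x)) = e n (\<phi> (Suc n) x)) \<and>
    (n = 0 \<longrightarrow> (\<forall>x\<in>carrier (F 0). e 0 (s x) = \<phi> 0 x))"
  let ?Q = "\<lambda>n s s'. \<forall>x\<in>carrier (F (Suc n)). \<phi> (Suc n) x = e (Suc n) (s' x) \<oplus>\<^bsub>G (Suc n)\<^esub> s (d n x)"
  have base: "\<exists>s. ?P 0 s"
  proof -
    have "\<phi> 0 x \<in> e 0 ` carrier (G (Suc 0))" if "x \<in> carrier (F 0)" for x
      by (rule G'(8)) (use that \<phi>c[of x 0] \<phi>(2)[OF that] lhomD(3)[OF F'(4)] in auto)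
    from projective_lift[OF F'(1) G'(2) G'(2) G'(3) \<phi>(1) this]
    obtain s where s: "s \<in> lhom A (F 0) (G (Suc 0))" "\<And>x. x \<in> carrier (F 0) \<Longrightarrow> e 0 (s x) = \<phi> 0 x"
      by blast
    then have "e 0 (s (d 0 x)) = e 0 (\<phi> (Suc 0) x)" if "x \<in> carrier (F (Suc 0))" for x
      using that dc \<phi>(3) by simp
    then show ?thesis using s by blast
  qed
  have step: "\<exists>s'. ?P (Suc n) s' \<and> ?Q n s s'" if P: "?P n s" for n s
  proof -
    interpret G1: module A "G (Suc n)" by (rule G'(2))
    interpret G2: module A "G (Suc (Suc n))" by (rule G'(2))
    have s: "s \<in> lhom A (F n) (G (Suc n))" using P by blast
    \<comment> \<open>This is the difference of \<open>\<phi> (Suc n)\<close> and \<open>s\<close>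
      after \<open>d n\<close>, in the nested form that \<open>add_lhom\<close> and
      \<open>minus_lhom\<close> recognize.\<close>
    define h where "h = (\<lambda>x\<in>carrier (F (Suc n)). \<phi> (Suc n) x \<oplus>\<^bsub>G (Suc n)\<^esub>
      (\<lambda>x\<in>carrier (F (Suc n)). \<ominus>\<^bsub>G (Suc n)\<^esub> compose (carrier (F (Suc n))) s (d n) x) x)"
    have h: "h \<in> lhom A (F (Suc n)) (G (Suc n))"
      unfolding h_def
      by (intro add_lhom minus_lhom compose_lhom[OF F'(2,3) s] F'(2) G'(2) \<phi>(1))
    have h_eq: "h x = \<phi> (Suc n) x \<ominus>\<^bsub>G (Suc n)\<^esub> s (d n x)" if "x \<in> carrier (F (Suc n))" for x
      using that by (simp add: h_def compose_eq a_minus_def)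
    have sd: "s (d n x) \<in> carrier (G (Suc n))" if "x \<in> carrier (F (Suc n))" for x
      using lhomD(3)[OF s] dc that by simp
    have "h x \<in> e (Suc n) ` carrier (G (Suc (Suc n)))" if x: "x \<in> carrier (F (Suc n))" for x
    proof (rule G'(9))
      show "h x \<in> carrier (G (Suc n))" using lhomD(3)[OF h x] .
      have "e n (h x) = e n (\<phi> (Suc n) x) \<ominus>\<^bsub>G n\<^esub> e n (s (d n x))"
        unfolding h_eq[OF x]
        by (rule module_hom_zero_minus(3)[OF G'(2) G'(2) lhomD(1)[OF G'(3)] \<phi>c[OF x] sd[OF x]])
      also have "\<dots> = \<zero>\<^bsub>G n\<^esub>"
        using P x ec[OF \<phi>c[OF x]] by (simp add: module_minus_eq_zero_iff[OF G'(2)])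
      finally show "e n (h x) = \<zero>\<^bsub>G n\<^esub>" .
    qed
    from projective_lift[OF F'(1) G'(2) G'(2) G'(3) h this]
    obtain s' where s': "s' \<in> lhom A (F (Suc n)) (G (Suc (Suc n)))"
      "\<And>x. x \<in> carrier (F (Suc n)) \<Longrightarrow> e (Suc n) (s' x) = h x" by blast
    have "?Q n s s'"
    proof
      fix x assume x: "x \<in> carrier (F (Suc n))"
      show "\<phi> (Suc n) x = e (Suc n) (s' x) \<oplus>\<^bsub>G (Suc n)\<^esub> s (d n x)"
        using s'(2)[OF x] h_eq[OF x] \<phi>c[OF x] sd[OF x] by (simp add: a_minus_def G1.a_assoc G1.l_neg)
    qed
    moreover have "e (Suc n) (s' (d (Suc n) x)) = e (Suc n) (\<phi> (Suc (Suc n)) x)"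
      if x: "x \<in> carrier (F (Suc (Suc n)))" for x
    proof -
      have "s (d n (d (Suc n) x)) = \<zero>\<^bsub>G (Suc n)\<^esub>"
        using F'(7)[OF x] module_hom_zero_minus(1)[OF F'(2) G'(2) lhomD(1)[OF s]] by simp
      moreover have "\<phi> (Suc n) (d (Suc n) x) = e (Suc n) (s' (d (Suc n) x)) \<oplus>\<^bsub>G (Suc n)\<^esub> s (d n (d (Suc n) x))"
        using \<open>?Q n s s'\<close> dc[OF x] by blast
      moreover have "e (Suc n) (s' (d (Suc n) x)) \<in> carrier (G (Suc n))"
        using ec lhomD(3)[OF s'(1)] dc x by simp
      ultimately show ?thesis using \<phi>(3)[OF x] by simp
    qed
    ultimately show ?thesis using s'(1) by blast
  qed
  have "\<exists>s. \<forall>n. ?P n (s n) \<and> ?Q n (s n) (s (Suc n))"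
    by (rule dependent_nat_choice[of ?P ?Q, OF base step])
  then obtain s where s: "\<forall>n. ?P n (s n) \<and> ?Q n (s n) (s (Suc n))" by (rule exE)
  show ?thesis
    by (rule exI[of _ s], intro conjI allI) (use s in simp_all)
qed

lemma lifts_id: "projective_resolution A M (F, d, \<epsilon>) \<Longrightarrow> lifts A F d \<epsilon> F d \<epsilon> (lid M) (\<lambda>n. lid (F n))"
  using resolutionD[of A M F d \<epsilon>] lid_lhom lhomD(3) unfolding lifts_def by fastforce

lemma lifts_zero:
  fixes M N :: "('a, 'm) module"
  assumes "projective_resolution A M (F, d, \<epsilon>)" "projective_resolution A N (G, e, \<eta>)" "module A N"
  shows "lifts A F d \<epsilon> G e \<eta> (lzero M N) (\<lambda>n. lzero (F n) (G n))"
proof -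
  note F' = resolutionD[OF assms(1)] and G' = resolutionD[OF assms(2)]
  show ?thesis
    unfolding lifts_def
    using lzero_lhom[OF F'(2) G'(2)] lhomD(3)[OF F'(3)] lhomD(3)[OF F'(4)]
      module_hom_zero_minus(1)[OF G'(2) assms(3) lhomD(1)[OF G'(4)]]
      module_hom_zero_minus(1)[OF G'(2) G'(2) lhomD(1)[OF G'(3)]]
    by simp
qed

lemma lifts_compose:
  fixes L M N :: "('a, 'm) module"
  assumes F: "projective_resolution A L (F, d, \<epsilon>)" and G: "projective_resolution A M (G, e, \<eta>)"
    and H: "projective_resolution A N (H, c, \<theta>)"
    and "lifts A F d \<epsilon> G e \<eta> f \<phi>" "lifts A G e \<eta> H c \<theta> g \<psi>"
    and "\<And>x. x \<in> carrier L \<Longrightarrow> h x = g (f x)"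
  shows "lifts A F d \<epsilon> H c \<theta> h (\<lambda>n. compose (carrier (F n)) (\<psi> n) (\<phi> n))"
proof -
  note F' = resolutionD[OF F] and l = liftsD[OF assms(4)] liftsD[OF assms(5)]
  show ?thesis
    unfolding lifts_def
    using compose_lhom[OF F'(2) l(1,4)] l(2,3,5,6) lhomD(3)[OF l(1)] lhomD(3)[OF F'(3)] lhomD(3)[OF F'(4)] assms(6)
    by (simp add: compose_eq)
qed

text \<open>Two lifts of the same map differ by a lift of zero, to which the homotopy lemma applies.
  The nested restrictions are the form produced by \<open>add_lhom\<close> and
  \<open>minus_lhom\<close>.\<close>

lemma lifts_diff:
  fixes M N :: "('a, 'm) module"
  assumes F: "projective_resolution A M (F, d, \<epsilon>)" and G: "projective_resolution A N (G, e, \<eta>)"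
    and N: "module A N" and f: "f \<in> lhom A M N"
    and "lifts A F d \<epsilon> G e \<eta> f \<phi>" "lifts A F d \<epsilon> G e \<eta> f \<psi>"
  shows "lifts A F d \<epsilon> G e \<eta> (lzero M N) (\<lambda>n. \<lambda>x\<in>carrier (F n). \<phi> n x \<oplus>\<^bsub>G n\<^esub> (\<lambda>x\<in>carrier (F n). \<ominus>\<^bsub>G n\<^esub> \<psi> n x) x)"
    (is "lifts _ _ _ _ _ _ _ _ ?\<chi>")
proof -
  note F' = resolutionD[OF F] and G' = resolutionD[OF G] and l = liftsD[OF assms(5)] liftsD[OF assms(6)]
  note c = lhomD(3)[OF l(1)] lhomD(3)[OF l(4)] lhomD(3)[OF F'(3)] lhomD(3)[OF F'(4)] lhomD(3)[OF f]
  have eq: "?\<chi> n x = \<phi> n x \<ominus>\<^bsub>G n\<^esub> \<psi> n x" if "x \<in> carrier (F n)" for n x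
    using that by (simp add: a_minus_def)
  show ?thesis
    unfolding lifts_def
  proof (intro conjI allI ballI)
    show "?\<chi> n \<in> lhom A (F n) (G n)" for n
      by (intro add_lhom minus_lhom F' G' l)
    show "\<eta> (?\<chi> 0 x) = lzero M N (\<epsilon> x)" if x: "x \<in> carrier (F 0)" for x
      unfolding eq[OF x] module_hom_zero_minus(3)[OF G'(2) N lhomD(1)[OF G'(4)] c(1)[OF x] c(2)[OF x]]
      using x c by (simp add: l module_minus_eq_zero_iff[OF N])
    show "e n (?\<chi> (Suc n) x) = ?\<chi> n (d n x)" if x: "x \<in> carrier (F (Suc n))" for n x
      unfolding eq[OF x] eq[OF c(3)[OF x]]
        module_hom_zero_minus(3)[OF G'(2) G'(2) lhomD(1)[OF G'(3)] c(1)[OF x] c(2)[OF x]]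
      using x by (simp add: l)
  qed
qed

lemma lifts_sum:
  fixes M N :: "('a, 'm) module"
  assumes F: "projective_resolution A M (F, d, \<epsilon>)" and G: "projective_resolution A N (G, e, \<eta>)"
    and N: "module A N" and I: "finite I" and f: "\<And>i. i \<in> I \<Longrightarrow> f i \<in> lhom A M N"
    and l: "\<And>i. i \<in> I \<Longrightarrow> lifts A F d \<epsilon> G e \<eta> (f i) (\<phi> i)"
    and h: "\<And>n. (\<lambda>x\<in>carrier (F n). \<Oplus>\<^bsub>G n\<^esub>i\<in>I. \<phi> i n x) \<in> lhom A (F n) (G n)"
      "\<And>x. x \<in> carrier M \<Longrightarrow> g x = (\<Oplus>\<^bsub>N\<^esub>i\<in>I. f i x)"
  shows "lifts A F d \<epsilon> G e \<eta> g (\<lambda>n. \<lambda>x\<in>carrier (F n). \<Oplus>\<^bsub>G n\<^esub>i\<in>I. \<phi> i n x)"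
proof -
  note F' = resolutionD[OF F] and G' = resolutionD[OF G] and l = liftsD[OF l]
  note c = lhomD(3)[OF l(1)] lhomD(3)[OF F'(3)] lhomD(3)[OF F'(4)]
  interpret N: module A N by (rule N)
  show ?thesis
    unfolding lifts_def
  proof (intro conjI allI ballI h(1))
    fix x assume x: "x \<in> carrier (F 0)"
    have "\<eta> (\<Oplus>\<^bsub>G 0\<^esub>i\<in>I. \<phi> i 0 x) = (\<Oplus>\<^bsub>N\<^esub>i\<in>I. \<eta> (\<phi> i 0 x))"
      by (rule finsum_hom[OF G'(2) N lhomD(1)[OF G'(4)] I]) (use c x in auto)
    also have "\<dots> = (\<Oplus>\<^bsub>N\<^esub>i\<in>I. f i (\<epsilon> x))"
      by (rule N.finsum_cong') (use x l c lhomD(3)[OF f] in auto)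
    finally show "\<eta> ((\<lambda>x\<in>carrier (F 0). \<Oplus>\<^bsub>G 0\<^esub>i\<in>I. \<phi> i 0 x) x) = g (\<epsilon> x)"
      using x c h(2) by simp
  next
    fix n x assume x: "x \<in> carrier (F (Suc n))"
    interpret G: module A "G n" by (rule G')
    have "e n (\<Oplus>\<^bsub>G (Suc n)\<^esub>i\<in>I. \<phi> i (Suc n) x) = (\<Oplus>\<^bsub>G n\<^esub>i\<in>I. e n (\<phi> i (Suc n) x))"
      by (rule finsum_hom[OF G'(2) G'(2) lhomD(1)[OF G'(3)] I]) (use c x in auto)
    also have "\<dots> = (\<Oplus>\<^bsub>G n\<^esub>i\<in>I. \<phi> i n (d n x))"
      by (rule G.finsum_cong') (use x l c in auto)
    finally show "e n ((\<lambda>x\<in>carrier (F (Suc n)). \<Oplus>\<^bsub>G (Suc n)\<^esub>i\<in>I. \<phi> i (Suc n) x) x) =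
        (\<lambda>x\<in>carrier (F n). \<Oplus>\<^bsub>G n\<^esub>i\<in>I. \<phi> i n x) (d n x)"
      using x c by simp
  qed
qed

text \<open>In contrast to \<open>liso\<close> the map need not be extensional, so composites and
  inverses require no restriction; extensionality is restored once, at the end.\<close>

definition isom :: "'a ring \<Rightarrow> ('a, 'm) module \<Rightarrow> ('a, 'n) module \<Rightarrow> bool" where
  "isom A M N \<longleftrightarrow> (\<exists>f \<in> module_hom A M N. bij_betw f (carrier M) (carrier N))"

text \<open>\<open>right_derived\<close> acts on objects only; the maps between derived functors
  come from here and are known by their values on classes of cocycles.\<close>

lemma subquot_map:
  assumes "submodule A B M" "submodule A Z M" "submodule A B' N" "submodule A Z' N"
    and "g \<in> module_hom A M N" "g ` Z \<subseteq> Z'" "g ` B \<subseteq> B'"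
  shows "\<exists>h \<in> module_hom A (subquot M Z B) (subquot N Z' B'). \<forall>z\<in>Z. h (B +>\<^bsub>M\<^esub> z) = B' +>\<^bsub>N\<^esub> g z"
proof -
  interpret Z: submodule A Z M by fact
  interpret Z': submodule A Z' N by fact
  note ZM = subsetD[OF Z.subset] and ZN = subsetD[OF Z'.subset]
  note g = module_homD[OF assms(5)]
  define h where "h X = B' +>\<^bsub>N\<^esub> g (inv_into Z (\<lambda>z. B +>\<^bsub>M\<^esub> z) X)" for X
  have h: "h (B +>\<^bsub>M\<^esub> z) = B' +>\<^bsub>N\<^esub> g z" if z: "z \<in> Z" for z
  proof -
    let ?w = "inv_into Z (\<lambda>z. B +>\<^bsub>M\<^esub> z) (B +>\<^bsub>M\<^esub> z)"
    have im: "B +>\<^bsub>M\<^esub> z \<in> (\<lambda>z. B +>\<^bsub>M\<^esub> z) ` Z" using z by blast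
    have w: "?w \<in> Z" "B +>\<^bsub>M\<^esub> ?w = B +>\<^bsub>M\<^esub> z" using inv_into_into[OF im] f_inv_into_f[OF im] by auto
    have "?w \<ominus>\<^bsub>M\<^esub> z \<in> B" using w z coset_eq_iff[OF assms(1)] ZM by simp
    then have "g (?w \<ominus>\<^bsub>M\<^esub> z) \<in> B'" using assms(7) by auto
    then have "g ?w \<ominus>\<^bsub>N\<^esub> g z \<in> B'"
      using w z ZM by (simp add: module_hom_zero_minus(3)[OF Z.module Z'.module assms(5)])
    then show ?thesis using w z ZM g(1) by (simp add: h_def coset_eq_iff[OF assms(3)])
  qed
  have "h \<in> module_hom A (subquot M Z B) (subquot N Z' B')"
  proof (rule module_homI, goal_cases)
    case (1 x)
    then show ?case using assms(6) by (auto simp: h)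
  next
    case (2 x y)
    then obtain u v where "u \<in> Z" "v \<in> Z" "x = B +>\<^bsub>M\<^esub> u" "y = B +>\<^bsub>M\<^esub> v" by auto
    then show ?case using ZM g by (simp add: subquot_ops[OF assms(1)] subquot_ops[OF assms(3)] h)
  next
    case (3 a x)
    then obtain u where "u \<in> Z" "x = B +>\<^bsub>M\<^esub> u" by auto
    then show ?case using 3 ZM g by (simp add: subquot_ops[OF assms(1)] subquot_ops[OF assms(3)] h)
  qed
  then show ?thesis using h by blast
qed

section \<open>Chain maps and homotopies after application of the functor\<close>

context module_functor
begin

definition cocycles :: "(nat \<Rightarrow> ('a, 'm) module) \<Rightarrow> (nat \<Rightarrow> 'm \<Rightarrow> 'm) \<Rightarrow> nat \<Rightarrow> 'n set" where
  "cocycles F d j = lker (fob T (F j)) (fob T (F (Suc j))) (far T (F (Suc j)) (F j) (d j))"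

definition coboundaries :: "(nat \<Rightarrow> ('a, 'm) module) \<Rightarrow> (nat \<Rightarrow> 'm \<Rightarrow> 'm) \<Rightarrow> nat \<Rightarrow> 'n set" where
  "coboundaries F d j = (case j of 0 \<Rightarrow> {\<zero>\<^bsub>fob T (F 0)\<^esub>}
    | Suc i \<Rightarrow> far T (F (Suc i)) (F i) (d i) ` carrier (fob T (F i)))"

lemma cocycles_submodule:
  assumes "projective_resolution A M (F, d, \<epsilon>)"
  shows "submodule A (cocycles F d j) (fob T (F j))"
  using resolutionD[OF assms] unfolding cocycles_def
  by (intro lker_submodule T_module T_hom(1)) auto

lemma coboundaries_submodule:
  assumes "projective_resolution A M (F, d, \<epsilon>)"
  shows "submodule A (coboundaries F d j) (fob T (F j))"
  using resolutionD[OF assms] unfolding coboundaries_def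
  by (cases j) (auto intro!: image_submodule zero_submodule T_module T_hom(1))

text \<open>\<open>T\<close> reverses the commuting squares of the chain map, so the induced maps go
  from the complex of \<open>G\<close> to that of \<open>F\<close>.\<close>

lemma lifts_cocycles:
  assumes F: "projective_resolution A M (F, d, \<epsilon>)" and G: "projective_resolution A N (G, e, \<eta>)"
    and l: "lifts A F d \<epsilon> G e \<eta> f \<phi>"
  shows "far T (F j) (G j) (\<phi> j) ` cocycles G e j \<subseteq> cocycles F d j"
    and "far T (F j) (G j) (\<phi> j) ` coboundaries G e j \<subseteq> coboundaries F d j"
proof -
  note F' = resolutionD[OF F] and G' = resolutionD[OF G] and \<phi> = liftsD[OF l]
  have comm: "far T (F (Suc i)) (F i) (d i) (far T (F i) (G i) (\<phi> i) y) =
      far T (F (Suc i)) (G (Suc i)) (\<phi> (Suc i)) (far T (G (Suc i)) (G i) (e i) y)"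
    if y: "y \<in> carrier (fob T (G i))" for y i
  proof -
    note c = compose_lhom[OF F'(2) F'(3) \<phi>(1), of i]
    have "far T (F (Suc i)) (F i) (d i) (far T (F i) (G i) (\<phi> i) y) =
        far T (F (Suc i)) (G i) (compose (carrier (F (Suc i))) (\<phi> i) (d i)) y"
      by (rule T_compose[OF F'(2,2) G'(2) F'(3) \<phi>(1) c]) (use y in \<open>simp_all add: compose_eq\<close>)
    also have "\<dots> = far T (F (Suc i)) (G (Suc i)) (\<phi> (Suc i)) (far T (G (Suc i)) (G i) (e i) y)"
      by (rule T_compose[symmetric, OF F'(2) G'(2,2) \<phi>(1) G'(3) c]) (use y in \<open>simp_all add: compose_eq \<phi>\<close>)
    finally show ?thesis .
  qed
  note z = module_hom_zero_minus(1)[OF T_module[OF G'(2)] T_module[OF F'(2)] T_hom(1)[OF F'(2) G'(2) \<phi>(1)]]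
  show "far T (F j) (G j) (\<phi> j) ` cocycles G e j \<subseteq> cocycles F d j"
    using T_hom(3)[OF F'(2) G'(2) \<phi>(1)] by (auto simp: cocycles_def lker_def comm z)
  show "far T (F j) (G j) (\<phi> j) ` coboundaries G e j \<subseteq> coboundaries F d j"
    using T_hom(3)[OF F'(2) G'(2) \<phi>(1)] comm[symmetric]
    by (cases j) (auto simp: coboundaries_def z)
qed

text \<open>\<open>T\<close> is applied to the homotopy. The term through \<open>e\<close> kills a
  cocycle \<open>y\<close>, because \<open>T\<close> of \<open>e j\<close> does; the term through
  \<open>d\<close> is a coboundary. In degree zero only the first term exists.\<close>

lemma lifts_zero_coboundaries:
  assumes F: "projective_resolution A M (F, d, \<epsilon>)" and G: "projective_resolution A N (G, e, \<eta>)"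
    and MN: "module A M" "module A N"
    and l: "lifts A F d \<epsilon> G e \<eta> (lzero M N) \<phi>" and y: "y \<in> cocycles G e j"
  shows "far T (F j) (G j) (\<phi> j) y \<in> coboundaries F d j"
proof -
  note F' = resolutionD[OF F] and G' = resolutionD[OF G] and \<phi> = liftsD[OF l]
  obtain s where s: "\<And>n. s n \<in> lhom A (F n) (G (Suc n))" "\<And>x. x \<in> carrier (F 0) \<Longrightarrow> e 0 (s 0 x) = \<phi> 0 x"
    "\<And>n x. x \<in> carrier (F (Suc n)) \<Longrightarrow> \<phi> (Suc n) x = e (Suc n) (s (Suc n) x) \<oplus>\<^bsub>G (Suc n)\<^esub> s n (d n x)"
    using lifts_zero_homotopy[OF F G MN l] by blast
  note es = compose_lhom[OF F'(2) s(1) G'(3)] and sd = compose_lhom[OF F'(2) F'(3) s(1)]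
  have y': "y \<in> carrier (fob T (G j))" "far T (G (Suc j)) (G j) (e j) y = \<zero>\<^bsub>fob T (G (Suc j))\<^esub>"
    using y by (auto simp: cocycles_def lker_def)
  have Tes: "far T (F j) (G j) (compose (carrier (F j)) (e j) (s j)) y = \<zero>\<^bsub>fob T (F j)\<^esub>"
  proof -
    have "far T (F j) (G j) (compose (carrier (F j)) (e j) (s j)) y =
      far T (F j) (G (Suc j)) (s j) (far T (G (Suc j)) (G j) (e j) y)"
      by (rule T_compose[symmetric, OF F'(2) G'(2,2) s(1) G'(3) es]) (use y' in \<open>simp_all add: compose_eq\<close>)
    then show ?thesis
      using y'(2) module_hom_zero_minus(1)[OF T_module[OF G'(2)] T_module[OF F'(2)] T_hom(1)[OF F'(2) G'(2) s(1)]]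
      by simp
  qed
  show ?thesis
  proof (cases j)
    case 0
    have "compose (carrier (F 0)) (e 0) (s 0) = \<phi> 0"
      by (rule compose_lhom_eqI[OF F'(2) s(1) G'(3) \<phi>(1) s(2)])
    then show ?thesis using Tes by (simp add: 0 coboundaries_def)
  next
    case (Suc n)
    interpret TF: module A "fob T (F (Suc n))" by (rule T_module[OF F'(2)])
    have sn: "far T (F n) (G (Suc n)) (s n) y \<in> carrier (fob T (F n))"
      using T_hom(3)[OF F'(2) G'(2) s(1)] y'(1) Suc by simp
    have "far T (F (Suc n)) (G (Suc n)) (\<phi> (Suc n)) y =
        far T (F (Suc n)) (G (Suc n)) (compose (carrier (F (Suc n))) (e (Suc n)) (s (Suc n))) y
        \<oplus>\<^bsub>fob T (F (Suc n))\<^esub> far T (F (Suc n)) (G (Suc n)) (compose (carrier (F (Suc n))) (s n) (d n)) y"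
      by (rule T_add[OF F'(2) G'(2) es sd \<phi>(1)]) (use y'(1) Suc in \<open>simp_all add: compose_eq s(3)\<close>)
    also have "far T (F (Suc n)) (G (Suc n)) (compose (carrier (F (Suc n))) (s n) (d n)) y =
        far T (F (Suc n)) (F n) (d n) (far T (F n) (G (Suc n)) (s n) y)"
      by (rule T_compose[symmetric, OF F'(2,2) G'(2) F'(3) s(1) sd]) (use y'(1) Suc in \<open>simp_all add: compose_eq\<close>)
    finally have "far T (F (Suc n)) (G (Suc n)) (\<phi> (Suc n)) y = far T (F (Suc n)) (F n) (d n) (far T (F n) (G (Suc n)) (s n) y)"
      using Tes Suc T_hom(3)[OF F'(2,2) F'(3) sn] by simp
    then show ?thesis using sn Suc by (simp add: coboundaries_def)
  qed
qed

text \<open>By additivity of \<open>T\<close> the two values differ by the value of a lift of zero,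
  a coboundary. This stands in for functoriality: identities between induced maps are proved by
  exhibiting two lifts of one map.\<close>

lemma lifts_unique:
  assumes F: "projective_resolution A M (F, d, \<epsilon>)" and G: "projective_resolution A N (G, e, \<eta>)"
    and MN: "module A M" "module A N" and f: "f \<in> lhom A M N"
    and l: "lifts A F d \<epsilon> G e \<eta> f \<phi>" "lifts A F d \<epsilon> G e \<eta> f \<psi>" and y: "y \<in> cocycles G e j"
  shows "coboundaries F d j +>\<^bsub>fob T (F j)\<^esub> far T (F j) (G j) (\<phi> j) y =
    coboundaries F d j +>\<^bsub>fob T (F j)\<^esub> far T (F j) (G j) (\<psi> j) y"
proof -
  note F' = resolutionD[OF F] and G' = resolutionD[OF G] and \<phi> = liftsD[OF l(1)] and \<psi> = liftsD[OF l(2)]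
  interpret TF: module A "fob T (F j)" by (rule T_module[OF F'(2)])
  interpret Gj: module A "G j" by (rule G')
  let ?\<chi> = "\<lambda>n. \<lambda>x\<in>carrier (F n). \<phi> n x \<oplus>\<^bsub>G n\<^esub> (\<lambda>x\<in>carrier (F n). \<ominus>\<^bsub>G n\<^esub> \<psi> n x) x"
  note \<chi> = lifts_diff[OF F G MN(2) f l]
  have y': "y \<in> carrier (fob T (G j))" using y by (auto simp: cocycles_def lker_def)
  note c = T_hom(3)[OF F'(2) G'(2) \<phi>(1) y'] T_hom(3)[OF F'(2) G'(2) \<psi>(1) y']
    T_hom(3)[OF F'(2) G'(2) liftsD(1)[OF \<chi>] y']
  have "far T (F j) (G j) (\<phi> j) y =
      far T (F j) (G j) (?\<chi> j) y \<oplus>\<^bsub>fob T (F j)\<^esub> far T (F j) (G j) (\<psi> j) y"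
    by (rule T_add[OF F'(2) G'(2) liftsD(1)[OF \<chi>] \<psi>(1) \<phi>(1) _ y'])
      (simp add: lhomD(3)[OF \<phi>(1)] lhomD(3)[OF \<psi>(1)] Gj.a_assoc Gj.l_neg)
  then have "far T (F j) (G j) (\<phi> j) y \<ominus>\<^bsub>fob T (F j)\<^esub> far T (F j) (G j) (\<psi> j) y = far T (F j) (G j) (?\<chi> j) y"
    using c by (simp add: a_minus_def TF.a_assoc TF.r_neg)
  then show ?thesis
    using lifts_zero_coboundaries[OF F G MN \<chi> y] c coset_eq_iff[OF coboundaries_submodule[OF F]]
    by simp
qed

end

section \<open>Biproducts\<close>

lemma isom_trans [trans]:
  assumes "isom A L M" "isom A M N" shows "isom A L N"
proof -
  obtain f g where f: "f \<in> module_hom A L M" "bij_betw f (carrier L) (carrier M)"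
    and g: "g \<in> module_hom A M N" "bij_betw g (carrier M) (carrier N)"
    using assms by (auto simp: isom_def)
  have "g \<circ> f \<in> module_hom A L N"
    by (rule module_homI) (simp_all add: module_homD[OF f(1)] module_homD[OF g(1)])
  then show ?thesis unfolding isom_def using bij_betw_trans[OF f(2) g(2)] by blast
qed

lemma isom_sym: "module A M \<Longrightarrow> isom A M N \<Longrightarrow> isom A N M"
  unfolding isom_def using module_hom_inv_into bij_betw_inv_into by blast

lemma isom_zero_module:
  assumes "module A M" "module A N" "isom A M N" "zero_module M" shows "zero_module N"
proof -
  obtain f where f: "f \<in> module_hom A M N" "bij_betw f (carrier M) (carrier N)"
    using assms(3) by (auto simp: isom_def)
  have "carrier N = f ` carrier M" using f(2) by (simp add: bij_betw_def)
  then show ?thesis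
    using assms(4) module_hom_zero_minus(1)[OF assms(1,2) f(1)] by (simp add: zero_module_def)
qed

lemma isom_finite_direct_sum:
  assumes "\<And>i. i \<in> I \<Longrightarrow> isom A (M i) (N i)"
  shows "isom A (finite_direct_sum I M) (finite_direct_sum I N)"
proof -
  have "\<forall>i\<in>I. \<exists>f. f \<in> module_hom A (M i) (N i) \<and> bij_betw f (carrier (M i)) (carrier (N i))"
    using assms by (auto simp: isom_def)
  then obtain f where f: "\<And>i. i \<in> I \<Longrightarrow> f i \<in> module_hom A (M i) (N i)"
    "\<And>i. i \<in> I \<Longrightarrow> bij_betw (f i) (carrier (M i)) (carrier (N i))" by metis
  note f' = module_homD[OF f(1)]
  define g where "g i = inv_into (carrier (M i)) (f i)" for i
  have g: "g i (f i x) = x" if "i \<in> I" "x \<in> carrier (M i)" for i x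
    using f(2)[OF that(1)] that(2) by (simp add: g_def bij_betw_def)
  have g': "f i (g i y) = y" "g i y \<in> carrier (M i)" if "i \<in> I" "y \<in> carrier (N i)" for i y
    using f(2)[OF that(1)] that(2) by (auto simp: g_def bij_betw_def inv_into_into f_inv_into_f)
  have cM: "x i \<in> carrier (M i)" if "x \<in> (\<Pi>\<^sub>E i\<in>I. carrier (M i))" "i \<in> I" for x i
    using that by auto
  have cN: "x i \<in> carrier (N i)" if "x \<in> (\<Pi>\<^sub>E i\<in>I. carrier (N i))" "i \<in> I" for x i
    using that by auto
  let ?f = "\<lambda>x. \<lambda>i\<in>I. f i (x i)"
  have c: "x i \<in> carrier (M i)" if "x \<in> carrier (finite_direct_sum I M)" "i \<in> I" for x i
    using that by (auto simp: finite_direct_sum_def)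
  have "?f \<in> module_hom A (finite_direct_sum I M) (finite_direct_sum I N)"
  proof (rule module_homI, goal_cases)
    case (1 x)
    then show ?case using c f' by (simp add: finite_direct_sum_def restrict_PiE_iff)
  next
    case (2 x y)
    show ?case using c[OF 2(1)] c[OF 2(2)] f' by (simp add: finite_direct_sum_def cong: restrict_cong)
  next
    case (3 a x)
    show ?case using c[OF 3(2)] 3(1) f' by (simp add: finite_direct_sum_def cong: restrict_cong)
  qed
  moreover have "bij_betw ?f (carrier (finite_direct_sum I M)) (carrier (finite_direct_sum I N))"
    unfolding finite_direct_sum_def module.simps partial_object.simps
  proof (rule bij_betw_byWitness[where f' = "\<lambda>y. \<lambda>i\<in>I. g i (y i)"])
    show "\<forall>x\<in>\<Pi>\<^sub>E i\<in>I. carrier (M i). (\<lambda>i\<in>I. g i (?f x i)) = x"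
      by (rule ballI, rule PiE_ext[of _ I "\<lambda>i. carrier (M i)"])
        (simp_all add: restrict_PiE_iff g g' f' cM)
    show "\<forall>y\<in>\<Pi>\<^sub>E i\<in>I. carrier (N i). ?f (\<lambda>i\<in>I. g i (y i)) = y"
      by (rule ballI, rule PiE_ext[of _ I "\<lambda>i. carrier (N i)"])
        (simp_all add: restrict_PiE_iff g' f' cN)
    show "?f ` (\<Pi>\<^sub>E i\<in>I. carrier (M i)) \<subseteq> (\<Pi>\<^sub>E i\<in>I. carrier (N i))"
      by (rule image_subsetI) (simp add: restrict_PiE_iff f' cM)
    show "(\<lambda>y. \<lambda>i\<in>I. g i (y i)) ` (\<Pi>\<^sub>E i\<in>I. carrier (N i)) \<subseteq> (\<Pi>\<^sub>E i\<in>I. carrier (M i))"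
      by (rule image_subsetI) (simp add: restrict_PiE_iff g' cN)
  qed
  ultimately show ?thesis unfolding isom_def by blast
qed

text \<open>The objects treated this way, derived functors of the limit and the colimit, are known
  through maps and not through elements; the biproduct identities determine them.\<close>

lemma isom_biproduct:
  assumes "module A M" "finite I" "\<And>i. i \<in> I \<Longrightarrow> module A (N i)"
    and p: "\<And>i. i \<in> I \<Longrightarrow> p i \<in> module_hom A M (N i)"
    and q: "\<And>i. i \<in> I \<Longrightarrow> q i \<in> module_hom A (N i) M"
    and pq: "\<And>i k y. i \<in> I \<Longrightarrow> k \<in> I \<Longrightarrow> y \<in> carrier (N i) \<Longrightarrow> p k (q i y) = (if k = i then y else \<zero>\<^bsub>N k\<^esub>)"
    and qp: "\<And>x. x \<in> carrier M \<Longrightarrow> (\<Oplus>\<^bsub>M\<^esub>i\<in>I. q i (p i x)) = x"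
  shows "isom A M (finite_direct_sum I N)"
proof -
  interpret M: module A M by fact
  note p' = module_homD[OF p] and q' = module_homD[OF q]
  let ?p = "\<lambda>x. \<lambda>i\<in>I. p i x" and ?q = "\<lambda>y. \<Oplus>\<^bsub>M\<^esub>i\<in>I. q i (y i)"
  have "?p \<in> module_hom A M (finite_direct_sum I N)"
    by (rule module_homI) (simp_all add: finite_direct_sum_def restrict_PiE_iff p' cong: restrict_cong)
  moreover have "bij_betw ?p (carrier M) (carrier (finite_direct_sum I N))"
  proof (rule bij_betw_byWitness[where f' = ?q])
    show "\<forall>x\<in>carrier M. ?q (?p x) = x"
    proof
      fix x assume x: "x \<in> carrier M"
      have "?q (?p x) = (\<Oplus>\<^bsub>M\<^esub>i\<in>I. q i (p i x))"
        by (rule M.finsum_cong') (use x p' q' in auto)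
      then show "?q (?p x) = x" using qp[OF x] by simp
    qed
    show "\<forall>y\<in>carrier (finite_direct_sum I N). ?p (?q y) = y"
    proof
      fix y assume y: "y \<in> carrier (finite_direct_sum I N)"
      then have yi: "\<And>i. i \<in> I \<Longrightarrow> y i \<in> carrier (N i)" by (auto simp: finite_direct_sum_def)
      show "?p (?q y) = y"
      proof (rule extensionalityI[of _ I])
        show "y \<in> extensional I" using y by (simp add: finite_direct_sum_def PiE_def)
        fix k assume k: "k \<in> I"
        have "p k (?q y) = (\<Oplus>\<^bsub>N k\<^esub>i\<in>I. p k (q i (y i)))"
          by (rule finsum_hom[OF assms(1) assms(3)[OF k] p[OF k] assms(2)]) (use yi q' in auto)
        also have "\<dots> = y k"
          by (rule finsum_single[OF assms(3)[OF k] assms(2) k yi[OF k]]) (use k yi pq in auto)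
        finally show "?p (?q y) k = y k" using k by simp
      qed simp
    qed
    show "?p ` carrier M \<subseteq> carrier (finite_direct_sum I N)"
      by (rule image_subsetI) (simp add: finite_direct_sum_def restrict_PiE_iff p')
    show "?q ` carrier (finite_direct_sum I N) \<subseteq> carrier M"
    proof (rule image_subsetI)
      fix y assume "y \<in> carrier (finite_direct_sum I N)"
      then have "\<And>i. i \<in> I \<Longrightarrow> y i \<in> carrier (N i)" by (auto simp: finite_direct_sum_def)
      then show "?q y \<in> carrier M" by (intro M.finsum_closed) (auto simp: q')
    qed
  qed
  ultimately show ?thesis unfolding isom_def by blast
qed

text \<open>The quotient map of a subquotient starts at the submodule \<open>Z\<close>, so sums of
  cocycles are formed there, whereas \<open>T_finsum\<close> computes in the ambient module.\<close>

lemma finsum_submodule: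
  assumes "submodule A Z M" "finite I" "f \<in> I \<rightarrow> Z"
  shows "(\<Oplus>\<^bsub>M\<lparr>carrier := Z\<rparr>\<^esub>i\<in>I. f i) = (\<Oplus>\<^bsub>M\<^esub>i\<in>I. f i)"
proof -
  interpret Z: submodule A Z M by fact
  interpret M: module A M by (rule Z.module)
  have "(\<lambda>x. x) \<in> module_hom A (M\<lparr>carrier := Z\<rparr>) M"
    by (rule module_homI) (use Z.subset in auto)
  from finsum_hom[OF M.submodule_is_module[OF assms(1)] Z.module this assms(2)] assms(3)
  show ?thesis by simp
qed

section \<open>Derived functors\<close>

context module_functor
begin

lemma left_exactD:
  assumes "module A L" "module A M" "module A N" "f \<in> lhom A L M" "g \<in> lhom A M N"
    and "f ` carrier L = lker M N g" "g ` carrier M = carrier N"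
  shows "inj_on (far T M N g) (carrier (fob T N))"
    and "far T M N g ` carrier (fob T N) = lker (fob T M) (fob T L) (far T L M f)"
  using left_exact[unfolded left_exact_def, rule_format, OF assms] by auto

text \<open>The same choice as inside \<open>right_derived\<close>, named so that its parts can be
  referred to.\<close>

definition res :: "('a, 'm) module \<Rightarrow> (nat \<Rightarrow> ('a, 'm) module) \<times> (nat \<Rightarrow> 'm \<Rightarrow> 'm) \<times> ('m \<Rightarrow> 'm)" where
  "res M = (SOME r. projective_resolution A M r)"

definition resF where "resF M = fst (res M)"
definition resd where "resd M = fst (snd (res M))"
definition rese where "rese M = snd (snd (res M))"

lemma res:
  assumes "module A M"
  shows "projective_resolution A M (resF M, resd M, rese M)"
  using someI_ex[OF ex_projective_resolution[OF cring large(1) assms]]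
  by (simp add: resF_def resd_def rese_def res_def)

lemma right_derived_subquot:
  "right_derived A T j M =
    subquot (fob T (resF M j)) (cocycles (resF M) (resd M) j) (coboundaries (resF M) (resd M) j)"
  by (simp add: right_derived_def resF_def resd_def rese_def cohomology_def cocycles_def
      coboundaries_def case_prod_unfold flip: res_def)

lemma right_derived_module: "module A M \<Longrightarrow> module A (right_derived A T j M)"
  unfolding right_derived_subquot
  by (intro subquot_module coboundaries_submodule[OF res] cocycles_submodule[OF res])

text \<open>Injections and projections are lifted to chain maps, and \<open>T\<close> induces maps
  on cohomology. The biproduct identities hold for the lifts only up to homotopy, which
  \<open>lifts_unique\<close> makes exact on classes.\<close>

lemma right_derived_biproduct:
  assumes L: "module A L" and I: "finite I" and V: "\<And>i. i \<in> I \<Longrightarrow> module A (V i)"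
    and \<iota>: "\<And>i. i \<in> I \<Longrightarrow> \<iota> i \<in> lhom A (V i) L" and \<pi>: "\<And>i. i \<in> I \<Longrightarrow> \<pi> i \<in> lhom A L (V i)"
    and \<pi>\<iota>: "\<And>i k x. i \<in> I \<Longrightarrow> k \<in> I \<Longrightarrow> x \<in> carrier (V i) \<Longrightarrow> \<pi> k (\<iota> i x) = (if k = i then x else \<zero>\<^bsub>V k\<^esub>)"
    and \<iota>\<pi>: "\<And>x. x \<in> carrier L \<Longrightarrow> (\<Oplus>\<^bsub>L\<^esub>i\<in>I. \<iota> i (\<pi> i x)) = x"
  shows "isom A (right_derived A T j L) (finite_direct_sum I (\<lambda>i. right_derived A T j (V i)))"
proof -
  note rL = res[OF L] and rV = res[OF V]
  let ?Z = "\<lambda>M. cocycles (resF M) (resd M) j"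
    and ?B = "\<lambda>M. coboundaries (resF M) (resd M) j"
  let ?TF = "\<lambda>M. fob T (resF M j)" and ?R = "\<lambda>M. right_derived A T j M"
  let ?cl = "\<lambda>M y. ?B M +>\<^bsub>?TF M\<^esub> y"
  let ?lifts = "\<lambda>M N. lifts A (resF M) (resd M) (rese M) (resF N) (resd N) (rese N)"
  let ?T = "\<lambda>M N. far T (resF M j) (resF N j)"
  note FL = resolutionD(2)[OF rL] and FV = resolutionD(2)[OF rV]
  have "\<forall>i\<in>I. \<exists>\<phi>. ?lifts (V i) L (\<iota> i) \<phi>"
    using ex_lifts[OF rV rL V L \<iota>] by blast
  then obtain \<phi> where \<phi>: "\<And>i. i \<in> I \<Longrightarrow> ?lifts (V i) L (\<iota> i) (\<phi> i)"
    by metis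
  have "\<forall>i\<in>I. \<exists>\<psi>. ?lifts L (V i) (\<pi> i) \<psi>"
    using ex_lifts[OF rL rV L V \<pi>] by blast
  then obtain \<psi> where \<psi>: "\<And>i. i \<in> I \<Longrightarrow> ?lifts L (V i) (\<pi> i) (\<psi> i)"
    by metis
  \<comment> \<open>By contravariance the lifted injections induce the projections of the new
    biproduct, and the lifted projections its injections.\<close>
  define a where "a i = ?T (V i) L (\<phi> i j)" for i
  define b where "b i = ?T L (V i) (\<psi> i j)" for i
  have ZB: "submodule A (?Z M) (?TF M)" "submodule A (?B M) (?TF M)" "?Z M \<subseteq> carrier (?TF M)" if "module A M" for M
    using cocycles_submodule[OF res[OF that]] coboundaries_submodule[OF res[OF that]]
    by (auto simp: submodule.subset cocycles_def lker_def)
  have a: "a i \<in> module_hom A (?TF L) (?TF (V i))" "a i ` ?Z L \<subseteq> ?Z (V i)" "a i ` ?B L \<subseteq> ?B (V i)" if "i \<in> I" for i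
    unfolding a_def using T_hom(1)[OF FV FL liftsD(1)[OF \<phi>]] lifts_cocycles[OF rV rL \<phi>] that by auto
  have b: "b i \<in> module_hom A (?TF (V i)) (?TF L)" "b i ` ?Z (V i) \<subseteq> ?Z L" "b i ` ?B (V i) \<subseteq> ?B L" if "i \<in> I" for i
    unfolding b_def using T_hom(1)[OF FL FV liftsD(1)[OF \<psi>]] lifts_cocycles[OF rL rV \<psi>] that by auto
  have "\<forall>i\<in>I. \<exists>\<alpha>. \<alpha> \<in> module_hom A (?R L) (?R (V i)) \<and> (\<forall>z\<in>?Z L. \<alpha> (?cl L z) = ?cl (V i) (a i z))"
    unfolding right_derived_subquot
    using subquot_map[OF ZB(2,1)[OF L] ZB(2,1)[OF V] a] by blast
  then obtain \<alpha> where \<alpha>: "\<And>i. i \<in> I \<Longrightarrow> \<alpha> i \<in> module_hom A (?R L) (?R (V i))"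
    "\<And>i z. i \<in> I \<Longrightarrow> z \<in> ?Z L \<Longrightarrow> \<alpha> i (?cl L z) = ?cl (V i) (a i z)" by metis
  have "\<forall>i\<in>I. \<exists>\<beta>. \<beta> \<in> module_hom A (?R (V i)) (?R L) \<and> (\<forall>z\<in>?Z (V i). \<beta> (?cl (V i) z) = ?cl L (b i z))"
    unfolding right_derived_subquot
    using subquot_map[OF ZB(2,1)[OF V] ZB(2,1)[OF L] b] by blast
  then obtain \<beta> where \<beta>: "\<And>i. i \<in> I \<Longrightarrow> \<beta> i \<in> module_hom A (?R (V i)) (?R L)"
    "\<And>i z. i \<in> I \<Longrightarrow> z \<in> ?Z (V i) \<Longrightarrow> \<beta> i (?cl (V i) z) = ?cl L (b i z)" by metis
  show ?thesis
  proof (rule isom_biproduct[where p = \<alpha> and q = \<beta>])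
    fix i k Y assume ik: "i \<in> I" "k \<in> I" and "Y \<in> carrier (?R (V i))"
    then obtain y where y: "y \<in> ?Z (V i)" "Y = ?cl (V i) y" by (auto simp: right_derived_subquot)
    note yc = subsetD[OF ZB(3)[OF V[OF ik(1)]] y(1)]
    have "\<alpha> k (\<beta> i Y) = ?cl (V k) (a k (b i y))"
      using y ik b(2)[OF ik(1)] by (auto simp: \<alpha>(2) \<beta>(2))
    also have "a k (b i y) = ?T (V k) (V i) (compose (carrier (resF (V k) j)) (\<psi> i j) (\<phi> k j)) y"
      unfolding a_def b_def
      by (rule T_compose[OF FV[OF ik(2)] FL FV[OF ik(1)] liftsD(1)[OF \<phi>[OF ik(2)]] liftsD(1)[OF \<psi>[OF ik(1)]]
            compose_lhom[OF FV[OF ik(2)] liftsD(1)[OF \<phi>[OF ik(2)]] liftsD(1)[OF \<psi>[OF ik(1)]]]])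
        (use yc in \<open>simp_all add: compose_eq\<close>)
    finally have eq: "\<alpha> k (\<beta> i Y) = ?cl (V k)
        (?T (V k) (V i) (compose (carrier (resF (V k) j)) (\<psi> i j) (\<phi> k j)) y)" .
    show "\<alpha> k (\<beta> i Y) = (if k = i then Y else \<zero>\<^bsub>?R (V k)\<^esub>)"
    proof (cases "k = i")
      case True
      \<comment> \<open>The composite lifts the identity of \<open>V i\<close>, as does the identity
        chain map; both therefore act alike on classes.\<close>
      have l: "?lifts (V i) (V i) (lid (V i))
          (\<lambda>n. compose (carrier (resF (V i) n)) (\<psi> i n) (\<phi> i n))"
        by (rule lifts_compose[OF rV[OF ik(1)] rL rV[OF ik(1)] \<phi>[OF ik(1)] \<psi>[OF ik(1)]])
          (use \<pi>\<iota>[OF ik(1) ik(1)] in simp)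
      show ?thesis
        using lifts_unique[OF rV[OF ik(1)] rV[OF ik(1)] V[OF ik(1)] V[OF ik(1)] lid_lhom[OF V[OF ik(1)]] l
            lifts_id[OF rV[OF ik(1)]] y(1)] T_id[OF FV[OF ik(1)] yc] y(2) eq True by simp
    next
      case False
      have l: "?lifts (V k) (V i) (lzero (V k) (V i))
          (\<lambda>n. compose (carrier (resF (V k) n)) (\<psi> i n) (\<phi> k n))"
        by (rule lifts_compose[OF rV[OF ik(2)] rL rV[OF ik(1)] \<phi>[OF ik(2)] \<psi>[OF ik(1)]])
          (use \<pi>\<iota>[OF ik(2) ik(1)] False in simp)
      show ?thesis
        using lifts_unique[OF rV[OF ik(2)] rV[OF ik(1)] V[OF ik(2)] V[OF ik(1)]
            lzero_lhom[OF V[OF ik(2)] V[OF ik(1)]] l lifts_zero[OF rV[OF ik(2)] rV[OF ik(1)] V[OF ik(1)]] y(1)]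
          T_lzero[OF FV[OF ik(2)] FV[OF ik(1)] yc] coset_zero[OF ZB(2)[OF V[OF ik(2)]]] eq False
        by (simp add: right_derived_subquot)
    qed
  next
    fix X assume "X \<in> carrier (?R L)"
    then obtain x where x: "x \<in> ?Z L" "X = ?cl L x" by (auto simp: right_derived_subquot)
    note xc = subsetD[OF ZB(3)[OF L] x(1)]
    interpret RL: module A "?R L" by (rule right_derived_module[OF L])
    let ?c = "\<lambda>i n. compose (carrier (resF L n)) (\<phi> i n) (\<psi> i n)"
    let ?s = "\<lambda>n. \<lambda>x\<in>carrier (resF L n). \<Oplus>\<^bsub>resF L n\<^esub>i\<in>I. ?c i n x"
    have c: "?c i n \<in> lhom A (resF L n) (resF L n)" if "i \<in> I" for i n
      by (rule compose_lhom[OF FL liftsD(1)[OF \<psi>[OF that]] liftsD(1)[OF \<phi>[OF that]]])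
    have lc: "?lifts L L
        (compose (carrier L) (\<iota> i) (\<pi> i)) (?c i)" if "i \<in> I" for i
      by (rule lifts_compose[OF rL rV[OF that] rL \<psi>[OF that] \<phi>[OF that]]) (simp add: compose_eq)
    \<comment> \<open>The sum of the composites lifts the identity of \<open>L\<close>, although it
      need not be the identity on the resolution.\<close>
    have ls: "?lifts L L (lid L) ?s"
    proof (rule lifts_sum[OF rL rL L I _ lc])
      interpret L: module A L by (rule L)
      show "compose (carrier L) (\<iota> i) (\<pi> i) \<in> lhom A L L" if "i \<in> I" for i
        by (rule compose_lhom[OF L \<pi>[OF that] \<iota>[OF that]])
      show "?s n \<in> lhom A (resF L n) (resF L n)" for n
        by (rule finsum_lhom[OF FL FL I c])
      fix x assume x: "x \<in> carrier L"
      have "(\<Oplus>\<^bsub>L\<^esub>i\<in>I. compose (carrier L) (\<iota> i) (\<pi> i) x) = (\<Oplus>\<^bsub>L\<^esub>i\<in>I. \<iota> i (\<pi> i x))"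
        by (rule L.finsum_cong') (use x lhomD(3)[OF \<iota>] lhomD(3)[OF \<pi>] in \<open>auto simp: compose_eq\<close>)
      then show "lid L x = (\<Oplus>\<^bsub>L\<^esub>i\<in>I. compose (carrier L) (\<iota> i) (\<pi> i) x)" using \<iota>\<pi>[OF x] x by simp
    qed
    have ba: "b i (a i x) = ?T L L (?c i j) x" if "i \<in> I" for i
      unfolding a_def b_def
      by (rule T_compose[OF FL FV[OF that] FL liftsD(1)[OF \<psi>[OF that]] liftsD(1)[OF \<phi>[OF that]] c[OF that]])
        (use xc in \<open>simp_all add: compose_eq\<close>)
    have baZ: "b i (a i x) \<in> ?Z L" if "i \<in> I" for i using a(2)[OF that] b(2)[OF that] x(1) by blast
    have ZL: "module A ((?TF L)\<lparr>carrier := ?Z L\<rparr>)"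
      by (rule module.submodule_is_module[OF T_module[OF FL] ZB(1)[OF L]])
    have "(\<Oplus>\<^bsub>?R L\<^esub>i\<in>I. \<beta> i (\<alpha> i X)) = (\<Oplus>\<^bsub>?R L\<^esub>i\<in>I. ?cl L (b i (a i x)))"
    proof (rule RL.finsum_cong'[OF refl])
      show "(\<lambda>i. ?cl L (b i (a i x))) \<in> I \<rightarrow> carrier (?R L)"
        using baZ by (auto simp: right_derived_subquot)
      fix i assume i: "i \<in> I"
      then show "\<beta> i (\<alpha> i X) = ?cl L (b i (a i x))"
        using x a(2)[OF i] by (auto simp: \<alpha>(2) \<beta>(2))
    qed
    also have "\<dots> = ?cl L (\<Oplus>\<^bsub>(?TF L)\<lparr>carrier := ?Z L\<rparr>\<^esub>i\<in>I. b i (a i x))"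
      using finsum_hom[OF ZL right_derived_module[OF L, of j, unfolded right_derived_subquot]
          quotient_hom[OF ZB(2,3)[OF L]] I, of "\<lambda>i. b i (a i x)"] baZ
      by (simp add: right_derived_subquot)
    also have "(\<Oplus>\<^bsub>(?TF L)\<lparr>carrier := ?Z L\<rparr>\<^esub>i\<in>I. b i (a i x)) = (\<Oplus>\<^bsub>?TF L\<^esub>i\<in>I. b i (a i x))"
      by (rule finsum_submodule[OF ZB(1)[OF L] I]) (use baZ in auto)
    also have "\<dots> = (\<Oplus>\<^bsub>?TF L\<^esub>i\<in>I. ?T L L (?c i j) x)"
    proof -
      interpret TL: module A "?TF L" by (rule T_module[OF FL])
      show ?thesis
        by (rule TL.finsum_cong') (use ba T_hom(3)[OF FL FL c xc] in auto)
    qed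
    also have "\<dots> = ?T L L (?s j) x"
      by (rule T_finsum[symmetric, OF FL FL I c xc])
    also have "?cl L \<dots> = ?cl L (?T L L (lid (resF L j)) x)"
      by (rule lifts_unique[OF rL rL L L lid_lhom[OF L] ls lifts_id[OF rL] x(1)])
    also have "\<dots> = X" using T_id[OF FL xc] x(2) by simp
    finally show "(\<Oplus>\<^bsub>?R L\<^esub>i\<in>I. \<beta> i (\<alpha> i X)) = X" .
  qed (use I V \<alpha>(1) \<beta>(1) right_derived_module[OF L] right_derived_module[OF V] in auto)
qed

text \<open>Left exactness, applied to the end of the resolution, identifies \<open>T M\<close> with
  the cocycles in degree \<open>0\<close>, and the coboundaries there are zero.\<close>

lemma right_derived_0:
  assumes "module A M" shows "isom A (fob T M) (right_derived A T 0 M)"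
proof -
  note r = res[OF assms] and r' = resolutionD[OF res[OF assms]]
  let ?F = "resF M" and ?d = "resd M" and ?\<epsilon> = "rese M"
  have im: "?d 0 ` carrier (?F (Suc 0)) = lker (?F 0) M ?\<epsilon>"
    using r by (simp add: projective_resolution_def)
  have T\<epsilon>: "inj_on (far T (?F 0) M ?\<epsilon>) (carrier (fob T M))"
    "far T (?F 0) M ?\<epsilon> ` carrier (fob T M) = cocycles ?F ?d 0"
    using left_exactD[OF r'(2,2) assms r'(3,4) im r'(5)] by (simp_all add: cocycles_def)
  have B: "submodule A (coboundaries ?F ?d 0) (fob T (?F 0))" by (rule coboundaries_submodule[OF r])
  have Z: "cocycles ?F ?d 0 \<subseteq> carrier (fob T (?F 0))" by (auto simp: cocycles_def lker_def)
  have B0: "coboundaries ?F ?d 0 = {\<zero>\<^bsub>fob T (?F 0)\<^esub>}" by (simp add: coboundaries_def)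
  let ?h = "\<lambda>y. coboundaries ?F ?d 0 +>\<^bsub>fob T (?F 0)\<^esub> far T (?F 0) M ?\<epsilon> y"
  note Th = T_hom[OF r'(2) assms r'(4)]
  have "?h \<in> module_hom A (fob T M) (right_derived A T 0 M)"
    unfolding right_derived_subquot
  proof (rule module_homI, goal_cases)
    case (1 x)
    then show ?case using T\<epsilon>(2) by auto
  next
    case (2 x y)
    then show ?case by (simp add: Th subquot_ops[OF B])
  next
    case (3 a x)
    then show ?case by (simp add: Th subquot_ops[OF B])
  qed
  moreover have "bij_betw ?h (carrier (fob T M)) (carrier (right_derived A T 0 M))"
    unfolding right_derived_subquot bij_betw_def
  proof
    show "inj_on ?h (carrier (fob T M))"
    proof (rule inj_onI)
      fix x y assume xy: "x \<in> carrier (fob T M)" "y \<in> carrier (fob T M)" "?h x = ?h y"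
      then have "far T (?F 0) M ?\<epsilon> x = far T (?F 0) M ?\<epsilon> y"
        using coset_eq_iff[OF B] Th(3) B0 module_minus_eq_zero_iff[OF T_module[OF r'(2)]] by simp
      then show "x = y" using xy T\<epsilon>(1) by (auto dest: inj_onD)
    qed
    show "?h ` carrier (fob T M) = carrier (subquot (fob T (?F 0)) (cocycles ?F ?d 0) (coboundaries ?F ?d 0))"
      by (simp add: T\<epsilon>(2)[symmetric] image_image)
  qed
  ultimately show ?thesis unfolding isom_def by blast
qed

text \<open>Only the half of exactness that \<open>left_exact\<close> leaves open: monomorphisms
  become surjections.\<close>

definition exact_functor :: bool where
  "exact_functor \<longleftrightarrow> (\<forall>M N f. module A M \<longrightarrow> module A N \<longrightarrow> f \<in> lhom A M N \<longrightarrow> inj_on f (carrier M) \<longrightarrow>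
    far T M N f ` carrier (fob T N) = carrier (fob T M))"

text \<open>The differential is factored through its image \<open>J\<close>. Left exactness makes
  the cocycles the image of \<open>T J\<close>, and exactness makes \<open>T\<close> of the
  inclusion of \<open>J\<close> surjective, so they are all coboundaries.\<close>

lemma exact_right_derived_Suc:
  assumes "exact_functor" "module A M" shows "zero_module (right_derived A T (Suc n) M)"
proof -
  note r = res[OF assms(2)] and r' = resolutionD[OF res[OF assms(2)]]
  let ?F = "resF M" and ?d = "resd M"
  interpret Fn: module A "?F n" by (rule r'(2))
  define J where "J = (?F n)\<lparr>carrier := ?d n ` carrier (?F (Suc n))\<rparr>"
  have J: "module A J"
    unfolding J_def
    by (rule Fn.submodule_is_module[OF image_submodule[OF r'(2,2) lhomD(1)[OF r'(3)]]])
  have d': "?d n \<in> lhom A (?F (Suc n)) J"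
    unfolding J_def by (rule lhom_codomain_submodule[OF r'(3) order_refl])
  have inc: "(\<lambda>x\<in>carrier J. x) \<in> lhom A J (?F n)"
    by (rule restrict_lhom[OF J], rule module_homI) (use lhomD(3)[OF r'(3)] in \<open>auto simp: J_def\<close>)
  have im: "?d (Suc n) ` carrier (?F (Suc (Suc n))) = lker (?F (Suc n)) J (?d n)"
    using r by (simp add: projective_resolution_def J_def lker_def)
  have ker: "far T (?F (Suc n)) J (?d n) ` carrier (fob T J) = cocycles ?F ?d (Suc n)"
    unfolding cocycles_def
    by (rule left_exactD(2)[OF r'(2,2) J r'(3) d' im]) (simp add: J_def)
  have surj: "far T J (?F n) (\<lambda>x\<in>carrier J. x) ` carrier (fob T (?F n)) = carrier (fob T J)"
    using assms(1) J r'(2) inc unfolding exact_functor_def by (auto simp: inj_on_def)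
  have comp: "far T (?F (Suc n)) J (?d n) (far T J (?F n) (\<lambda>x\<in>carrier J. x) y) = far T (?F (Suc n)) (?F n) (?d n) y"
    if "y \<in> carrier (fob T (?F n))" for y
    by (rule T_compose[OF r'(2) J r'(2) d' inc r'(3) _ that]) (simp add: J_def)
  have "cocycles ?F ?d (Suc n) = coboundaries ?F ?d (Suc n)"
    unfolding ker[symmetric] surj[symmetric] coboundaries_def
    by (simp add: image_image comp)
  then have "carrier (right_derived A T (Suc n) M) = {\<zero>\<^bsub>right_derived A T (Suc n) M\<^esub>}"
  proof -
    let ?B = "coboundaries ?F ?d (Suc n)"
    note B = coboundaries_submodule[OF r, of "Suc n"]
    interpret B: submodule A ?B "fob T (?F (Suc n))" by (rule B)
    have "(\<lambda>x. ?B +>\<^bsub>fob T (?F (Suc n))\<^esub> x) ` ?B = {?B}"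
      using coset_eq_zero_iff[OF B] B.subset B.zero_closed by blast
    then show ?thesis by (simp add: right_derived_subquot \<open>cocycles ?F ?d (Suc n) = _\<close>)
  qed
  then show ?thesis by (simp add: zero_module_def)
qed

end

section \<open>The two cases\<close>

definition maximal_elements :: "'p::order set \<Rightarrow> 'p set" where
  "maximal_elements P = {q \<in> P. \<forall>r\<in>P. q \<le> r \<longrightarrow> r = q}"

lemma ex_maximal_above:
  assumes "finite P" "p \<in> P" shows "\<exists>m\<in>maximal_elements P. p \<le> m"
  using finite_has_maximal2[OF assms] unfolding maximal_elements_def by blast

lemma inverse_systemD:
  assumes "inverse_system A P G"
  shows "p \<in> P \<Longrightarrow> module A (sob G p)" "p \<in> P \<Longrightarrow> sar G p p = lid (sob G p)"
    "p \<in> P \<Longrightarrow> q \<in> P \<Longrightarrow> p \<le> q \<Longrightarrow> sar G p q \<in> lhom A (sob G q) (sob G p)"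
    "p \<in> P \<Longrightarrow> q \<in> P \<Longrightarrow> r \<in> P \<Longrightarrow> p \<le> q \<Longrightarrow> q \<le> r \<Longrightarrow> x \<in> carrier (sob G r) \<Longrightarrow>
      sar G p q (sar G q r x) = sar G p r x"
proof -
  show "sar G p q (sar G q r x) = sar G p r x"
    if "p \<in> P" "q \<in> P" "r \<in> P" "p \<le> q" "q \<le> r" "x \<in> carrier (sob G r)"
  proof -
    have "sar G p r = compose (carrier (sob G r)) (sar G p q) (sar G q r)"
      using assms that unfolding inverse_system_def by blast
    then show ?thesis using that(6) by (simp only: compose_eq)
  qed
  show "p \<in> P \<Longrightarrow> module A (sob G p)" "p \<in> P \<Longrightarrow> sar G p p = lid (sob G p)"
    using conjunct1[OF assms[unfolded inverse_system_def]] by auto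
  show "p \<in> P \<Longrightarrow> q \<in> P \<Longrightarrow> p \<le> q \<Longrightarrow> sar G p q \<in> lhom A (sob G q) (sob G p)"
    using conjunct1[OF conjunct2[OF assms[unfolded inverse_system_def]]] by auto
qed

lemma zero_isom:
  assumes "module A M" "module A N" "zero_module M" "zero_module N" shows "isom A M N"
proof -
  interpret N: module A N by fact
  have "(\<lambda>x. \<zero>\<^bsub>N\<^esub>) \<in> module_hom A M N"
    by (rule module_homI) auto
  then show ?thesis
    using assms(3,4) unfolding isom_def zero_module_def bij_betw_def by auto
qed

lemma finite_direct_sum_zero_module:
  assumes "\<And>i. i \<in> I \<Longrightarrow> zero_module (M i)"
  shows "zero_module (finite_direct_sum I M)"
proof -
  have "(\<Pi>\<^sub>E i\<in>I. carrier (M i)) = (\<Pi>\<^sub>E i\<in>I. {\<zero>\<^bsub>M i\<^esub>})"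
    using assms by (intro PiE_cong) (simp add: zero_module_def)
  also have "\<dots> = (\<Pi>\<^sub>E i\<in>I. {(\<lambda>i\<in>I. \<zero>\<^bsub>M i\<^esub>) i})" by (intro PiE_cong) simp
  also have "\<dots> = {\<lambda>i\<in>I. \<zero>\<^bsub>M i\<^esub>}" by (rule PiE_singleton) (rule restrict_extensional)
  finally show ?thesis by (simp add: zero_module_def finite_direct_sum_def)
qed

section \<open>Limits and colimits of systems in terms of the maximal elements\<close>

context module_functor
begin

lemma right_derived_lim_of_unique_maximal:
  fixes G :: "('p::order, 'a, 'm) system"
  assumes P: "finite P" and G: "inverse_system A P G"
    and uniq: "\<And>p b c. p \<in> P \<Longrightarrow> b \<in> maximal_elements P \<Longrightarrow> c \<in> maximal_elements P \<Longrightarrow>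
      p \<le> b \<Longrightarrow> p \<le> c \<Longrightarrow> b = c"
  shows "isom A (right_derived A T j (lim_ob A P G))
    (finite_direct_sum (maximal_elements P) (\<lambda>q. right_derived A T j (sob G q)))"
proof -
  let ?M = "maximal_elements P" and ?L = "lim_ob A P G" and ?\<pi> = "lim_proj A P G"
  note G' = inverse_systemD[OF G]
  have lim: "limit_cone A P G (?L, ?\<pi>)"
    by (rule lim_ob_limit_cone[OF cring inf(1) P G'(1,3)])
  then have L: "module A ?L" and \<pi>: "\<And>p. p \<in> P \<Longrightarrow> ?\<pi> p \<in> lhom A ?L (sob G p)"
    and comp: "\<And>p q x. p \<in> P \<Longrightarrow> q \<in> P \<Longrightarrow> p \<le> q \<Longrightarrow> x \<in> carrier ?L \<Longrightarrow> sar G p q (?\<pi> q x) = ?\<pi> p x"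
    by (auto simp: limit_cone_def cone_def dest: composeD)
  interpret L: module A ?L by (rule L)
  have M: "i \<in> P" "\<And>r. r \<in> P \<Longrightarrow> i \<le> r \<Longrightarrow> r = i" if "i \<in> ?M" for i
    using that by (auto simp: maximal_elements_def)
  \<comment> \<open>The components of the inclusion of the summand at \<open>i\<close> into the
    limit: structure maps below \<open>i\<close>, zero elsewhere.\<close>
  define \<xi> where "\<xi> i p = (if p \<le> i then sar G p i else lzero (sob G i) (sob G p))" for i p
  have \<xi>: "\<xi> i p \<in> lhom A (sob G i) (sob G p)" if "i \<in> ?M" "p \<in> P" for i p
    unfolding \<xi>_def using that M G'(3) lzero_lhom[OF G'(1) G'(1)] by simp
  have cone: "cone A P G (sob G i) (\<xi> i)" if i: "i \<in> ?M" for i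
    unfolding cone_def
  proof (intro conjI ballI impI)
    show "module A (sob G i)" using G'(1) M i by blast
    show "\<xi> i p \<in> lhom A (sob G i) (sob G p)" if "p \<in> P" for p using \<xi> i that .
    fix p q assume pq: "p \<in> P" "q \<in> P" "p \<le> q"
    show "compose (carrier (sob G i)) (sar G p q) (\<xi> i q) = \<xi> i p"
    proof (rule compose_lhom_eqI[OF G'(1)[OF M(1)[OF i]] \<xi>[OF i pq(2)] G'(3)[OF pq] \<xi>[OF i pq(1)]])
      fix x assume x: "x \<in> carrier (sob G i)"
      show "sar G p q (\<xi> i q x) = \<xi> i p x"
      proof (cases "q \<le> i")
        case True
        then have "p \<le> i" using pq(3) by (rule order_trans[rotated])
        then show ?thesis using G'(4)[OF pq(1,2) M(1)[OF i] pq(3) True x] True by (simp add: \<xi>_def)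
      next
        case False
        \<comment> \<open>Here the uniqueness enters: \<open>q\<close> lies below a maximal
          \<open>m\<close> other than \<open>i\<close>, so \<open>p\<close>, being below
          \<open>m\<close>, cannot also lie below \<open>i\<close>, and the zero component at
          \<open>q\<close> is compatible with the one at \<open>p\<close>.\<close>
        obtain m where m: "m \<in> ?M" "q \<le> m" using ex_maximal_above[OF P pq(2)] by blast
        then have "\<not> p \<le> i" using uniq[OF pq(1) i m(1)] pq(3) False by auto
        then show ?thesis using False x
          by (simp add: \<xi>_def module_hom_zero_minus(1)[OF G'(1) G'(1) lhomD(1)[OF G'(3)[OF pq]]] pq)
      qed
    qed
  qed
  have "\<forall>i\<in>?M. \<exists>u. u \<in> lhom A (sob G i) ?L \<and> (\<forall>p\<in>P. compose (carrier (sob G i)) (?\<pi> p) u = \<xi> i p)"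
    using lim cone unfolding limit_cone_def by blast
  then obtain \<iota> where \<iota>: "\<And>i. i \<in> ?M \<Longrightarrow> \<iota> i \<in> lhom A (sob G i) ?L"
    "\<And>i p. i \<in> ?M \<Longrightarrow> p \<in> P \<Longrightarrow> compose (carrier (sob G i)) (?\<pi> p) (\<iota> i) = \<xi> i p" by metis
  note \<pi>\<iota> = composeD[OF \<iota>(2)]
  have finM: "finite ?M" using P by (simp add: maximal_elements_def)
  show ?thesis
  proof (rule right_derived_biproduct[OF L finM, of "\<lambda>q. sob G q" \<iota> ?\<pi>])
    fix i k x assume "i \<in> ?M" "k \<in> ?M" "x \<in> carrier (sob G i)"
    then show "?\<pi> k (\<iota> i x) = (if k = i then x else \<zero>\<^bsub>sob G k\<^esub>)"
      using \<pi>\<iota> M G'(2)[of i] by (auto simp: \<xi>_def)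
  next
    fix x assume x: "x \<in> carrier ?L"
    let ?f = "\<lambda>i. compose (carrier ?L) (\<iota> i) (?\<pi> i)"
    let ?s = "\<lambda>x\<in>carrier ?L. \<Oplus>\<^bsub>?L\<^esub>i\<in>?M. ?f i x"
    have f: "?f i \<in> lhom A ?L ?L" if "i \<in> ?M" for i
      by (rule compose_lhom[OF L \<pi>[OF M(1)[OF that]] \<iota>(1)[OF that]])
    have s: "?s \<in> lhom A ?L ?L" by (rule finsum_lhom[OF L L finM f])
    \<comment> \<open>An endomorphism of the limit is the identity if it preserves all projections.
      At \<open>p\<close> only the summand of the maximal element above \<open>p\<close>
      contributes.\<close>
    have "compose (carrier ?L) (?\<pi> p) ?s = ?\<pi> p" if p: "p \<in> P" for p
    proof (rule compose_lhom_eqI[OF L s \<pi>[OF p] \<pi>[OF p]])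
      fix x assume x: "x \<in> carrier ?L"
      obtain m where m: "m \<in> ?M" "p \<le> m" using ex_maximal_above[OF P p] by blast
      have "?\<pi> p (?s x) = ?\<pi> p (\<Oplus>\<^bsub>?L\<^esub>i\<in>?M. ?f i x)" using x by simp
      also have "\<dots> = (\<Oplus>\<^bsub>sob G p\<^esub>i\<in>?M. ?\<pi> p (?f i x))"
        by (rule finsum_hom[OF L G'(1)[OF p] lhomD(1)[OF \<pi>[OF p]] finM]) (use lhomD(3)[OF f] x in auto)
      also have "\<dots> = ?\<pi> p x"
      proof (rule finsum_single[OF G'(1)[OF p] finM m(1) lhomD(3)[OF \<pi>[OF p] x]])
        have eq: "?\<pi> p (?f i x) = \<xi> i p (?\<pi> i x)" if "i \<in> ?M" for i
          using \<pi>\<iota>[OF that p] lhomD(3)[OF \<pi>[OF M(1)[OF that]] x] x by (simp add: compose_eq)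
        show "?\<pi> p (?f m x) = ?\<pi> p x"
          using eq[OF m(1)] m comp[OF p M(1)[OF m(1)] m(2) x] by (simp add: \<xi>_def)
        show "?\<pi> p (?f i x) = \<zero>\<^bsub>sob G p\<^esub>" if "i \<in> ?M" "i \<noteq> m" for i
          using eq[OF that(1)] uniq[OF p that(1) m(1) _ m(2)] that lhomD(3)[OF \<pi>[OF M(1)[OF that(1)]] x]
          by (auto simp: \<xi>_def)
      qed
      finally show "?\<pi> p (?s x) = ?\<pi> p x" .
    qed
    moreover have "compose (carrier ?L) (?\<pi> p) (lid ?L) = ?\<pi> p" if p: "p \<in> P" for p
      by (rule compose_lhom_eqI[OF L lid_lhom[OF L] \<pi>[OF p] \<pi>[OF p]]) simp
    moreover have "\<exists>!u. u \<in> lhom A ?L ?L \<and> (\<forall>p\<in>P. compose (carrier ?L) (?\<pi> p) u = ?\<pi> p)"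
      using lim unfolding limit_cone_def prod.case by blast
    ultimately have "?s = lid ?L" using s lid_lhom[OF L] by blast
    then have "?s x = x" using x by (simp only: restrict_apply if_True)
    moreover have "(\<Oplus>\<^bsub>?L\<^esub>i\<in>?M. \<iota> i (?\<pi> i x)) = ?s x"
      using x lhomD(3)[OF f] by (auto simp: compose_eq intro!: L.finsum_cong')
    ultimately show "(\<Oplus>\<^bsub>?L\<^esub>i\<in>?M. \<iota> i (?\<pi> i x)) = x" by simp
  qed (use M G'(1) \<pi> \<iota>(1) in auto)
qed

lemma apply_system_direct:
  assumes "inverse_system A P G"
  shows "p \<in> P \<Longrightarrow> module A (sob (apply_system T G) p)"
    "p \<in> P \<Longrightarrow> q \<in> P \<Longrightarrow> p \<le> q \<Longrightarrow>
      sar (apply_system T G) p q \<in> lhom A (sob (apply_system T G) p) (sob (apply_system T G) q)"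
  using inverse_systemD[OF assms] by (auto simp: apply_system_def intro!: T_module T_lhom)

text \<open>
  Two maximal elements with a common lower bound admit, for every monomorphism \<open>f : M \<rightarrow> N\<close>, a
  system with limit \<open>0\<close> whose image under \<open>T\<close> has colimit \<open>coker (T f)\<close>.
\<close>

lemma exact_functor_if_not_unique_maximal:
  fixes P :: "'p::order set"
  assumes P: "finite P" and eqv: "colim_lim_equivalence A P T"
    and abc: "a \<in> P" "b \<in> maximal_elements P" "c \<in> maximal_elements P" "a \<le> b" "a \<le> c" "b \<noteq> c"
  shows "exact_functor"
  unfolding exact_functor_def
proof (intro allI impI)
  fix M N :: "('a, 'm) module" and f
  assume M: "module A M" and N: "module A N" and f: "f \<in> lhom A M N" and inj: "inj_on f (carrier M)"
  interpret M: module A M by (rule M)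
  interpret N: module A N by (rule N)
  have bc: "b \<in> P" "c \<in> P" "\<not> b \<le> c" "\<And>r. r \<in> P \<Longrightarrow> c \<le> r \<Longrightarrow> r = c"
    using abc by (auto simp: maximal_elements_def)
  \<comment> \<open>For \<open>p\<close> below \<open>c\<close> this says that \<open>p\<close> also
    lies below another maximal element. Asking for any \<open>r\<close> not below \<open>c\<close>
    makes \<open>U\<close> visibly closed downwards.\<close>
  define U where "U p \<longleftrightarrow> (\<exists>r\<in>P. p \<le> r \<and> \<not> r \<le> c)" for p
  have Ua: "U a" using abc bc by (auto simp: U_def)
  have Uc: "\<not> U c" using bc(4) by (auto simp: U_def)
  have Udown: "U p" if "p \<le> q" "U q" for p q using that unfolding U_def by (meson order_trans)
  define Z :: "('a, 'm) module" where "Z = zero_mod"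
  have Z: "module A Z" "zero_module Z" using zero_mod cring by (auto simp: Z_def)
  interpret Z: module A Z by (rule Z)
  have Z0: "x = \<zero>\<^bsub>Z\<^esub>" if "x \<in> carrier Z" for x using that Z(2) by (simp add: zero_module_def)
  define ob where "ob p = (if p \<le> c then if U p then N else M else Z)" for p
  \<comment> \<open>The only nontrivial map is \<open>f\<close>, from the \<open>M\<close>-part down
    into the \<open>N\<close>-part. No map in the other direction occurs, since \<open>U\<close> is
    closed downwards.\<close>
  define ar where "ar p q = (if q \<le> c then if U q then lid N else if U p then f else lid M
    else lzero Z (ob p))" for p q
  define G :: "('p, 'a, 'm) system" where "G = \<lparr>sob = ob, sar = ar\<rparr>"
  have G_simps [simp]: "sob G = ob" "sar G = ar" by (simp_all add: G_def)
  have ob: "module A (ob p)" for p by (simp add: ob_def M N Z)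
  have ar: "ar p q \<in> lhom A (ob q) (ob p)" if "p \<le> q" for p q
  proof (cases "q \<le> c")
    case True
    then have "p \<le> c" using that by simp
    then show ?thesis
      using True f lid_lhom[OF M] lid_lhom[OF N] Udown[OF that] by (simp add: ar_def ob_def)
  next
    case False
    then show ?thesis using lzero_lhom[OF Z(1) ob] by (simp add: ar_def ob_def[of q])
  qed
  have G: "inverse_system A P G"
    unfolding inverse_system_def G_simps
  proof (intro conjI ballI impI)
    fix p
    show "module A (ob p)" by (rule ob)
    show "ar p p = lid (ob p)"
      by (auto simp: ar_def ob_def Z0[symmetric] intro!: restrict_ext)
  next
    fix p q r assume "p \<le> q" "q \<le> (r::'p)"
    then have pq: "p \<le> q" "q \<le> r" "p \<le> r" by auto
    show "ar p r = compose (carrier (ob r)) (ar p q) (ar q r)"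
    proof (rule compose_lhom_eqI[OF ob ar[OF pq(2)] ar[OF pq(1)] ar[OF pq(3)], symmetric])
      fix x assume x: "x \<in> carrier (ob r)"
      show "ar p q (ar q r x) = ar p r x"
      proof (cases "r \<le> c")
        case True
        then have le: "p \<le> c" "q \<le> c" using pq by auto
        note U = Udown[OF pq(1)] Udown[OF pq(2)]
        show ?thesis
          using True le U x lhomD(3)[OF f] by (auto simp: ar_def ob_def)
      next
        case False
        then have "x = \<zero>\<^bsub>ob r\<^esub>" using x Z0 by (simp add: ob_def)
        then show ?thesis
          using pq by (simp add: module_hom_zero_minus(1)[OF ob ob lhomD(1)[OF ar]])
      qed
    qed
  qed (rule ar)
  have lim: "limit_cone A P G (lim_ob A P G, lim_proj A P G)"
    by (rule lim_ob_limit_cone[OF cring inf(1) P inverse_systemD(1,3)[OF G]])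
  let ?L = "lim_ob A P G" and ?\<pi> = "lim_proj A P G"
  from lim have L: "module A ?L" and \<pi>: "\<And>p. p \<in> P \<Longrightarrow> ?\<pi> p \<in> lhom A ?L (ob p)"
    and comp: "\<And>p q x. p \<in> P \<Longrightarrow> q \<in> P \<Longrightarrow> p \<le> q \<Longrightarrow> x \<in> carrier ?L \<Longrightarrow> ar p q (?\<pi> q x) = ?\<pi> p x"
    by (auto simp: limit_cone_def cone_def dest: composeD)
  \<comment> \<open>The component at \<open>a\<close> is \<open>f\<close> of the component at
    \<open>c\<close>, and also the image of the component at \<open>b\<close>, which is zero as
    \<open>b\<close> is not below \<open>c\<close>. Injectivity of \<open>f\<close> kills the
    component at \<open>c\<close>, and with it everything below \<open>c\<close>.\<close>
  have \<pi>_zero: "?\<pi> p x = \<zero>\<^bsub>ob p\<^esub>" if p: "p \<in> P" and x: "x \<in> carrier ?L" for p x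
  proof (cases "p \<le> c")
    case False
    then show ?thesis using lhomD(3)[OF \<pi>[OF p] x] Z0 by (simp add: ob_def)
  next
    case True
    have obc: "ob c = M" "ob a = N" "ob b = Z" using Uc Ua abc bc by (simp_all add: ob_def)
    have xc: "?\<pi> c x \<in> carrier M" using lhomD(3)[OF \<pi>[OF bc(2)] x] obc by simp
    have "f (?\<pi> c x) = ?\<pi> a x"
      using comp[OF abc(1) bc(2) abc(5) x] Ua Uc by (simp add: ar_def)
    also have "\<dots> = ar a b (?\<pi> b x)" using comp[OF abc(1) bc(1) abc(4) x] by simp
    also have "\<dots> = \<zero>\<^bsub>N\<^esub>"
      using bc(3) lhomD(3)[OF \<pi>[OF bc(1)] x] obc by (simp add: ar_def)
    finally have "f (?\<pi> c x) = f \<zero>\<^bsub>M\<^esub>"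
      using module_hom_zero_minus(1)[OF M N lhomD(1)[OF f]] by simp
    then have "?\<pi> c x = \<zero>\<^bsub>ob c\<^esub>"
      unfolding obc using inj_onD[OF inj _ xc M.zero_closed] by blast
    then have "?\<pi> p x = ar p c \<zero>\<^bsub>ob c\<^esub>" using comp[OF p bc(2) True x] by simp
    then show ?thesis using module_hom_zero_minus(1)[OF ob ob lhomD(1)[OF ar[OF True]]] by simp
  qed
  have L0: "zero_module ?L"
  proof -
    interpret L: module A ?L by (rule L)
    \<comment> \<open>With all projections zero, the identity and the zero map of \<open>?L\<close>
      solve the same universal problem and so coincide.\<close>
    have "\<exists>!u. u \<in> lhom A ?L ?L \<and> (\<forall>p\<in>P. compose (carrier ?L) (?\<pi> p) u = ?\<pi> p)"
      using lim unfolding limit_cone_def prod.case by blast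
    moreover have "compose (carrier ?L) (?\<pi> p) (lid ?L) = ?\<pi> p"
      "compose (carrier ?L) (?\<pi> p) (lzero ?L ?L) = ?\<pi> p" if p: "p \<in> P" for p
      by (rule compose_lhom_eqI[OF L _ \<pi>[OF p] \<pi>[OF p]];
          use \<pi>_zero[OF p] lid_lhom[OF L] lzero_lhom[OF L L] in simp)+
    ultimately have "lid ?L = lzero ?L ?L" using lid_lhom[OF L] lzero_lhom[OF L L] by blast
    then have "x = \<zero>\<^bsub>?L\<^esub>" if "x \<in> carrier ?L" for x using that by (metis restrict_apply')
    then show ?thesis using L.zero_closed unfolding zero_module_def by blast
  qed
  let ?D = "apply_system T G"
  let ?C = "colim_ob A P ?D" and ?\<iota> = "colim_inj A P ?D"
  note D = apply_system_direct[OF G]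
  have D_simps: "sob ?D p = fob T (ob p)" "sar ?D p q = far T (ob q) (ob p) (ar p q)" for p q
    by (simp_all add: apply_system_def)
  have colim: "colimit_cocone A P ?D (?C, ?\<iota>)"
    by (rule colim_ob_colimit_cocone[OF cring inf(2) P D])
  then have C: "module A ?C" and \<iota>: "\<And>p. p \<in> P \<Longrightarrow> ?\<iota> p \<in> lhom A (fob T (ob p)) ?C"
    by (auto simp: colimit_cocone_def cocone_def D_simps)
  obtain \<theta> where "\<theta> \<in> liso A ?C (fob T ?L)"
    using eqv G unfolding colim_lim_equivalence_def by blast
  then have "bij_betw \<theta> (carrier ?C) (carrier (fob T ?L))" by (simp add: liso_def)
  moreover have "carrier (fob T ?L) = {\<zero>\<^bsub>fob T ?L\<^esub>}"
    using T_zero_module[OF L L0] by (simp add: zero_module_def)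
  ultimately have inj\<theta>: "inj_on \<theta> (carrier ?C)" "\<And>x. x \<in> carrier ?C \<Longrightarrow> \<theta> x = \<zero>\<^bsub>fob T ?L\<^esub>"
    by (auto simp: bij_betw_def)
  have C0: "x = \<zero>\<^bsub>?C\<^esub>" if "x \<in> carrier ?C" for x
  proof -
    interpret C: module A ?C by (rule C)
    show ?thesis using inj_onD[OF inj\<theta>(1) _ that C.zero_closed] inj\<theta>(2) that by simp
  qed
  let ?Tf = "far T M N f"
  note Tf = T_hom[OF M N f]
  \<comment> \<open>\<open>Q\<close> is the cokernel of \<open>T f\<close>; it suffices to show that
    the projection \<open>\<kappa>\<close> is zero.\<close>
  obtain Q :: "('a, 'n) module" and \<kappa> where Q: "module A Q" and \<kappa>: "\<kappa> \<in> lhom A (fob T M) Q"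
    "\<And>y. y \<in> carrier (fob T M) \<Longrightarrow> \<kappa> y = \<zero>\<^bsub>Q\<^esub> \<longleftrightarrow> y \<in> ?Tf ` carrier (fob T N)"
  proof -
    have "\<exists>(Q :: ('a, 'n) module) \<kappa>. module A Q \<and> \<kappa> \<in> lhom A (fob T M) Q \<and>
        \<kappa> ` carrier (fob T M) = carrier Q \<and>
        (\<forall>y\<in>carrier (fob T M). \<kappa> y = \<zero>\<^bsub>Q\<^esub> \<longleftrightarrow> y \<in> ?Tf ` carrier (fob T N))"
      by (rule ex_quotient[OF T_module[OF M] image_submodule[OF T_module[OF N] T_module[OF M] Tf(1)] inj_on_id2])
    then show ?thesis using that by (elim exE conjE) simp
  qed
  \<comment> \<open>The cocone is \<open>\<kappa>\<close> on the \<open>M\<close>-part and zero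
    elsewhere. Where an arrow passes from the \<open>N\<close>-part to the \<open>M\<close>-part its
    image under \<open>T\<close> is \<open>T f\<close>, which \<open>\<kappa>\<close> kills.\<close>
  define \<zeta> where "\<zeta> p = (if p \<le> c \<and> \<not> U p then \<kappa> else lzero (fob T (ob p)) Q)" for p
  have \<zeta>: "\<zeta> p \<in> lhom A (fob T (ob p)) Q" for p
    using \<kappa>(1) lzero_lhom[OF T_module[OF ob] Q] by (simp add: \<zeta>_def ob_def)
  have "cocone A P ?D Q \<zeta>"
    unfolding cocone_def D_simps
  proof (intro conjI ballI impI Q \<zeta>)
    fix p q assume pq: "p \<in> P" "q \<in> P" "p \<le> q"
    show "compose (carrier (fob T (ob p))) (\<zeta> q) (far T (ob q) (ob p) (ar p q)) = \<zeta> p"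
    proof (rule compose_lhom_eqI[OF T_module[OF ob] T_lhom[OF ob ob ar[OF pq(3)]] \<zeta> \<zeta>])
      fix y assume y: "y \<in> carrier (fob T (ob p))"
      note Tc = T_hom(3)[OF ob ob ar[OF pq(3)] y]
      show "\<zeta> q (far T (ob q) (ob p) (ar p q) y) = \<zeta> p y"
      proof (cases "q \<le> c \<and> \<not> U q")
        case True
        then have le: "p \<le> c" using pq by auto
        show ?thesis
        proof (cases "U p")
          case True': True
          then have "ob q = M" "ob p = N" "ar p q = f" using True le by (simp_all add: ob_def ar_def)
          then show ?thesis using True True' y Tf(3) \<kappa>(2) by (auto simp: \<zeta>_def)
        next
          case False
          then have "ob q = M" "ob p = M" "ar p q = lid M" using True le by (simp_all add: ob_def ar_def)
          then show ?thesis using True False le y T_id[OF M] by (simp add: \<zeta>_def)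
        qed
      next
        case False
        \<comment> \<open>The \<open>M\<close>-part is closed upwards in \<open>P\<close>: above one
          of its elements everything is below \<open>c\<close>, and \<open>U\<close> fails
          there.\<close>
        have "\<not> (p \<le> c \<and> \<not> U p)" using False Udown[OF pq(3)] pq unfolding U_def by blast
        then show ?thesis using False y Tc by (auto simp: \<zeta>_def)
      qed
    qed
  qed
  then obtain u where u: "u \<in> lhom A ?C Q" "\<And>p. p \<in> P \<Longrightarrow> compose (carrier (sob ?D p)) u (?\<iota> p) = \<zeta> p"
    using colim unfolding colimit_cocone_def by blast
  show "?Tf ` carrier (fob T N) = carrier (fob T M)"
  proof
    show "carrier (fob T M) \<subseteq> ?Tf ` carrier (fob T N)"
    proof
      fix y assume y: "y \<in> carrier (fob T M)"
      have obc: "ob c = M" using Uc by (simp add: ob_def)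
      \<comment> \<open>\<open>\<kappa>\<close> is the component of the cocone at \<open>c\<close>,
        so it factors through the colimit, which is zero.\<close>
      have "\<kappa> y = u (?\<iota> c y)"
        using composeD[OF u(2)[OF bc(2)]] y obc Uc by (simp add: D_simps \<zeta>_def)
      also have "?\<iota> c y = \<zero>\<^bsub>?C\<^esub>" using C0 lhomD(3)[OF \<iota>[OF bc(2)]] y obc by simp
      also have "u \<zero>\<^bsub>?C\<^esub> = \<zero>\<^bsub>Q\<^esub>" by (rule module_hom_zero_minus(1)[OF C Q lhomD(1)[OF u(1)]])
      finally show "y \<in> ?Tf ` carrier (fob T N)" using \<kappa>(2)[OF y] by simp
    qed
  qed (use Tf(3) in auto)
qed

text \<open>When all maps between different elements vanish, an object that is not maximal is sent
  to zero in the colimit, since its injection factors through such a map; the maximal objects are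
  unconstrained.\<close>

lemma T_lim_if_zero_maps:
  fixes G :: "('p::order, 'a, 'm) system"
  assumes P: "finite P" and G: "inverse_system A P G" and eqv: "colim_lim_equivalence A P T"
    and zero: "\<And>p q y. p \<in> P \<Longrightarrow> q \<in> P \<Longrightarrow> p \<le> q \<Longrightarrow> p \<noteq> q \<Longrightarrow> y \<in> carrier (fob T (sob G p)) \<Longrightarrow>
      far T (sob G q) (sob G p) (sar G p q) y = \<zero>\<^bsub>fob T (sob G q)\<^esub>"
  shows "isom A (fob T (lim_ob A P G)) (finite_direct_sum (maximal_elements P) (\<lambda>q. fob T (sob G q)))"
proof -
  let ?M = "maximal_elements P" and ?D = "apply_system T G"
  let ?C = "colim_ob A P ?D" and ?\<iota> = "colim_inj A P ?D"
  note G' = inverse_systemD[OF G] and D = apply_system_direct[OF G]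
  have D_simps [simp]: "sob ?D p = fob T (sob G p)" "sar ?D p q = far T (sob G q) (sob G p) (sar G p q)" for p q
    by (simp_all add: apply_system_def)
  have TG: "module A (fob T (sob G p))" if "p \<in> P" for p using T_module[OF G'(1)[OF that]] .
  have M: "i \<in> P" "\<And>r. r \<in> P \<Longrightarrow> i \<le> r \<Longrightarrow> r = i" if "i \<in> ?M" for i
    using that by (auto simp: maximal_elements_def)
  have finM: "finite ?M" using P by (simp add: maximal_elements_def)
  have colim: "colimit_cocone A P ?D (?C, ?\<iota>)"
    by (rule colim_ob_colimit_cocone[OF cring inf(2) P D])
  then have C: "module A ?C" and \<iota>: "\<And>p. p \<in> P \<Longrightarrow> ?\<iota> p \<in> lhom A (fob T (sob G p)) ?C"
    and comp: "\<And>p q y. p \<in> P \<Longrightarrow> q \<in> P \<Longrightarrow> p \<le> q \<Longrightarrow> y \<in> carrier (fob T (sob G p)) \<Longrightarrow>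
      ?\<iota> q (sar ?D p q y) = ?\<iota> p y"
    by (auto simp: colimit_cocone_def cocone_def dest: composeD)
  interpret C: module A ?C by (rule C)
  \<comment> \<open>The components of the projection onto the summand at \<open>i\<close>. They form
    a cocone because \<open>i\<close> is maximal and the maps arriving at it from other elements are
    zero.\<close>
  define \<xi> where "\<xi> i p = (if p = i then lid (fob T (sob G i)) else lzero (fob T (sob G p)) (fob T (sob G i)))" for i p
  have \<xi>: "\<xi> i p \<in> lhom A (fob T (sob G p)) (fob T (sob G i))" if "i \<in> P" "p \<in> P" for i p
    unfolding \<xi>_def using that lid_lhom[OF TG] lzero_lhom[OF TG TG] by simp
  have cocone: "cocone A P ?D (fob T (sob G i)) (\<xi> i)" if i: "i \<in> ?M" for i
    unfolding cocone_def D_simps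
  proof (intro conjI ballI impI TG \<xi> M(1)[OF i])
    fix p q assume pq: "p \<in> P" "q \<in> P" "p \<le> q"
    note i' = M(1)[OF i]
    show "compose (carrier (fob T (sob G p))) (\<xi> i q) (far T (sob G q) (sob G p) (sar G p q)) = \<xi> i p"
    proof (rule compose_lhom_eqI[OF TG[OF pq(1)] T_lhom[OF G'(1)[OF pq(2)] G'(1)[OF pq(1)] G'(3)[OF pq]]
          \<xi>[OF i' pq(2)] \<xi>[OF i' pq(1)]])
      fix y assume y: "y \<in> carrier (fob T (sob G p))"
      show "\<xi> i q (far T (sob G q) (sob G p) (sar G p q) y) = \<xi> i p y"
      proof (cases "p = q")
        case True
        then show ?thesis using T_id[OF G'(1)[OF pq(1)] y] G'(2)[OF pq(1)] by simp
      next
        case False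
        have "p \<noteq> i" using False M(2)[OF i pq(2)] pq(3) by auto
        then show ?thesis
          using zero[OF pq False y] y module_hom_zero_minus(1)[OF TG[OF pq(2)] TG[OF i'] lhomD(1)[OF \<xi>[OF i' pq(2)]]]
          by (simp add: \<xi>_def)
      qed
    qed
  qed
  have "\<forall>i\<in>?M. \<exists>u. u \<in> lhom A ?C (fob T (sob G i)) \<and>
      (\<forall>p\<in>P. compose (carrier (sob ?D p)) u (?\<iota> p) = \<xi> i p)"
    using colim cocone unfolding colimit_cocone_def by blast
  then obtain a where a: "\<And>i. i \<in> ?M \<Longrightarrow> a i \<in> lhom A ?C (fob T (sob G i))"
    "\<And>i p. i \<in> ?M \<Longrightarrow> p \<in> P \<Longrightarrow> compose (carrier (sob ?D p)) (a i) (?\<iota> p) = \<xi> i p" by metis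
  have a\<iota>: "a i (?\<iota> p y) = \<xi> i p y" if "i \<in> ?M" "p \<in> P" "y \<in> carrier (fob T (sob G p))" for i p y
    using composeD[OF a(2)[OF that(1,2)]] that(3) by simp
  have "isom A ?C (finite_direct_sum ?M (\<lambda>q. fob T (sob G q)))"
  proof (rule isom_biproduct[OF C finM, where p = a and q = ?\<iota>])
    fix i k y assume "i \<in> ?M" "k \<in> ?M" "y \<in> carrier (fob T (sob G i))"
    then show "a k (?\<iota> i y) = (if k = i then y else \<zero>\<^bsub>fob T (sob G k)\<^esub>)"
      using a\<iota> M(1) by (auto simp: \<xi>_def)
  next
    fix x assume x: "x \<in> carrier ?C"
    let ?f = "\<lambda>i. compose (carrier ?C) (?\<iota> i) (a i)"
    let ?s = "\<lambda>x\<in>carrier ?C. \<Oplus>\<^bsub>?C\<^esub>i\<in>?M. ?f i x"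
    have f: "?f i \<in> lhom A ?C ?C" if "i \<in> ?M" for i
      by (rule compose_lhom[OF C a(1)[OF that] \<iota>[OF M(1)[OF that]]])
    have s: "?s \<in> lhom A ?C ?C" by (rule finsum_lhom[OF C C finM f])
    note s0 = module_hom_zero_minus(1)[OF C C lhomD(1)[OF s]]
    have "compose (carrier (sob ?D p)) ?s (?\<iota> p) = ?\<iota> p" if p: "p \<in> P" for p
      unfolding D_simps
    proof (rule compose_lhom_eqI[OF TG[OF p] \<iota>[OF p] s \<iota>[OF p]])
      fix y assume y: "y \<in> carrier (fob T (sob G p))"
      have \<iota>y: "?\<iota> p y \<in> carrier ?C" using lhomD(3)[OF \<iota>[OF p] y] .
      show "?s (?\<iota> p y) = ?\<iota> p y"
      proof (cases "p \<in> ?M")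
        case True
        have "(\<Oplus>\<^bsub>?C\<^esub>i\<in>?M. ?f i (?\<iota> p y)) = ?\<iota> p y"
        proof (rule finsum_single[OF C finM True \<iota>y])
          show "?f p (?\<iota> p y) = ?\<iota> p y" using \<iota>y a\<iota>[OF True p y] y by (simp add: compose_eq \<xi>_def)
          show "?f i (?\<iota> p y) = \<zero>\<^bsub>?C\<^esub>" if "i \<in> ?M" "i \<noteq> p" for i
            using \<iota>y a\<iota>[OF that(1) p y] y that(2)
              module_hom_zero_minus(1)[OF TG[OF M(1)[OF that(1)]] C lhomD(1)[OF \<iota>[OF M(1)[OF that(1)]]]]
            by (simp add: compose_eq \<xi>_def)
        qed
        then show ?thesis using \<iota>y by simp
      next
        case False
        \<comment> \<open>A strictly larger element exists, and the injection at \<open>p\<close>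
          passes through the zero map to it.\<close>
        then obtain q where q: "q \<in> P" "p \<le> q" "p \<noteq> q" using p by (auto simp: maximal_elements_def)
        have "?\<iota> p y = ?\<iota> q \<zero>\<^bsub>fob T (sob G q)\<^esub>"
          using comp[OF p q(1,2) y] zero[OF p q y] by simp
        also have "\<dots> = \<zero>\<^bsub>?C\<^esub>" by (rule module_hom_zero_minus(1)[OF TG[OF q(1)] C lhomD(1)[OF \<iota>[OF q(1)]]])
        finally show ?thesis using s0 by (simp only:)
      qed
    qed
    moreover have "compose (carrier (sob ?D p)) (lid ?C) (?\<iota> p) = ?\<iota> p" if p: "p \<in> P" for p
      unfolding D_simps
      by (rule compose_lhom_eqI[OF TG[OF p] \<iota>[OF p] lid_lhom[OF C] \<iota>[OF p]]) (use lhomD(3)[OF \<iota>[OF p]] in simp)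
    moreover have "\<exists>!u. u \<in> lhom A ?C ?C \<and> (\<forall>p\<in>P. compose (carrier (sob ?D p)) u (?\<iota> p) = ?\<iota> p)"
      using colim unfolding colimit_cocone_def prod.case by blast
    ultimately have "?s = lid ?C" using s lid_lhom[OF C] by blast
    then have "?s x = x" using x by (simp only: restrict_apply if_True)
    moreover have "(\<Oplus>\<^bsub>?C\<^esub>i\<in>?M. ?\<iota> i (a i x)) = ?s x"
      using x lhomD(3)[OF f] by (auto simp: compose_eq intro!: C.finsum_cong')
    ultimately show "(\<Oplus>\<^bsub>?C\<^esub>i\<in>?M. ?\<iota> i (a i x)) = x" by simp
  qed (use M(1) TG lhomD(1)[OF a(1)] lhomD(1)[OF \<iota>] in auto)
  moreover obtain \<theta> where "\<theta> \<in> liso A ?C (fob T (lim_ob A P G))"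
    using eqv G unfolding colim_lim_equivalence_def by blast
  then have "isom A ?C (fob T (lim_ob A P G))" by (auto simp: liso_def lhom_def isom_def)
  ultimately show ?thesis using isom_trans[OF isom_sym[OF C]] by blast
qed

end

section \<open>Reduced homology of cones\<close>

text \<open>The cofaces of \<open>ys\<close> together with the deleted position: the index set of
  the sum that gives the coefficient of a boundary at \<open>ys\<close>.\<close>

definition faces :: "'p::order set \<Rightarrow> int \<Rightarrow> 'p list \<Rightarrow> ('p list \<times> nat) set" where
  "faces Q n ys = {(xs, i). xs \<in> simplices Q n \<and> i < length xs \<and> take i xs @ drop (Suc i) xs = ys}"

abbreviation (input) minus_one_pow :: "'a ring \<Rightarrow> nat \<Rightarrow> 'a" where
  "minus_one_pow k i \<equiv> (\<ominus>\<^bsub>k\<^esub> \<one>\<^bsub>k\<^esub>) [^]\<^bsub>k\<^esub> i"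

lemma boundary_faces:
  "boundary k Q n c = (\<lambda>ys\<in>simplices Q (n - 1). \<Oplus>\<^bsub>k\<^esub>e\<in>faces Q n ys. minus_one_pow k (snd e) \<otimes>\<^bsub>k\<^esub> c (fst e))"
  by (simp add: boundary_def faces_def)

section \<open>The augmented chain complex as a complex of modules\<close>

lemma finite_simplices:
  assumes "finite Q" shows "finite (simplices Q n)"
proof (rule finite_subset)
  show "simplices Q n \<subseteq> {xs. set xs \<subseteq> Q \<and> length xs = nat (n + 1)}" by (auto simp: simplices_def)
qed (rule finite_lists_length_eq[OF assms])

lemma finite_faces: "finite Q \<Longrightarrow> finite (faces Q n ys)"
proof (rule finite_subset)
  show "faces Q n ys \<subseteq> simplices Q n \<times> {..<nat (n + 1)}" by (auto simp: faces_def simplices_def)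
qed (simp add: finite_simplices)

lemma chain_space_sel:
  assumes "cring k"
  shows "carrier (chain_space k Q n) = simplices Q n \<rightarrow>\<^sub>E carrier k"
    "\<zero>\<^bsub>chain_space k Q n\<^esub> = (\<lambda>xs\<in>simplices Q n. \<zero>\<^bsub>k\<^esub>)"
    "c \<oplus>\<^bsub>chain_space k Q n\<^esub> d = (\<lambda>xs\<in>simplices Q n. c xs \<oplus>\<^bsub>k\<^esub> d xs)"
    "a \<odot>\<^bsub>chain_space k Q n\<^esub> c = (\<lambda>xs\<in>simplices Q n. a \<otimes>\<^bsub>k\<^esub> c xs)"
proof -
  interpret cring k by fact
  show "carrier (chain_space k Q n) = simplices Q n \<rightarrow>\<^sub>E carrier k"
    "\<zero>\<^bsub>chain_space k Q n\<^esub> = (\<lambda>xs\<in>simplices Q n. \<zero>\<^bsub>k\<^esub>)"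
    "c \<oplus>\<^bsub>chain_space k Q n\<^esub> d = (\<lambda>xs\<in>simplices Q n. c xs \<oplus>\<^bsub>k\<^esub> d xs)"
    "a \<odot>\<^bsub>chain_space k Q n\<^esub> c = (\<lambda>xs\<in>simplices Q n. a \<otimes>\<^bsub>k\<^esub> c xs)"
    by (simp_all only: chain_space_def func_space_def module.simps partial_object.simps ring.simps)
qed

lemma chain_space_module: "cring k \<Longrightarrow> module k (chain_space k Q n)"
  unfolding chain_space_def by (rule cring.func_space_is_module)

lemma boundary_hom:
  assumes "cring k" "finite Q"
  shows "boundary k Q n \<in> module_hom k (chain_space k Q n) (chain_space k Q (n - 1))"
proof -
  interpret k: cring k by fact
  note sel = chain_space_sel[OF assms(1)]
  have s: "minus_one_pow k i \<in> carrier k" for i by simp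
  have fc: "fst e \<in> simplices Q n" if "e \<in> faces Q n ys" for e ys using that by (auto simp: faces_def)
  have c: "c (fst e) \<in> carrier k" if "c \<in> carrier (chain_space k Q n)" "e \<in> faces Q n ys" for c e ys
    using that(1) fc[OF that(2)] by (auto simp: sel)
  note fin = finite_faces[OF assms(2)]
  show ?thesis
  proof (rule module_homI)
    fix c assume c': "c \<in> carrier (chain_space k Q n)"
    show "boundary k Q n c \<in> carrier (chain_space k Q (n - 1))"
      unfolding boundary_faces sel restrict_PiE_iff
      by (intro ballI k.finsum_closed Pi_I k.m_closed s c[OF c'])
  next
    fix c d assume c': "c \<in> carrier (chain_space k Q n)" and d': "d \<in> carrier (chain_space k Q n)"
    show "boundary k Q n (c \<oplus>\<^bsub>chain_space k Q n\<^esub> d) =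
        boundary k Q n c \<oplus>\<^bsub>chain_space k Q (n - 1)\<^esub> boundary k Q n d"
      unfolding boundary_faces sel(3)
    proof (rule restrict_ext)
      fix ys assume ys: "ys \<in> simplices Q (n - 1)"
      have "(\<Oplus>\<^bsub>k\<^esub>e\<in>faces Q n ys. minus_one_pow k (snd e) \<otimes>\<^bsub>k\<^esub> (\<lambda>xs\<in>simplices Q n. c xs \<oplus>\<^bsub>k\<^esub> d xs) (fst e)) =
          (\<Oplus>\<^bsub>k\<^esub>e\<in>faces Q n ys. minus_one_pow k (snd e) \<otimes>\<^bsub>k\<^esub> c (fst e) \<oplus>\<^bsub>k\<^esub> minus_one_pow k (snd e) \<otimes>\<^bsub>k\<^esub> d (fst e))"
        by (rule k.finsum_cong') (use fc c[OF c'] c[OF d'] in \<open>auto simp: k.r_distr\<close>)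
      also have "\<dots> = (\<Oplus>\<^bsub>k\<^esub>e\<in>faces Q n ys. minus_one_pow k (snd e) \<otimes>\<^bsub>k\<^esub> c (fst e)) \<oplus>\<^bsub>k\<^esub>
          (\<Oplus>\<^bsub>k\<^esub>e\<in>faces Q n ys. minus_one_pow k (snd e) \<otimes>\<^bsub>k\<^esub> d (fst e))"
        by (rule k.finsum_addf) (use c[OF c'] c[OF d'] in auto)
      finally show "(\<Oplus>\<^bsub>k\<^esub>e\<in>faces Q n ys. minus_one_pow k (snd e) \<otimes>\<^bsub>k\<^esub> (\<lambda>xs\<in>simplices Q n. c xs \<oplus>\<^bsub>k\<^esub> d xs) (fst e)) =
          (\<lambda>ys\<in>simplices Q (n - 1). \<Oplus>\<^bsub>k\<^esub>e\<in>faces Q n ys. minus_one_pow k (snd e) \<otimes>\<^bsub>k\<^esub> c (fst e)) ys \<oplus>\<^bsub>k\<^esub>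
          (\<lambda>ys\<in>simplices Q (n - 1). \<Oplus>\<^bsub>k\<^esub>e\<in>faces Q n ys. minus_one_pow k (snd e) \<otimes>\<^bsub>k\<^esub> d (fst e)) ys"
        using ys by simp
    qed
  next
    fix a c assume a: "a \<in> carrier k" and c': "c \<in> carrier (chain_space k Q n)"
    show "boundary k Q n (a \<odot>\<^bsub>chain_space k Q n\<^esub> c) = a \<odot>\<^bsub>chain_space k Q (n - 1)\<^esub> boundary k Q n c"
      unfolding boundary_faces sel(4)
    proof (rule restrict_ext)
      fix ys assume ys: "ys \<in> simplices Q (n - 1)"
      have "(\<Oplus>\<^bsub>k\<^esub>e\<in>faces Q n ys. minus_one_pow k (snd e) \<otimes>\<^bsub>k\<^esub> (\<lambda>xs\<in>simplices Q n. a \<otimes>\<^bsub>k\<^esub> c xs) (fst e)) =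
          (\<Oplus>\<^bsub>k\<^esub>e\<in>faces Q n ys. a \<otimes>\<^bsub>k\<^esub> (minus_one_pow k (snd e) \<otimes>\<^bsub>k\<^esub> c (fst e)))"
        by (rule k.finsum_cong') (use fc c[OF c'] a in \<open>auto simp: k.m_lcomm\<close>)
      also have "\<dots> = a \<otimes>\<^bsub>k\<^esub> (\<Oplus>\<^bsub>k\<^esub>e\<in>faces Q n ys. minus_one_pow k (snd e) \<otimes>\<^bsub>k\<^esub> c (fst e))"
        by (rule k.finsum_rdistr[symmetric]) (use fin a c[OF c'] in auto)
      finally show "(\<Oplus>\<^bsub>k\<^esub>e\<in>faces Q n ys. minus_one_pow k (snd e) \<otimes>\<^bsub>k\<^esub> (\<lambda>xs\<in>simplices Q n. a \<otimes>\<^bsub>k\<^esub> c xs) (fst e)) =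
          a \<otimes>\<^bsub>k\<^esub> (\<lambda>ys\<in>simplices Q (n - 1). \<Oplus>\<^bsub>k\<^esub>e\<in>faces Q n ys. minus_one_pow k (snd e) \<otimes>\<^bsub>k\<^esub> c (fst e)) ys"
        using ys by simp
    qed
  qed
qed

lemma boundaries_submodule:
  assumes "cring k" "finite Q"
  shows "submodule k (boundary k Q (n + 1) ` carrier (chain_space k Q (n + 1))) (chain_space k Q n)"
  using image_submodule[OF chain_space_module[OF assms(1)] chain_space_module[OF assms(1)] boundary_hom[OF assms]]
  by (metis add_diff_cancel_right')

lemma cycles_submodule:
  assumes "cring k" "finite Q"
  shows "submodule k (lker (chain_space k Q n) (chain_space k Q (n - 1)) (boundary k Q n)) (chain_space k Q n)"
  by (intro lker_submodule chain_space_module boundary_hom assms)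

lemma reduced_homology_vectorspace:
  assumes "field k" "finite Q" shows "vectorspace k (reduced_homology k Q n)"
proof -
  interpret k: field k by fact
  show ?thesis
    unfolding reduced_homology_def vectorspace_def
    by (intro conjI assms(1) subquot_module boundaries_submodule cycles_submodule fieldE(1)[OF assms(1)] assms(2))
qed

section \<open>Vanishing of reduced homology and the values in degree -1\<close>

lemma reduced_betti_eq_0:
  assumes "field k" "finite Q"
    and "\<And>c. c \<in> carrier (chain_space k Q n) \<Longrightarrow> boundary k Q n c = \<zero>\<^bsub>chain_space k Q (n - 1)\<^esub> \<Longrightarrow>
      c \<in> boundary k Q (n + 1) ` carrier (chain_space k Q (n + 1))"
  shows "reduced_betti k Q n = 0"
proof -
  interpret V: vectorspace k "reduced_homology k Q n" by (rule reduced_homology_vectorspace[OF assms(1,2)])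
  interpret k: field k by fact
  let ?B = "boundary k Q (n + 1) ` carrier (chain_space k Q (n + 1))"
  note B = boundaries_submodule[OF fieldE(1)[OF assms(1)] assms(2), of n]
  have "x = \<zero>\<^bsub>reduced_homology k Q n\<^esub>" if x: "x \<in> carrier (reduced_homology k Q n)" for x
  proof -
    obtain c where c: "c \<in> carrier (chain_space k Q n)" "boundary k Q n c = \<zero>\<^bsub>chain_space k Q (n - 1)\<^esub>"
      "x = ?B +>\<^bsub>chain_space k Q n\<^esub> c"
    proof -
      have "x \<in> (\<lambda>c. ?B +>\<^bsub>chain_space k Q n\<^esub> c) ` lker (chain_space k Q n) (chain_space k Q (n - 1)) (boundary k Q n)"
        using x unfolding reduced_homology_def subquot_sel .
      then obtain d where "x = ?B +>\<^bsub>chain_space k Q n\<^esub> d"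
        "d \<in> lker (chain_space k Q n) (chain_space k Q (n - 1)) (boundary k Q n)" by (rule imageE)
      then show ?thesis using that[of d] by (simp add: lker_def)
    qed
    then show ?thesis
      unfolding reduced_homology_def subquot_sel c(3) coset_eq_zero_iff[OF B c(1)] using assms(3) by blast
  qed
  then have car: "carrier (reduced_homology k Q n) = {\<zero>\<^bsub>reduced_homology k Q n\<^esub>}"
    using V.zero_closed by blast
  have "V.span {\<zero>\<^bsub>reduced_homology k Q n\<^esub>} = carrier (reduced_homology k Q n)"
    using V.span_is_subset2[of "{\<zero>\<^bsub>reduced_homology k Q n\<^esub>}"] V.in_own_span[of "{\<zero>\<^bsub>reduced_homology k Q n\<^esub>}"] car
    by auto
  then show ?thesis unfolding reduced_betti_def by (rule V.dim0I)
qed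

lemma reduced_betti_no_simplices:
  assumes "field k" "finite Q" "simplices Q n = {}" shows "reduced_betti k Q n = 0"
proof (rule reduced_betti_eq_0[OF assms(1,2)])
  interpret k: field k by fact
  interpret B: submodule k "boundary k Q (n + 1) ` carrier (chain_space k Q (n + 1))" "chain_space k Q n"
    by (rule boundaries_submodule[OF fieldE(1)[OF assms(1)] assms(2)])
  fix c assume "c \<in> carrier (chain_space k Q n)"
  then have "c = \<zero>\<^bsub>chain_space k Q n\<^esub>"
    unfolding chain_space_sel[OF fieldE(1)[OF assms(1)]] assms(3) PiE_empty_domain singleton_iff
    by (simp add: restrict_def)
  then show "c \<in> boundary k Q (n + 1) ` carrier (chain_space k Q (n + 1))" using B.zero_closed by simp
qed

lemma simplices_empty_iff: "n < - 1 \<Longrightarrow> simplices Q n = {}" "n \<noteq> - 1 \<Longrightarrow> simplices {} n = {}"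
  by (auto simp: simplices_def)

lemma simplices_minus_one: "simplices Q (- 1) = {[]}"
  by (auto simp: simplices_def)

text \<open>The empty chain is the only simplex, so the complex is one-dimensional in degree
  \<open>-1\<close> and zero elsewhere. This yields multiplicity one for a maximal element
  \<open>q\<close> with \<open>h q = j\<close>.\<close>

lemma reduced_betti_empty:
  assumes "field k" shows "reduced_betti k ({} :: 'p::order set) n = (if n = - 1 then 1 else 0)"
proof (cases "n = - 1")
  case False
  then show ?thesis using reduced_betti_no_simplices[OF assms finite.emptyI simplices_empty_iff(2)] by simp
next
  case True
  interpret k: field k by fact
  let ?E = "{} :: 'p set"
  let ?C = "\<lambda>n. chain_space k ?E n" and ?H = "reduced_homology k ?E (- 1)"
  interpret V: vectorspace k ?H by (rule reduced_homology_vectorspace[OF assms finite.emptyI])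
  note sel = chain_space_sel[OF fieldE(1)[OF assms(1)]]
  let ?B = "boundary k ?E (- 1 + 1) ` carrier (?C (- 1 + 1))"
  note B = boundaries_submodule[OF fieldE(1)[OF assms(1)] finite.emptyI, of "- 1"]
  have "boundary k ?E (- 1 + 1) c = \<zero>\<^bsub>?C (- 1)\<^esub>" for c
  proof -
    have "simplices ?E 0 = {}" by (rule simplices_empty_iff) simp
    then have "faces ?E 0 ys = {}" for ys by (simp add: faces_def)
    then show ?thesis by (simp add: boundary_faces sel)
  qed
  then have B0: "\<And>b. b \<in> ?B \<Longrightarrow> b = \<zero>\<^bsub>?C (- 1)\<^esub>" by auto
  have "boundary k ?E (- 1) c = \<zero>\<^bsub>?C (- 1 - 1)\<^esub>" for c
    unfolding boundary_faces sel by (intro restrict_ext) (simp add: simplices_empty_iff)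
  then have Z: "carrier ?H = (\<lambda>c. ?B +>\<^bsub>?C (- 1)\<^esub> c) ` carrier (?C (- 1))"
    by (auto simp: reduced_homology_def lker_def)
  define u where "u = (\<lambda>xs\<in>simplices ?E (- 1). \<one>\<^bsub>k\<^esub>)"
  have u: "u \<in> carrier (?C (- 1))" by (simp add: u_def sel)
  let ?v = "?B +>\<^bsub>?C (- 1)\<^esub> u"
  have v: "?v \<in> carrier ?H" using u Z by blast
  have "?v \<noteq> \<zero>\<^bsub>?H\<^esub>"
  proof
    assume "?v = \<zero>\<^bsub>?H\<^esub>"
    then have "u \<in> ?B" using coset_eq_zero_iff[OF B u] by (simp add: reduced_homology_def)
    then have "u [] = \<zero>\<^bsub>?C (- 1)\<^esub> []" using B0 by metis
    then show False by (simp add: u_def sel simplices_minus_one)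
  qed
  moreover have "V.span {?v} = carrier ?H"
  proof
    show "V.span {?v} \<subseteq> carrier ?H" using v by (intro V.span_is_subset2) simp
    show "carrier ?H \<subseteq> V.span {?v}"
    proof
      fix x assume "x \<in> carrier ?H"
      then obtain c where c: "c \<in> carrier (?C (- 1))" "x = ?B +>\<^bsub>?C (- 1)\<^esub> c" using Z by blast
      have c0: "c [] \<in> carrier k" using c(1) by (auto simp: sel simplices_minus_one)
      have "c = c [] \<odot>\<^bsub>?C (- 1)\<^esub> u"
        unfolding sel(4) simplices_minus_one
        by (rule extensionalityI[of _ "{[]}"])
          (use c(1) c0 in \<open>auto simp: sel u_def simplices_minus_one PiE_def\<close>)
      then have "x = c [] \<odot>\<^bsub>?H\<^esub> ?v"
        using subquot_ops(2)[OF B u c0] c(2) by (simp add: reduced_homology_def)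
      moreover have "?v \<in> V.span {?v}" using V.in_own_span[of "{?v}"] v by auto
      moreover have "submodule k (V.span {?v}) ?H" using v by (intro V.span_is_submodule) simp
      ultimately show "x \<in> V.span {?v}" using c0 by (auto dest: submodule.smult_closed)
    qed
  qed
  ultimately have "vectorspace.dim k ?H = 1" using V.dim1I v by blast
  then show ?thesis using True by (simp add: reduced_betti_def)
qed

text \<open>The augmentation is onto as soon as there is a vertex: a multiple of the vertex
  \<open>t\<close> bounds the given multiple of the empty chain.\<close>

lemma reduced_betti_minus_one_nonempty:
  assumes "field k" "finite Q" "t \<in> Q" shows "reduced_betti k Q (- 1) = 0"
proof (rule reduced_betti_eq_0[OF assms(1,2)])
  interpret k: field k by fact
  note sel = chain_space_sel[OF fieldE(1)[OF assms(1)]]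
  fix c assume c: "c \<in> carrier (chain_space k Q (- 1))"
  then have c0: "c [] \<in> carrier k" by (auto simp: sel simplices_minus_one)
  define e where "e = (\<lambda>xs\<in>simplices Q 0. if xs = [t] then c [] else \<zero>\<^bsub>k\<^esub>)"
  have e: "e \<in> carrier (chain_space k Q 0)" using c0 by (simp add: sel e_def)
  have t: "[t] \<in> simplices Q 0" using assms(3) by (simp add: simplices_def)
  have "(\<Oplus>\<^bsub>k\<^esub>x\<in>faces Q 0 []. minus_one_pow k (snd x) \<otimes>\<^bsub>k\<^esub> e (fst x)) = c []"
  proof (rule k.finsum_eq_single[OF finite_faces[OF assms(2)] _ c0])
    show "([t], 0) \<in> faces Q 0 []" using t by (simp add: faces_def)
    show "minus_one_pow k (snd ([t], 0 :: nat)) \<otimes>\<^bsub>k\<^esub> e (fst ([t], 0 :: nat)) = c []" using t c0 by (simp add: e_def)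
    show "minus_one_pow k (snd x) \<otimes>\<^bsub>k\<^esub> e (fst x) = \<zero>\<^bsub>k\<^esub>" if "x \<in> faces Q 0 []" "x \<noteq> ([t], 0)" for x
    proof -
      obtain xs i where x: "x = (xs, i)" by (cases x)
      have "xs \<in> simplices Q 0" "i < length xs" "length xs = 1" using that(1) by (auto simp: x faces_def simplices_def)
      then show ?thesis using that(2) by (auto simp: x e_def)
    qed
  qed
  then have "boundary k Q (- 1 + 1) e = c"
    using c by (auto simp: boundary_faces simplices_minus_one sel PiE_def intro!: extensionalityI[of _ "{[]}"])
  then show "c \<in> boundary k Q (- 1 + 1) ` carrier (chain_space k Q (- 1 + 1))" using e by force
qed

text \<open>The contracting homotopy of the cone with apex \<open>t\<close> appends \<open>t\<close> to a simplex.\<close>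

lemma reduced_betti_cone:
  assumes "field k" "finite Q" "t \<in> Q" and top: "\<And>z. z \<in> Q \<Longrightarrow> z \<le> t"
  shows "reduced_betti k Q n = 0"
proof (rule reduced_betti_eq_0[OF assms(1,2)])
  interpret k: field k by fact
  note sel = chain_space_sel[OF fieldE(1)[OF assms(1)]]
  have s: "minus_one_pow k i \<in> carrier k" for i by simp
  have ss: "minus_one_pow k i \<otimes>\<^bsub>k\<^esub> (minus_one_pow k i \<otimes>\<^bsub>k\<^esub> x) = x" if "x \<in> carrier k" for i x
  proof -
    have "minus_one_pow k i \<otimes>\<^bsub>k\<^esub> minus_one_pow k i = ((\<ominus>\<^bsub>k\<^esub> \<one>\<^bsub>k\<^esub>) \<otimes>\<^bsub>k\<^esub> (\<ominus>\<^bsub>k\<^esub> \<one>\<^bsub>k\<^esub>)) [^]\<^bsub>k\<^esub> i"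
      by (rule k.nat_pow_distrib[symmetric]) auto
    also have "\<dots> = \<one>\<^bsub>k\<^esub>" by (simp add: k.l_minus k.r_minus)
    finally show ?thesis using that by (simp flip: k.m_assoc)
  qed
  fix c assume c: "c \<in> carrier (chain_space k Q n)" and cyc: "boundary k Q n c = \<zero>\<^bsub>chain_space k Q (n - 1)\<^esub>"
  have cc: "c xs \<in> carrier k" if "xs \<in> simplices Q n" for xs using c that by (auto simp: sel)
  have snoc: "xs @ [t] \<in> simplices Q (n + 1) \<longleftrightarrow> xs \<in> simplices Q n \<and> t \<notin> set xs" for xs n
    using assms(3) top by (force simp: simplices_def sorted_wrt_append order.strict_iff_order)
  \<comment> \<open>Since \<open>t\<close> is the top of \<open>Q\<close>, it can occur in an
    increasing list only as the last entry.\<close>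
  have last_t: "xs \<noteq> [] \<and> last xs = t" if "xs \<in> simplices Q m" "t \<in> set xs" for xs m
  proof -
    have "xs \<noteq> []" using that(2) by auto
    then obtain ws x where xs: "xs = ws @ [x]" by (cases xs rule: rev_cases) auto
    have "x \<le> t" "\<And>w. w \<in> set ws \<Longrightarrow> w < x" using that top by (auto simp: xs simplices_def sorted_wrt_append)
    then have "t \<notin> set ws" by (meson leD)
    then show ?thesis using that(2) by (auto simp: xs)
  qed
  \<comment> \<open>The chain that extends \<open>c\<close> by the apex. The exponent is the
    position of \<open>t\<close>, so that deleting \<open>t\<close> again gives the square of a
    sign.\<close>
  define e where "e = (\<lambda>xs\<in>simplices Q (n + 1).
    if xs \<noteq> [] \<and> last xs = t then minus_one_pow k (length xs - 1) \<otimes>\<^bsub>k\<^esub> c (butlast xs) else \<zero>\<^bsub>k\<^esub>)"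
  have e_snoc: "e (xs @ [t]) = minus_one_pow k (length xs) \<otimes>\<^bsub>k\<^esub> c xs" if "xs @ [t] \<in> simplices Q (n + 1)" for xs
    using that by (simp add: e_def)
  have e_zero: "e xs = \<zero>\<^bsub>k\<^esub>" if "xs \<in> simplices Q (n + 1)" "t \<notin> set xs" for xs
    using that by (auto simp: e_def dest!: last_in_set)
  have ec: "e xs \<in> carrier k" if xs: "xs \<in> simplices Q (n + 1)" for xs
  proof (cases "t \<in> set xs")
    case True
    then obtain ws where ws: "xs = ws @ [t]" using last_t[OF xs] by (metis append_butlast_last_id)
    then show ?thesis using e_snoc xs snoc[of ws n] cc s by simp
  qed (use xs e_zero in simp)
  have e: "e \<in> carrier (chain_space k Q (n + 1))"
  proof -
    have "e \<in> extensional (simplices Q (n + 1))" unfolding e_def by (rule restrict_extensional)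
    then show ?thesis using ec by (simp add: sel PiE_def Pi_def)
  qed
  have "(\<Oplus>\<^bsub>k\<^esub>x\<in>faces Q (n + 1) ys. minus_one_pow k (snd x) \<otimes>\<^bsub>k\<^esub> e (fst x)) = c ys" if ys: "ys \<in> simplices Q n" for ys
  proof (cases "t \<in> set ys")
    \<comment> \<open>Among the cofaces of \<open>ys\<close> only \<open>ys @ [t]\<close> contains
      the apex; \<open>e\<close> vanishes on the others.\<close>
    case False
    have yt: "ys @ [t] \<in> simplices Q (n + 1)" using snoc ys False by simp
    show ?thesis
    proof (rule k.finsum_eq_single[OF finite_faces[OF assms(2)] _ cc[OF ys]])
      show "(ys @ [t], length ys) \<in> faces Q (n + 1) ys" using yt by (simp add: faces_def)
      show "minus_one_pow k (snd (ys @ [t], length ys)) \<otimes>\<^bsub>k\<^esub> e (fst (ys @ [t], length ys)) = c ys"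
        using e_snoc[OF yt] ss cc[OF ys] by simp
      show "minus_one_pow k (snd x) \<otimes>\<^bsub>k\<^esub> e (fst x) = \<zero>\<^bsub>k\<^esub>"
        if x: "x \<in> faces Q (n + 1) ys" "x \<noteq> (ys @ [t], length ys)" for x
      proof -
        obtain xs i where xi: "x = (xs, i)" by (cases x)
        have xs: "xs \<in> simplices Q (n + 1)" "i < length xs" "take i xs @ drop (Suc i) xs = ys"
          using x(1) by (auto simp: xi faces_def)
        have "t \<notin> set xs"
        proof
          assume "t \<in> set xs"
          then obtain ws where ws: "xs = ws @ [t]" using last_t[OF xs(1)] by (metis append_butlast_last_id)
          have "i = length ws"
          proof (rule ccontr)
            assume "i \<noteq> length ws"
            then have "i < length ws" using xs(2) ws by simp
            then have "t \<in> set ys" using xs(3) by (auto simp: ws)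
            then show False using False by simp
          qed
          then show False using x(2) xs(3) by (simp add: xi ws)
        qed
        then show ?thesis using e_zero[OF xs(1)] s by (simp add: xi)
      qed
    qed
  next
    case True
    then obtain zs where zs: "ys = zs @ [t]" using last_t[OF ys] by (metis append_butlast_last_id)
    have zs': "zs \<in> simplices Q (n - 1)" "t \<notin> set zs" using snoc[of zs "n - 1"] ys zs by simp_all
    \<comment> \<open>Every coface of \<open>ys = zs @ [t]\<close> ends in \<open>t\<close>, so it
      comes from a coface of \<open>zs\<close> without \<open>t\<close>. The cycle condition at
      \<open>zs\<close> will evaluate the sum over these.\<close>
    define E where "E = {x \<in> faces Q n zs. t \<notin> set (fst x)}"
    have E: "fst x \<in> simplices Q n" "length (fst x) = Suc (length zs)" "t \<notin> set (fst x)"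
      "snd x < length (fst x)" "take (snd x) (fst x) @ drop (Suc (snd x)) (fst x) = zs" if "x \<in> E" for x
    proof -
      obtain xs i where xi: "x = (xs, i)" by (cases x)
      have xs: "xs \<in> simplices Q n" "t \<notin> set xs" "i < length xs" "take i xs @ drop (Suc i) xs = zs"
        using that unfolding E_def faces_def xi by simp_all
      have "length zs = length xs - 1" using xs(3) by (subst xs(4)[symmetric]) simp
      then show "fst x \<in> simplices Q n" "length (fst x) = Suc (length zs)" "t \<notin> set (fst x)"
        "snd x < length (fst x)" "take (snd x) (fst x) @ drop (Suc (snd x)) (fst x) = zs"
        using xs by (simp_all add: xi)
    qed
    have finE: "finite E" using finite_faces[OF assms(2), of n zs] by (simp add: E_def)
    have sE: "(\<lambda>x. minus_one_pow k (snd x) \<otimes>\<^bsub>k\<^esub> c (fst x)) \<in> E \<rightarrow> carrier k" using E(1) cc s by auto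
    have delete_snoc: "(xs @ [t], i) \<in> faces Q (n + 1) ys \<longleftrightarrow> (xs, i) \<in> E" for xs i
    proof
      assume L: "(xs @ [t], i) \<in> faces Q (n + 1) ys"
      then have L': "xs \<in> simplices Q n" "t \<notin> set xs" "i \<le> length xs"
        "take i (xs @ [t]) @ drop (Suc i) (xs @ [t]) = zs @ [t]"
        using snoc[of xs n] by (auto simp: faces_def zs)
      have "i \<noteq> length xs"
      proof
        assume "i = length xs"
        then have "xs = zs @ [t]" using L'(4) by simp
        then show False using L'(2) by simp
      qed
      then show "(xs, i) \<in> E" using L' by (simp add: E_def faces_def Suc_diff_le)
    next
      assume "(xs, i) \<in> E"
      from E[OF this] show "(xs @ [t], i) \<in> faces Q (n + 1) ys"
        using snoc[of xs n] by (simp add: faces_def zs Suc_le_eq)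
    qed
    let ?h = "\<lambda>x :: 'b list \<times> nat. (fst x @ [t], snd x)"
    have im: "faces Q (n + 1) ys = ?h ` E"
    proof
      show "?h ` E \<subseteq> faces Q (n + 1) ys" using delete_snoc by auto
      show "faces Q (n + 1) ys \<subseteq> ?h ` E"
      proof
        fix x assume x: "x \<in> faces Q (n + 1) ys"
        obtain xs i where xi: "x = (xs, i)" by (cases x)
        have xs: "xs \<in> simplices Q (n + 1)" "take i xs @ drop (Suc i) xs = ys"
          using x by (auto simp: xi faces_def)
        have "t \<in> set xs"
        proof -
          have "t \<in> set (take i xs @ drop (Suc i) xs)" using xs(2) True by simp
          then show ?thesis by (auto dest: in_set_takeD in_set_dropD)
        qed
        then obtain ws where "xs = ws @ [t]" using last_t[OF xs(1)] by (metis append_butlast_last_id)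
        then show "x \<in> ?h ` E" using x delete_snoc[of ws i] by (auto simp: xi intro!: image_eqI[of _ _ "(ws, i)"])
      qed
    qed
    have inj: "inj_on ?h E" by (rule inj_onI) (auto simp: prod_eq_iff)
    have eh: "e (fst (?h x)) = minus_one_pow k (Suc (length zs)) \<otimes>\<^bsub>k\<^esub> c (fst x)" if "x \<in> E" for x
      using e_snoc[of "fst x"] snoc[of "fst x" n] E(1-3)[OF that] by simp
    have "(\<Oplus>\<^bsub>k\<^esub>x\<in>faces Q (n + 1) ys. minus_one_pow k (snd x) \<otimes>\<^bsub>k\<^esub> e (fst x)) =
        (\<Oplus>\<^bsub>k\<^esub>x\<in>E. minus_one_pow k (snd (?h x)) \<otimes>\<^bsub>k\<^esub> e (fst (?h x)))"
      unfolding im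
    proof (rule k.finsum_reindex[OF _ inj])
      show "(\<lambda>x. minus_one_pow k (snd x) \<otimes>\<^bsub>k\<^esub> e (fst x)) \<in> ?h ` E \<rightarrow> carrier k"
        unfolding im[symmetric] using ec s by (auto simp: faces_def)
    qed
    also have "\<dots> = (\<Oplus>\<^bsub>k\<^esub>x\<in>E. minus_one_pow k (Suc (length zs)) \<otimes>\<^bsub>k\<^esub> (minus_one_pow k (snd x) \<otimes>\<^bsub>k\<^esub> c (fst x)))"
    proof (rule k.finsum_cong'[OF refl])
      show "(\<lambda>x. minus_one_pow k (Suc (length zs)) \<otimes>\<^bsub>k\<^esub> (minus_one_pow k (snd x) \<otimes>\<^bsub>k\<^esub> c (fst x))) \<in> E \<rightarrow> carrier k"
        using sE s by (auto simp: Pi_iff)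
      show "minus_one_pow k (snd (?h x)) \<otimes>\<^bsub>k\<^esub> e (fst (?h x)) =
          minus_one_pow k (Suc (length zs)) \<otimes>\<^bsub>k\<^esub> (minus_one_pow k (snd x) \<otimes>\<^bsub>k\<^esub> c (fst x))" if "x \<in> E" for x
        unfolding eh[OF that] snd_conv by (rule k.m_lcomm[OF s s cc[OF E(1)[OF that]]])
    qed
    also have "\<dots> = minus_one_pow k (Suc (length zs)) \<otimes>\<^bsub>k\<^esub> (\<Oplus>\<^bsub>k\<^esub>x\<in>E. minus_one_pow k (snd x) \<otimes>\<^bsub>k\<^esub> c (fst x))"
      by (rule k.finsum_rdistr[symmetric, OF finE s sE])
    also have "(\<Oplus>\<^bsub>k\<^esub>x\<in>E. minus_one_pow k (snd x) \<otimes>\<^bsub>k\<^esub> c (fst x)) = minus_one_pow k (Suc (length zs)) \<otimes>\<^bsub>k\<^esub> c ys"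
    proof -
      \<comment> \<open>The only coface of \<open>zs\<close> that contains \<open>t\<close> is
        \<open>ys\<close> itself, with \<open>t\<close> deleted.\<close>
      have fE: "faces Q n zs = insert (ys, length zs) E"
      proof
        show "insert (ys, length zs) E \<subseteq> faces Q n zs" using ys by (auto simp: E_def faces_def zs)
        show "faces Q n zs \<subseteq> insert (ys, length zs) E"
        proof
          fix x assume x: "x \<in> faces Q n zs"
          obtain xs i where xi: "x = (xs, i)" by (cases x)
          have xs: "xs \<in> simplices Q n" "i < length xs" "take i xs @ drop (Suc i) xs = zs"
            using x by (auto simp: xi faces_def)
          show "x \<in> insert (ys, length zs) E"
          proof (cases "t \<in> set xs")
            case True
            then obtain ws where ws: "xs = ws @ [t]" using last_t[OF xs(1)] by (metis append_butlast_last_id)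
            have "i = length ws"
            proof (rule ccontr)
              assume "i \<noteq> length ws"
              then have "i < length ws" using xs(2) ws by simp
              then have "t \<in> set zs" using xs(3) by (auto simp: ws)
              then show False using zs'(2) by simp
            qed
            then show ?thesis using xs(3) by (simp add: xi ws zs)
          qed (use x in \<open>simp add: E_def xi\<close>)
        qed
      qed
      have nE: "(ys, length zs) \<notin> E" by (simp add: E_def zs)
      \<comment> \<open>The cycle condition at \<open>zs\<close> makes the sum over \<open>E\<close>
        the negative of the term of \<open>ys\<close>; the minus sign accounts for the exponent
        \<open>Suc (length zs)\<close>.\<close>
      have "boundary k Q n c zs = \<zero>\<^bsub>k\<^esub>" using cyc zs'(1) by (simp add: sel)
      then have "(\<Oplus>\<^bsub>k\<^esub>x\<in>faces Q n zs. minus_one_pow k (snd x) \<otimes>\<^bsub>k\<^esub> c (fst x)) = \<zero>\<^bsub>k\<^esub>"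
        using zs'(1) by (simp add: boundary_faces)
      moreover have "(\<Oplus>\<^bsub>k\<^esub>x\<in>faces Q n zs. minus_one_pow k (snd x) \<otimes>\<^bsub>k\<^esub> c (fst x)) =
          minus_one_pow k (length zs) \<otimes>\<^bsub>k\<^esub> c ys \<oplus>\<^bsub>k\<^esub> (\<Oplus>\<^bsub>k\<^esub>x\<in>E. minus_one_pow k (snd x) \<otimes>\<^bsub>k\<^esub> c (fst x))"
        unfolding fE using k.finsum_insert[OF finE nE sE] cc[OF ys] by simp
      ultimately have "(\<Oplus>\<^bsub>k\<^esub>x\<in>E. minus_one_pow k (snd x) \<otimes>\<^bsub>k\<^esub> c (fst x)) \<oplus>\<^bsub>k\<^esub> minus_one_pow k (length zs) \<otimes>\<^bsub>k\<^esub> c ys = \<zero>\<^bsub>k\<^esub>"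
        using k.a_comm[OF k.finsum_closed[OF sE] k.m_closed[OF s cc[OF ys]]] by simp
      from k.minus_equality[OF this k.m_closed[OF s cc[OF ys]] k.finsum_closed[OF sE]]
      have "(\<Oplus>\<^bsub>k\<^esub>x\<in>E. minus_one_pow k (snd x) \<otimes>\<^bsub>k\<^esub> c (fst x)) = \<ominus>\<^bsub>k\<^esub> (minus_one_pow k (length zs) \<otimes>\<^bsub>k\<^esub> c ys)" ..
      then show ?thesis using cc[OF ys] by (simp add: k.l_minus k.r_minus)
    qed
    also have "minus_one_pow k (Suc (length zs)) \<otimes>\<^bsub>k\<^esub> (minus_one_pow k (Suc (length zs)) \<otimes>\<^bsub>k\<^esub> c ys) = c ys"
      by (rule ss[OF cc[OF ys]])
    finally show ?thesis .
  qed
  then have "boundary k Q (n + 1) e = c"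
    unfolding boundary_faces
    by (intro extensionalityI[of _ "simplices Q n"]) (use c in \<open>simp_all add: sel PiE_def\<close>)
  then show "c \<in> boundary k Q (n + 1) ` carrier (chain_space k Q (n + 1))" using e by blast
qed

section \<open>The main theorem\<close>

lemma lhom_restrict_scalars:
  "f \<in> lhom A M N \<Longrightarrow> K \<subseteq> carrier A \<Longrightarrow> f \<in> lhom (A\<lparr>carrier := K\<rparr>) M N"
  by (auto simp: lhom_def module_hom_def)

text \<open>The bijection \<open>s\<close> pairs summands that are equal; all unpaired summands are
  zero, so reindexing and filling up with zeros is invertible.\<close>

lemma isom_direct_sum_match:
  assumes M: "\<And>i. i \<in> I \<Longrightarrow> module A (M i)" and N: "\<And>k. k \<in> J \<Longrightarrow> module A (N k)"
    and s: "bij_betw s J\<^sub>0 I\<^sub>0" "J\<^sub>0 \<subseteq> J" "I\<^sub>0 \<subseteq> I" "\<And>k. k \<in> J\<^sub>0 \<Longrightarrow> N k = M (s k)"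
    and zero: "\<And>i. i \<in> I \<Longrightarrow> i \<notin> I\<^sub>0 \<Longrightarrow> zero_module (M i)" "\<And>k. k \<in> J \<Longrightarrow> k \<notin> J\<^sub>0 \<Longrightarrow> zero_module (N k)"
  shows "isom A (finite_direct_sum I M) (finite_direct_sum J N)"
proof -
  have z: "\<zero>\<^bsub>N k\<^esub> \<in> carrier (N k)" "\<zero>\<^bsub>N k\<^esub> \<oplus>\<^bsub>N k\<^esub> \<zero>\<^bsub>N k\<^esub> = \<zero>\<^bsub>N k\<^esub>"
    "\<And>a. a \<in> carrier A \<Longrightarrow> a \<odot>\<^bsub>N k\<^esub> \<zero>\<^bsub>N k\<^esub> = \<zero>\<^bsub>N k\<^esub>" if "k \<in> J" for k
  proof -
    interpret module A "N k" by (rule N[OF that])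
    show "\<zero>\<^bsub>N k\<^esub> \<in> carrier (N k)" "\<zero>\<^bsub>N k\<^esub> \<oplus>\<^bsub>N k\<^esub> \<zero>\<^bsub>N k\<^esub> = \<zero>\<^bsub>N k\<^esub>"
      "\<And>a. a \<in> carrier A \<Longrightarrow> a \<odot>\<^bsub>N k\<^esub> \<zero>\<^bsub>N k\<^esub> = \<zero>\<^bsub>N k\<^esub>" by auto
  qed
  have zM: "\<zero>\<^bsub>M i\<^esub> \<in> carrier (M i)" if "i \<in> I" for i
    using abelian_monoid.zero_closed[OF abelian_group.axioms(1)[OF module.axioms(2)[OF M[OF that]]]] .
  define t where "t = inv_into J\<^sub>0 s"
  have sI: "s k \<in> I\<^sub>0" "s k \<in> I" "t (s k) = k" if "k \<in> J\<^sub>0" for k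
    using that s(1,3) by (auto simp: t_def bij_betw_def)
  have tJ: "t i \<in> J\<^sub>0" "t i \<in> J" "s (t i) = i" if "i \<in> I\<^sub>0" for i
    using that s(1,2) by (auto simp: t_def bij_betw_def inv_into_into f_inv_into_f)
  let ?S = "finite_direct_sum I M" and ?R = "finite_direct_sum J N"
  let ?f = "\<lambda>x. \<lambda>k\<in>J. if k \<in> J\<^sub>0 then x (s k) else \<zero>\<^bsub>N k\<^esub>"
  let ?g = "\<lambda>y. \<lambda>i\<in>I. if i \<in> I\<^sub>0 then y (t i) else \<zero>\<^bsub>M i\<^esub>"
  have xM: "x i \<in> carrier (M i)" if "x \<in> carrier ?S" "i \<in> I" for x i
    using that by (auto simp: finite_direct_sum_def)
  have yN: "y k \<in> carrier (N k)" if "y \<in> carrier ?R" "k \<in> J" for y k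
    using that by (auto simp: finite_direct_sum_def)
  have f: "?f x \<in> carrier ?R" if "x \<in> carrier ?S" for x
    using xM[OF that] s(4) sI z(1) by (simp add: finite_direct_sum_def restrict_PiE_iff)
  have g: "?g y \<in> carrier ?S" if "y \<in> carrier ?R" for y
  proof -
    have "y (t i) \<in> carrier (M i)" if "i \<in> I\<^sub>0" for i
      using yN[OF \<open>y \<in> carrier ?R\<close> tJ(2)[OF that]] s(4)[OF tJ(1)[OF that]] tJ(3)[OF that] by simp
    then show ?thesis using zM by (simp add: finite_direct_sum_def restrict_PiE_iff)
  qed
  have "?f \<in> module_hom A ?S ?R"
  proof (rule module_homI[OF f], assumption, goal_cases)
    case (1 x y)
    show ?case
      unfolding finite_direct_sum_def ring.simps
      by (rule restrict_ext) (use z(2) s(4) sI in simp)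
  next
    case (2 a x)
    show ?case
      unfolding finite_direct_sum_def module.simps
      by (rule restrict_ext) (use 2 z(3) s(4) sI in simp)
  qed
  moreover have "bij_betw ?f (carrier ?S) (carrier ?R)"
  proof (rule bij_betw_byWitness[where f' = ?g])
    show "\<forall>x\<in>carrier ?S. ?g (?f x) = x"
    proof
      fix x assume x: "x \<in> carrier ?S"
      show "?g (?f x) = x"
      proof (rule extensionalityI[of _ I, OF restrict_extensional])
        show "x \<in> extensional I" using x by (simp add: finite_direct_sum_def PiE_def)
        show "?g (?f x) i = x i" if "i \<in> I" for i
          using xM[OF x that] that tJ zero(1)[OF that] by (auto simp: zero_module_def)
      qed
    qed
    show "\<forall>y\<in>carrier ?R. ?f (?g y) = y"
    proof
      fix y assume y: "y \<in> carrier ?R"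
      show "?f (?g y) = y"
      proof (rule extensionalityI[of _ J, OF restrict_extensional])
        show "y \<in> extensional J" using y by (simp add: finite_direct_sum_def PiE_def)
        show "?f (?g y) k = y k" if "k \<in> J" for k
          using yN[OF y that] that sI zero(2)[OF that] by (auto simp: zero_module_def)
      qed
    qed
  qed (use f g in auto)
  ultimately show ?thesis unfolding isom_def by blast
qed

section \<open>The derived functors of the limit for an exact functor\<close>

context module_functor
begin

text \<open>\<open>T f\<close> is conjugate to a map between zeroth derived functors. If
  \<open>m\<close> or \<open>n\<close> is positive, one of its ends is zero; otherwise the
  hypothesis on homomorphisms is about this very map.\<close>

lemma zero_maps_if_no_homs:
  assumes M: "module A M" and N: "module A N" and f: "f \<in> lhom A M N"
    and h: "\<And>i. i \<noteq> m \<Longrightarrow> zero_module (right_derived A T i M)"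
      "\<And>i. i \<noteq> n \<Longrightarrow> zero_module (right_derived A T i N)"
    and hom: "lhom A (right_derived A T n N) (right_derived A T m M)
      = {lzero (right_derived A T n N) (right_derived A T m M)}"
    and y: "y \<in> carrier (fob T N)"
  shows "far T M N f y = \<zero>\<^bsub>fob T M\<^esub>"
proof -
  note TM = T_module[OF M] and TN = T_module[OF N]
  note RM = right_derived_module[OF M, of 0] and RN = right_derived_module[OF N, of 0]
  interpret TM: module A "fob T M" by (rule TM)
  obtain \<alpha> where \<alpha>: "\<alpha> \<in> module_hom A (fob T N) (right_derived A T 0 N)"
    "bij_betw \<alpha> (carrier (fob T N)) (carrier (right_derived A T 0 N))"
    using right_derived_0[OF N] by (auto simp: isom_def)
  obtain \<beta> where \<beta>: "\<beta> \<in> module_hom A (fob T M) (right_derived A T 0 M)"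
    "bij_betw \<beta> (carrier (fob T M)) (carrier (right_derived A T 0 M))"
    using right_derived_0[OF M] by (auto simp: isom_def)
  have fy: "far T M N f y \<in> carrier (fob T M)" by (rule T_hom(3)[OF M N f y])
  consider "m \<noteq> 0" | "n \<noteq> 0" | "m = 0" "n = 0" by blast
  then show ?thesis
  proof cases
    case 1
    then have "zero_module (fob T M)"
      using isom_zero_module[OF RM TM isom_sym[OF TM right_derived_0[OF M]]] h(1) by simp
    then show ?thesis using fy by (simp add: zero_module_def)
  next
    case 2
    then have "zero_module (fob T N)"
      using isom_zero_module[OF RN TN isom_sym[OF TN right_derived_0[OF N]]] h(2) by simp
    then have "y = \<zero>\<^bsub>fob T N\<^esub>" using y by (simp add: zero_module_def)
    then show ?thesis using module_hom_zero_minus(1)[OF TN TM T_hom(1)[OF M N f]] by simp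
  next
    case 3
    let ?R = "right_derived A T 0 N" and ?inv = "inv_into (carrier (fob T N)) \<alpha>"
    note inv = module_hom_inv_into[OF TN \<alpha>]
    have g: "(\<lambda>x\<in>carrier ?R. \<beta> (far T M N f (?inv x))) \<in> lhom A ?R (right_derived A T 0 M)"
      by (rule restrict_lhom[OF RN], rule module_homI)
        (simp_all only: module_homD[OF inv] module_homD[OF \<beta>(1)] T_hom[OF M N f])
    have \<alpha>y: "\<alpha> y \<in> carrier ?R" "?inv (\<alpha> y) = y"
      using module_homD(1)[OF \<alpha>(1) y] \<alpha>(2) y by (auto simp: bij_betw_def)
    from g have "(\<lambda>x\<in>carrier ?R. \<beta> (far T M N f (?inv x))) = lzero ?R (right_derived A T 0 M)"
      using hom unfolding 3 by blast
    from fun_cong[OF this, of "\<alpha> y"] have "\<beta> (far T M N f y) = \<zero>\<^bsub>right_derived A T 0 M\<^esub>"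
      using \<alpha>y by (simp only: restrict_apply if_True)
    then have "\<beta> (far T M N f y) = \<beta> \<zero>\<^bsub>fob T M\<^esub>" by (simp add: module_hom_zero_minus(1)[OF TM RM \<beta>(1)])
    then show ?thesis using \<beta>(2) fy by (auto simp: bij_betw_def dest: inj_onD)
  qed
qed

text \<open>In positive degrees both sides vanish by exactness; in degree \<open>0\<close> derived
  functors are replaced by \<open>T\<close> and the colimit is computed.\<close>

lemma right_derived_lim_of_exact:
  fixes G :: "('p::order, 'a, 'm) system"
  assumes P: "finite P" and G: "inverse_system A P G" and eqv: "colim_lim_equivalence A P T"
    and h: "\<And>p i. p \<in> P \<Longrightarrow> i \<noteq> h p \<Longrightarrow> zero_module (right_derived A T i (sob G p))"
    and hom: "\<And>p q. p \<in> P \<Longrightarrow> q \<in> P \<Longrightarrow> p \<noteq> q \<Longrightarrow>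
      lhom A (right_derived A T (h p) (sob G p)) (right_derived A T (h q) (sob G q))
      = {lzero (right_derived A T (h p) (sob G p)) (right_derived A T (h q) (sob G q))}"
    and exact: exact_functor
  shows "isom A (right_derived A T j (lim_ob A P G))
    (finite_direct_sum (maximal_elements P) (\<lambda>q. right_derived A T j (sob G q)))"
proof -
  note G' = inverse_systemD[OF G]
  let ?M = "maximal_elements P" and ?L = "lim_ob A P G"
  have MP: "q \<in> P" if "q \<in> ?M" for q using that by (simp add: maximal_elements_def)
  have L: "module A ?L"
    using lim_ob_limit_cone[OF cring inf(1) P G'(1,3)] by (simp add: limit_cone_def cone_def)
  show ?thesis
  proof (cases j)
    case (Suc n)
    show ?thesis
      unfolding Suc
      by (intro zero_isom finite_direct_sum_zero_module exact_right_derived_Suc exact L G'(1) MP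
          finite_direct_sum_module right_derived_module cring)
  next
    case 0
    have zero: "far T (sob G q) (sob G p) (sar G p q) y = \<zero>\<^bsub>fob T (sob G q)\<^esub>"
      if "p \<in> P" "q \<in> P" "p \<le> q" "p \<noteq> q" "y \<in> carrier (fob T (sob G p))" for p q y
      by (rule zero_maps_if_no_homs[OF G'(1) G'(1) G'(3) h h hom]) (use that in auto)
    have "isom A (right_derived A T 0 ?L) (fob T ?L)"
      by (rule isom_sym[OF T_module[OF L] right_derived_0[OF L]])
    also have "isom A (fob T ?L) (finite_direct_sum ?M (\<lambda>q. fob T (sob G q)))"
      by (rule T_lim_if_zero_maps[OF P G eqv zero])
    also have "isom A (finite_direct_sum ?M (\<lambda>q. fob T (sob G q)))
        (finite_direct_sum ?M (\<lambda>q. right_derived A T 0 (sob G q)))"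
      by (rule isom_finite_direct_sum[OF right_derived_0[OF G'(1)[OF MP]]])
    finally show ?thesis by (simp add: 0)
  qed
qed

end

lemma inverse_system_restrict:
  assumes "inverse_system A (hat P) V" shows "inverse_system A P (restrict_system V)"
proof -
  have Fin: "Fin p \<in> hat P" if "p \<in> P" for p using that by (simp add: hat_def)
  note V = assms[unfolded inverse_system_def]
  show ?thesis
    unfolding inverse_system_def restrict_system_def system.simps
  proof (intro conjI ballI impI)
    fix p assume "p \<in> P"
    then show "module A (sob V (Fin p))" "sar V (Fin p) (Fin p) = lid (sob V (Fin p))"
      using conjunct1[OF V] Fin by auto
  next
    fix p q assume "p \<in> P" "q \<in> P" "p \<le> q"
    then show "sar V (Fin p) (Fin q) \<in> lhom A (sob V (Fin q)) (sob V (Fin p))"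
      using conjunct1[OF conjunct2[OF V]] Fin by simp
  next
    fix p q r assume "p \<in> P" "q \<in> P" "r \<in> P" "p \<le> q" "q \<le> r"
    then show "sar V (Fin p) (Fin r) = compose (carrier (sob V (Fin r))) (sar V (Fin p) (Fin q)) (sar V (Fin q) (Fin r))"
      using conjunct2[OF conjunct2[OF V]] Fin by (meson less_eq_extended.simps(1))
  qed
qed

theorem theorem7p2:
  fixes A :: "'a ring" and K :: "'a set" and P :: "'p::order set"
    and V :: "('p extended, 'a, 'm) system"
    and T :: "('a, 'm, 'n) mfunctor"
    and h :: "'p \<Rightarrow> nat" and j :: nat
  assumes "cring A" and "noetherian_ring A" and "subfield K A"
    and "large_universe A TYPE('m)" and "large_universe A TYPE('n)"
    and "finite P"
    and "contravariant_functor A T" and "left_exact A T"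
    and "commutes_with_finite_direct_sums A T"
    and "inverse_system A (hat P) V"
    and "lim_acyclic A P (restrict_system V)"
    and "colim_lim_equivalence A P T"
    and "\<forall>p\<in>P. \<forall>i. i \<noteq> h p \<longrightarrow> zero_module (right_derived A T i (sob V (Fin p)))"
    and "\<forall>p\<in>P. \<forall>q\<in>P. p \<noteq> q \<longrightarrow>
           lhom A (right_derived A T (h p) (sob V (Fin p))) (right_derived A T (h q) (sob V (Fin q)))
           = {\<lambda>x\<in>carrier (right_derived A T (h p) (sob V (Fin p))).
                \<zero>\<^bsub>right_derived A T (h q) (sob V (Fin q))\<^esub>}"
  shows "\<exists>f. f \<in> liso (A\<lparr>carrier := K\<rparr>)
           (right_derived A T j (lim_ob A P (restrict_system V)))
           (finite_direct_sum (SIGMA q:P. {..<reduced_betti (A\<lparr>carrier := K\<rparr>) {z \<in> P. q < z} (int (h q) - int j - 1)})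
             (\<lambda>(q, _). right_derived A T (h q) (sob V (Fin q))))"
proof -
  interpret module_functor A T
    by (rule module_functor.intro) fact+
  let ?G = "restrict_system V" and ?M = "maximal_elements P" and ?K = "A\<lparr>carrier := K\<rparr>"
  let ?R = "\<lambda>i q. right_derived A T i (sob V (Fin q))"
  let ?m = "\<lambda>q. reduced_betti ?K {z \<in> P. q < z} (int (h q) - int j - 1)"
  let ?J = "SIGMA q:P. {..<?m q}" and ?N = "\<lambda>(q, _ :: nat). ?R (h q) q"
  have sobG: "sob ?G p = sob V (Fin p)" for p by (simp add: restrict_system_def)
  have G: "inverse_system A P ?G" by (rule inverse_system_restrict[OF assms(10)])
  note G' = inverse_systemD[OF G] and V' = inverse_systemD(1)[OF G, unfolded sobG]
  have MP: "q \<in> P" if "q \<in> ?M" for q using that by (simp add: maximal_elements_def)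
  have h0: "zero_module (?R i p)" if "p \<in> P" "i \<noteq> h p" for p i using assms(13) that by blast
  have field: "field ?K" by (rule A.subfield_iff(2)[OF assms(3)])
  have finP: "finite {z \<in> P. q < z}" for q using assms(6) by simp
  have L: "module A (lim_ob A P ?G)"
    using lim_ob_limit_cone[OF assms(1) inf(1) assms(6) G'(1,3)] by (simp add: limit_cone_def cone_def)
  let ?uniq = "\<forall>p\<in>P. \<forall>b\<in>?M. \<forall>c\<in>?M. p \<le> b \<longrightarrow> p \<le> c \<longrightarrow> b = c"
  have cases: ?uniq if "\<not> exact_functor"
    using exact_functor_if_not_unique_maximal[OF assms(6,12)] that by blast
  \<comment> \<open>The distinction is made on exactness of \<open>T\<close>, not on the shape of
    \<open>P\<close>; the failure of exactness supplies the shape.\<close>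
  have "isom A (right_derived A T j (lim_ob A P ?G)) (finite_direct_sum ?M (\<lambda>q. ?R j q))"
  proof (cases exact_functor)
    case True
    show ?thesis
      using right_derived_lim_of_exact[OF assms(6) G assms(12), of h j, unfolded sobG] assms(13,14) True by blast
  next
    case False
    show ?thesis
      using right_derived_lim_of_unique_maximal[OF assms(6) G, of j, unfolded sobG] cases[OF False] by blast
  qed
  moreover have "isom A (finite_direct_sum ?M (\<lambda>q. ?R j q)) (finite_direct_sum ?J ?N)"
  \<comment> \<open>The summands that may be nonzero on both sides are those of maximal
    \<open>q\<close> with \<open>h q = j\<close>, each with the single copy number
    \<open>0\<close>.\<close>
  proof (rule isom_direct_sum_match[where s = fst and J\<^sub>0 = "{q \<in> ?M. h q = j} \<times> {0}" and I\<^sub>0 = "{q \<in> ?M. h q = j}"])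
    have m_max: "?m q = (if h q = j then 1 else 0)" if "q \<in> ?M" for q
    proof -
      \<comment> \<open>The empty complex has homology only in degree \<open>-1\<close>, and
        \<open>h q - j - 1 = -1\<close> means \<open>h q = j\<close>.\<close>
      have "{z \<in> P. q < z} = {}" using that by (auto simp: maximal_elements_def)
      show ?thesis unfolding \<open>{z \<in> P. q < z} = {}\<close> reduced_betti_empty[OF field] by simp
    qed
    show "{q \<in> ?M. h q = j} \<times> {0} \<subseteq> ?J"
    proof
      fix k assume "k \<in> {q \<in> ?M. h q = j} \<times> {0 :: nat}"
      then obtain q where q: "k = (q, 0)" "q \<in> ?M" "h q = j" by auto
      then have "?m q = 1" unfolding m_max[OF q(2)] by simp
      then show "k \<in> ?J" using q(1) MP[OF q(2)] by simp
    qed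
    show "bij_betw fst ({q \<in> ?M. h q = j} \<times> {0 :: nat}) {q \<in> ?M. h q = j}"
      by (auto simp: bij_betw_def inj_on_def)
    show "zero_module (?R j q)" if "q \<in> ?M" "q \<notin> {q \<in> ?M. h q = j}" for q
      using that h0 MP by auto
    show "zero_module (?N k)" if k: "k \<in> ?J" "k \<notin> {q \<in> ?M. h q = j} \<times> {0}" for k
    proof -
      obtain q l where ql: "k = (q, l)" "q \<in> P" "l < ?m q" using k(1) by auto
      \<comment> \<open>For maximal \<open>q\<close> the multiplicity is at most one, so a copy
        number can only be \<open>0\<close>, with \<open>h q = j\<close>; this index is already
        matched.\<close>
      have qM: "q \<notin> ?M" using k(2) ql m_max[of q] by (auto split: if_splits)
      obtain t where t: "t \<in> ?M" "q \<le> t" using ex_maximal_above[OF assms(6) ql(2)] by blast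
      then have "q \<noteq> t" using qM by blast
      then have qt: "t \<in> {z \<in> P. q < z}" using t MP by (simp add: order.strict_iff_order)
      have "exact_functor"
      proof (rule ccontr)
        assume "\<not> exact_functor"
        note uniq = cases[OF this]
        \<comment> \<open>Any \<open>z\<close> above \<open>q\<close> lies below some maximal
          element, and that one must be \<open>t\<close>, since both are above \<open>q\<close>. The
          interval is a cone with apex \<open>t\<close>.\<close>
        have "z \<le> t" if "z \<in> {z \<in> P. q < z}" for z
        proof -
          obtain s where s: "s \<in> ?M" "z \<le> s" using ex_maximal_above[OF assms(6), of z] \<open>z \<in> {z \<in> P. q < z}\<close> by blast
          moreover have "q \<le> s" using that s(2) by auto
          ultimately show ?thesis using uniq ql(2) t by blast
        qed
        then have "?m q = 0" by (rule reduced_betti_cone[OF field finP qt])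
        then show False using ql(3) by simp
      qed
      \<comment> \<open>For \<open>h q = 0\<close> the degree is \<open>- j - 1\<close>: it is
        \<open>-1\<close> for \<open>j = 0\<close>, where a nonempty complex has no homology, and
        otherwise there are no simplices.\<close>
      moreover have "h q \<noteq> 0"
      proof
        assume hq: "h q = 0"
        have "?m q = 0"
        proof (cases j)
          case 0
          then show ?thesis using reduced_betti_minus_one_nonempty[OF field finP qt] hq by simp
        next
          case (Suc n)
          then show ?thesis
            using reduced_betti_no_simplices[OF field finP simplices_empty_iff(1)] hq by simp
        qed
        then show False using ql(3) by simp
      qed
      ultimately have "zero_module (?R (h q) q)"
        using exact_right_derived_Suc[OF _ V'[OF ql(2)]] by (cases "h q") auto
      then show ?thesis by (simp add: ql)
    qed
  qed (use MP V' right_derived_module in auto)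
  ultimately have "isom A (right_derived A T j (lim_ob A P ?G)) (finite_direct_sum ?J ?N)"
    by (rule isom_trans)
  then obtain f where f: "f \<in> module_hom A (right_derived A T j (lim_ob A P ?G)) (finite_direct_sum ?J ?N)"
    "bij_betw f (carrier (right_derived A T j (lim_ob A P ?G))) (carrier (finite_direct_sum ?J ?N))"
    by (auto simp: isom_def)
  \<comment> \<open>Morphisms in \<open>liso\<close> are extensional, so the map is restricted to
    the carrier before the scalars are cut down to \<open>K\<close>.\<close>
  let ?f = "\<lambda>x\<in>carrier (right_derived A T j (lim_ob A P ?G)). f x"
  have "?f \<in> lhom A (right_derived A T j (lim_ob A P ?G)) (finite_direct_sum ?J ?N)"
    by (rule restrict_lhom[OF right_derived_module[OF L] f(1)])
  moreover have "K \<subseteq> carrier A" by (rule subfieldE(3)[OF assms(3)])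
  ultimately have "?f \<in> lhom ?K (right_derived A T j (lim_ob A P ?G)) (finite_direct_sum ?J ?N)"
    by (rule lhom_restrict_scalars)
  moreover have "bij_betw ?f (carrier (right_derived A T j (lim_ob A P ?G))) (carrier (finite_direct_sum ?J ?N))"
    using f(2) bij_betw_cong[of _ ?f f] by (simp only: restrict_apply if_True)
  ultimately show ?thesis unfolding liso_def by blast
qed

end
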